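(* Let $\mathcal F$ denote the location-scale Gaussian density family on $\mathbb R^d$ with parameter space $\Theta=[-a,a]^d\times\Omega$, where $a>0$ and $\Omega$ is a compact subset of $\mathbb S^d_{++}$ (positive definite $d\times d$ matrices) whose eigenvalues lie in a closed interval contained in $(0,\infty)$, and $\Theta$ has nonempty interior. Let $k\ge k_0\ge1$ and $G_0=\sum_{j=1}^{k_0}p_j^0\delta_{(\mu_j^0,\Sigma_j^0)}\in\mathcal E_{k_0}(\Theta)$. Then there exists a constant $C(G_0)>0$, depending only on $G_0,k,d,\Theta$, such that for all $n\ge2$, $$\mathbb E\big[\overline{\mathcal D}(\widehat G_n,G_0)\big]\le C(G_0)\frac{\log n}{\sqrt n},$$ where $\widehat G_n$ is the penalized maximum likelihood estimator of order at most $k$ with tuning parameter $\xi_n=\log n$, based on $n$ i.i.d. observations from $p_{G_0}$.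
   Context: Setting. $f(x|\mu,\Sigma)$ is the density on $\mathbb R^d$ of the Gaussian distribution with mean $\mu$ and covariance $\Sigma$, with respect to Lebesgue measure, and $\mathcal F=\{f(\cdot|\theta):\theta=(\mu,\Sigma)\in\Theta\}$. A mixing measure is a finitely supported probability measure $G=\sum_{j=1}^{k'}p_j\delta_{\theta_j}$ on $\Theta$ (distinct atoms, weights $p_j>0$); $k'$ is its order. $\mathcal O_k(\Theta)$ is the set of mixing measures of order at most $k$, and $\mathcal E_k(\Theta)=\mathcal O_k(\Theta)\setminus\mathcal O_{k-1}(\Theta)$. Put $p_G(x)=\int f(x|\theta)\,dG(\theta)$. Estimator. $X_1,\dots,X_n$ are i.i.d. with density $p_{G_0}$. The penalized MLE is $\widehat G_n\in\arg\max_{G\in\mathcal O_k(\Theta)}\{\sum_{i=1}^n\log p_G(X_i)+\xi_n\rho(G)\}$ with $\rho(G)=\sum_{j=1}^{k'}\log p_j$ for $G=\sum_{j=1}^{k'}p_j\delta_{\theta_j}$ of order $k'\le k$. The integers $\bar r(k')$. For $k'\ge2$, $\bar r(k')$ is the smallest integer $r\ge1$ such that the system of polynomial equations $$\sum_{j=1}^{k'}\ \sum_{n_1,n_2}\frac{c_j^2a_j^{n_1}b_j^{n_2}}{n_1!\,n_2!}=0,\qquad\alpha=1,\dots,r,$$ where the inner sum is over all nonnegative integers $n_1,n_2$ with $n_1+2n_2=\alpha$, has no nontrivial solution in the real unknowns $(a_j,b_j,c_j)_{j=1}^{k'}$; a solution is nontrivial if all $c_j$ are nonzero and at least one $a_j$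 is nonzero. Loss function. For $G=\sum_{i=1}^{k'}p_i\delta_{(\mu_i,\Sigma_i)}\in\mathcal E_{k'}(\Theta)$, $k'\le k$, define $\mathcal A_j=\mathcal A_j(G)=\{i\in\{1,\dots,k'\}:\|\mu_i-\mu_j^0\|+\|\Sigma_i-\Sigma_j^0\|\le\|\mu_i-\mu_\ell^0\|+\|\Sigma_i-\Sigma_\ell^0\|\ \forall\ell\ne j\}$ for $1\le j\le k_0$ (Euclidean/Frobenius norms), and $$\overline{\mathcal D}(G,G_0)=\sum_{j:|\mathcal A_j|=1}\sum_{i\in\mathcal A_j}p_i\big(\|\mu_i-\mu_j^0\|+\|\Sigma_i-\Sigma_j^0\|\big)+\sum_{j:|\mathcal A_j|>1}\sum_{i\in\mathcal A_j}p_i\Big(\|\mu_i-\mu_j^0\|^{\bar r(|\mathcal A_j|)}+\|\Sigma_i-\Sigma_j^0\|^{\bar r(|\mathcal A_j|)/2}\Big)+\sum_{j=1}^{k_0}\Big|\sum_{i\in\mathcal A_j}p_i-p_j^0\Big|.$$ *)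

theory Defs
  imports "HOL-Probability.Probability"
begin

text \<open>
  A parameter is a pair of a mean and a covariance matrix. The library norm on
  \<^typ>\<open>real^'d^'d\<close> is the Frobenius norm.
\<close>

type_synonym 'd param = "(real^'d) \<times> (real^'d^'d)"

definition symmetric_mats :: "(real^'d^'d) set" where
  "symmetric_mats = {S. transpose S = S}"

definition pos_def_mats :: "(real^'d^'d) set" where
  "pos_def_mats = {S \<in> symmetric_mats. \<forall>v. v \<noteq> 0 \<longrightarrow> v \<bullet> (S *v v) > 0}"

definition eigenvalues :: "real^'d^'d \<Rightarrow> real set" where
  "eigenvalues S = {l. \<exists>v. v \<noteq> 0 \<and> S *v v = l *\<^sub>R v}"

definition gaussian_density :: "'d::finite param \<Rightarrow> real^'d \<Rightarrow> real" where
  "gaussian_density = (\<lambda>(\<mu>, S) x.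
     exp (- ((x - \<mu>) \<bullet> (matrix_inv S *v (x - \<mu>))) / 2) / sqrt ((2 * pi) ^ CARD('d) * det S))"

definition param_space :: "real \<Rightarrow> (real^'d^'d) set \<Rightarrow> 'd::finite param set" where
  "param_space a \<Omega> = {\<mu>. \<forall>i. \<mu> $ i \<in> {-a..a}} \<times> \<Omega>"

text \<open>
  Covariance matrices live in the space of symmetric matrices, which has empty interior in
  \<^typ>\<open>real^'d^'d\<close> if the dimension is at least two. The interior of a parameter space is
  therefore taken relative to the product of the mean space and the symmetric matrices.
\<close>

definition param_interior :: "'d::finite param set \<Rightarrow> 'd param set" where
  "param_interior \<Theta> = (top_of_set (UNIV \<times> symmetric_mats)) interior_of \<Theta>"

text \<open>
  A mixing measure is a \<^term>\<open>pmf\<close> with finite support: its atoms are the elements of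
  \<^term>\<open>set_pmf G\<close>, the weight of an atom \<open>\<theta>\<close> is \<^term>\<open>pmf G \<theta>\<close>, and its order is the number of
  atoms. Below, the atoms themselves take the place of the indices of an enumeration.
\<close>

definition mixing_le :: "nat \<Rightarrow> 'd::finite param set \<Rightarrow> 'd param pmf set" where
  "mixing_le k \<Theta> = {G. finite (set_pmf G) \<and> set_pmf G \<subseteq> \<Theta> \<and> card (set_pmf G) \<le> k}"

definition mixing_eq :: "nat \<Rightarrow> 'd::finite param set \<Rightarrow> 'd param pmf set" where
  "mixing_eq k \<Theta> = mixing_le k \<Theta> - mixing_le (k - 1) \<Theta>"

definition mixture_density :: "'d::finite param pmf \<Rightarrow> real^'d \<Rightarrow> real" where
  "mixture_density G x = (\<integral>\<theta>. gaussian_density \<theta> x \<partial>measure_pmf G)"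

definition sample_measure :: "'d::finite param pmf \<Rightarrow> nat \<Rightarrow> (nat \<Rightarrow> real^'d) measure" where
  "sample_measure G n =
     (\<Pi>\<^sub>M i\<in>{1..n}. density lborel (\<lambda>x. ennreal (mixture_density G x)))"

definition penalty :: "'d::finite param pmf \<Rightarrow> real" where
  "penalty G = (\<Sum>\<theta>\<in>set_pmf G. ln (pmf G \<theta>))"

definition penalized_loglik ::
    "real \<Rightarrow> nat \<Rightarrow> (nat \<Rightarrow> real^'d) \<Rightarrow> 'd::finite param pmf \<Rightarrow> real" where
  "penalized_loglik \<xi> n x G = (\<Sum>i = 1..n. ln (mixture_density G (x i))) + \<xi> * penalty G"

definition is_penalized_mle ::
    "'d::finite param set \<Rightarrow> nat \<Rightarrow> real \<Rightarrow> nat \<Rightarrow> (nat \<Rightarrow> real^'d) \<Rightarrow> 'd param pmf \<Rightarrow> bool" where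
  "is_penalized_mle \<Theta> k \<xi> n x = is_arg_max (penalized_loglik \<xi> n x) (\<lambda>G. G \<in> mixing_le k \<Theta>)"

definition nontrivial_solution ::
    "nat \<Rightarrow> nat \<Rightarrow> (nat \<Rightarrow> real) \<Rightarrow> (nat \<Rightarrow> real) \<Rightarrow> (nat \<Rightarrow> real) \<Rightarrow> bool" where
  "nontrivial_solution m r a b c \<longleftrightarrow>
     (\<forall>\<alpha>\<in>{1..r}. (\<Sum>j = 1..m. \<Sum>(n1, n2) | n1 + 2 * n2 = \<alpha>.
        (c j)\<^sup>2 * a j ^ n1 * b j ^ n2 / (fact n1 * fact n2)) = 0) \<and>
     (\<forall>j\<in>{1..m}. c j \<noteq> 0) \<and> (\<exists>j\<in>{1..m}. a j \<noteq> 0)"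

definition rbar :: "nat \<Rightarrow> nat" where
  "rbar m = (LEAST r. r \<ge> 1 \<and> \<not> (\<exists>a b c. nontrivial_solution m r a b c))"

definition param_dist :: "'d::finite param \<Rightarrow> 'd param \<Rightarrow> real" where
  "param_dist \<theta> \<theta>' = norm (fst \<theta> - fst \<theta>') + norm (snd \<theta> - snd \<theta>')"

definition voronoi_cell ::
    "'d::finite param pmf \<Rightarrow> 'd param pmf \<Rightarrow> 'd param \<Rightarrow> 'd param set" where
  "voronoi_cell G G0 \<theta>0 =
     {\<theta> \<in> set_pmf G. \<forall>\<theta>1 \<in> set_pmf G0 - {\<theta>0}. param_dist \<theta> \<theta>0 \<le> param_dist \<theta> \<theta>1}"

definition mixing_loss :: "'d::finite param pmf \<Rightarrow> 'd param pmf \<Rightarrow> real" where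
  "mixing_loss G G0 =
     (\<Sum>\<theta>0 | \<theta>0 \<in> set_pmf G0 \<and> card (voronoi_cell G G0 \<theta>0) = 1.
        \<Sum>\<theta>\<in>voronoi_cell G G0 \<theta>0. pmf G \<theta> * param_dist \<theta> \<theta>0) +
     (\<Sum>\<theta>0 | \<theta>0 \<in> set_pmf G0 \<and> card (voronoi_cell G G0 \<theta>0) > 1.
        \<Sum>\<theta>\<in>voronoi_cell G G0 \<theta>0. pmf G \<theta> *
          (norm (fst \<theta> - fst \<theta>0) ^ rbar (card (voronoi_cell G G0 \<theta>0)) +
           norm (snd \<theta> - snd \<theta>0) powr (real (rbar (card (voronoi_cell G G0 \<theta>0))) / 2))) +
     (\<Sum>\<theta>0\<in>set_pmf G0. \<bar>(\<Sum>\<theta>\<in>voronoi_cell G G0 \<theta>0. pmf G \<theta>) - pmf G0 \<theta>0\<bar>)"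

end

theory Submission
  imports Defs "HOL-Complex_Analysis.Complex_Analysis"
begin

text \<open>
  The rate is first expressed through characteristic functions \<open>\<phi>\<^sub>G\<close>: the loss of \<open>G\<close> is at most a
  constant times \<open>sup\<^sub>t \<bar>\<phi>\<^sub>G(t) - \<phi>\<^sub>G\<^sub>0(t)\<bar>\<close>, for all \<open>G\<close> with weights bounded below. Away from \<open>G\<^sub>0\<close>
  this is compactness and identifiability. Close to \<open>G\<^sub>0\<close>, restrict to one direction \<open>t = s u\<close> that
  separates the finitely many relevant parameters. An atom in the cell of \<open>\<theta>\<^sub>j\<close> contributes
  \<open>exp (\<i> a s - b s\<^sup>2)\<close> times the characteristic function at \<open>\<theta>\<^sub>j\<close>, and the Taylor coefficients of
  that factor are the polynomials in the definition of \<open>r\<close>-bar. The functions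
  \<open>s\<^sup>\<alpha> exp (\<i> \<mu>\<^sub>j s - v\<^sub>j s\<^sup>2)\<close> are linearly independent, so each coefficient is controlled by finitely
  many evaluations, and by the choice of \<open>r\<close>-bar the coefficients cannot all be small relative to
  the deviations.

  For the estimator, cover the mixtures by polynomially many (in \<open>n\<close>) upper brackets. Markov's
  inequality and a union bound show that, outside an event of probability \<open>O(1/n)\<close>, every
  log-likelihood ratio is at most \<open>O(log n)\<close>; as \<open>\<xi>\<^sub>n = log n\<close>, the penalty then bounds the weights
  of the estimator below. On such an event the same argument for the square roots of the ratios,
  with the affinity bound \<open>1 - V\<^sup>2 / 8\<close> for the \<open>L\<^sup>1\<close> distance \<open>V\<close>, gives \<open>V = O(\<surd>(log n / n))\<close>,
  and \<open>V\<close> dominates the difference of the characteristic functions.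
\<close>

text \<open>Characteristic functions turn a perturbed Gaussian atom into a multiplicative factor.
  The relations between mean and covariance derivatives of the density then sit in the exponent,
  where a mean deviation has weight 1 and a covariance deviation weight 2.

  The obstacle is that the exponents of the loss vary with the cell, so no common Taylor order fits.
  Each cell is expanded to its own order; its remainder is a small multiple of the loss of the same
  cell, and all remainders are absorbed together at the end.

  The constants have to survive the merging of atoms. Compactness gives this only for weights
  bounded away from 0: a log-likelihood ratio of at most d log n against a penalty with factor log n
  bounds the weights below independently of n.

  The minimality condition for r-bar excludes only solutions with some nonzero a_j. Pure covariance
  deviations are excluded by the equation of order 4, so r-bar >= 4 is proved for at least two
  atoms.

  Independence comes from vanishing to a finite order, and the same argument shows that r-bar
  exists.\<close>

no_notation fps_nth (infixl "$" 75)

section \<open>Sums of exponentials times polynomials\<close>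

text \<open>An order of vanishing that forces a sum of \<open>m\<close> polynomials of degree at
  most \<open>N\<close>, each times an exponential series, to be zero term by term. Eliminating one
  term costs \<open>Suc N\<close> orders, and the \<open>Suc N\<close> derivatives raise the other
  degrees to at most \<open>Suc (2 * N)\<close>. That it is finite makes \<open>rbar\<close> well
  defined.\<close>

fun vanish_bound :: "nat \<Rightarrow> nat \<Rightarrow> nat" where
  "vanish_bound 0 N = 0"
| "vanish_bound (Suc m) N = Suc N + vanish_bound m (Suc (2 * N))"

lemma fps_mult_vanish:
  fixes f g :: "'a::comm_ring_1 fps"
  assumes "\<forall>n<B. fps_nth f n = 0"
  shows "\<forall>n<B. fps_nth (f * g) n = 0"
  using assms by (auto simp: fps_mult_nth)

lemma fps_deriv_vanish:
  fixes f :: "'a::comm_ring_1 fps"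
  assumes "\<forall>n<B + m. fps_nth f n = 0"
  shows "\<forall>n<B. fps_nth ((fps_deriv ^^ m) f) n = 0"
  using assms
proof (induction m arbitrary: f)
  case (Suc m)
  then have "\<forall>n<B. fps_nth ((fps_deriv ^^ m) (fps_deriv f)) n = 0"
    by (intro Suc.IH) simp
  then show ?case by (simp add: funpow_swap1)
qed simp

text \<open>How differentiation acts on the polynomial factor of a product P e when e' = d
  e.\<close>

definition twist :: "'a::field_char_0 poly \<Rightarrow> 'a poly \<Rightarrow> 'a poly" where
  "twist d P = pderiv P + P * d"

text \<open>A nonzero \<open>P\<close> would divide its own derivative, hence be constant in
  characteristic zero; then \<open>P * d = 0\<close> is left.\<close>

lemma twist_eq_0:
  assumes "d \<noteq> 0" "twist d P = 0"
  shows "P = 0"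
proof (rule ccontr)
  assume P: "P \<noteq> 0"
  have "pderiv P = - (P * d)"
    using assms(2) by (simp add: twist_def eq_neg_iff_add_eq_0)
  then have "P dvd pderiv P"
    by (metis dvd_minus_iff dvd_triv_left)
  then have "degree P = 0"
    using not_dvd_pderiv by blast
  then have "pderiv P = 0"
    by (simp add: pderiv_eq_0_iff)
  with assms P show False
    by (simp add: twist_def)
qed

lemma degree_twist: "degree (twist d P) \<le> degree P + degree d"
  unfolding twist_def
  by (rule degree_add_le) (auto simp: degree_pderiv intro: le_trans[OF diff_le_self] degree_mult_le)

lemma fps_deriv_twist:
  assumes "fps_deriv e = fps_of_poly d * e"
  shows "fps_deriv (fps_of_poly P * e) = fps_of_poly (twist d P) * e"
  by (simp add: assms twist_def fps_of_poly_add fps_of_poly_mult fps_of_poly_pderiv algebra_simps)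

lemma fps_deriv_twist_funpow:
  assumes "fps_deriv e = fps_of_poly d * e"
  shows "(fps_deriv ^^ m) (fps_of_poly P * e) = fps_of_poly ((twist d ^^ m) P) * e"
  by (induction m) (simp_all add: fps_deriv_twist[OF assms] del: fps_deriv_mult)

lemma twist_funpow_eq_0: "d \<noteq> 0 \<Longrightarrow> (twist d ^^ m) P = 0 \<Longrightarrow> P = 0"
  by (induction m) (auto dest: twist_eq_0)

lemma degree_twist_funpow: "degree ((twist d ^^ m) P) \<le> degree P + m * degree d"
  by (induction m) (auto intro: le_trans[OF degree_twist])

lemma fps_deriv_funpow_poly_eq_0:
  fixes P :: "'a::field_char_0 poly"
  assumes "degree P < m"
  shows "(fps_deriv ^^ m) (fps_of_poly P) = 0"
proof -
  have "(fps_deriv ^^ m) (fps_of_poly P) = fps_of_poly ((pderiv ^^ m) P)"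
    by (induction m) (simp_all add: fps_of_poly_pderiv)
  moreover have "degree P < m \<Longrightarrow> (pderiv ^^ m) P = 0" for m
  proof (induction m arbitrary: P)
    case (Suc m)
    show ?case
    proof (cases "degree P = 0")
      case True
      then have "pderiv P = 0" by (simp add: pderiv_eq_0_iff)
      moreover have "(pderiv ^^ m) 0 = (0::'a poly)" by (induction m) simp_all
      ultimately show ?thesis by (simp add: funpow_swap1 del: funpow.simps) (simp add: funpow_swap1)
    next
      case False
      then have "degree (pderiv P) < m" using Suc.prems by (simp add: degree_pderiv)
      then show ?thesis using Suc.IH by (simp add: funpow_swap1)
    qed
  qed simp
  ultimately show ?thesis using assms by simp
qed

lemma fps_poly_eq_0:
  fixes e :: "'a::field_char_0 fps"
  assumes "fps_nth e 0 \<noteq> 0" "degree P \<le> N" "\<forall>n<Suc N. fps_nth (fps_of_poly P * e) n = 0"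
  shows "P = 0"
proof -
  have "\<forall>n<Suc N. fps_nth (fps_of_poly P * e * inverse e) n = 0"
    by (rule fps_mult_vanish) (fact assms)
  then have "\<forall>n<Suc N. coeff P n = 0"
    using assms(1) by (simp add: mult.assoc inverse_mult_eq_1' del: fps_of_poly_nth flip: fps_of_poly_nth)
  then show ?thesis
    using assms(2) by (intro poly_eqI) (metis coeff_0 coeff_eq_0 le_less_trans linorder_not_less less_Suc_eq_le)
qed

text \<open>Dividing by one of the factors \<open>e\<^sub>i\<close> and differentiating \<open>N + 1\<close> times removes a term of
  the sum and lowers the order of vanishing by \<open>N + 1\<close> only.\<close>

lemma exp_poly_sum_vanish:
  fixes e :: "'i \<Rightarrow> 'a::field_char_0 fps" and d P :: "'i \<Rightarrow> 'a poly"
  assumes "finite I" "inj_on d I"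
    and "\<And>i. i \<in> I \<Longrightarrow> degree (d i) \<le> 1"
    and "\<And>i. i \<in> I \<Longrightarrow> fps_nth (e i) 0 \<noteq> 0"
    and "\<And>i. i \<in> I \<Longrightarrow> fps_deriv (e i) = fps_of_poly (d i) * e i"
    and "\<And>i. i \<in> I \<Longrightarrow> degree (P i) \<le> N"
    and "\<forall>n<vanish_bound (card I) N. fps_nth (\<Sum>i\<in>I. fps_of_poly (P i) * e i) n = 0"
  shows "\<forall>i\<in>I. P i = 0"
  using assms
proof (induction I arbitrary: d e P N rule: finite_induct)
  case (insert j I)
  define e' where "e' i = e i * inverse (e j)" for i
  define d' where "d' i = d i - d j" for i
  define B where "B = vanish_bound (card I) (Suc (2 * N))"
  have j0: "fps_nth (e j) 0 \<noteq> 0" using insert.prems by simp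
  have van: "\<forall>n<B + Suc N. fps_nth (\<Sum>i\<in>insert j I. fps_of_poly (P i) * e i) n = 0"
    using insert.prems(6) insert.hyps by (simp add: B_def add.commute)
  have eq: "(\<Sum>i\<in>insert j I. fps_of_poly (P i) * e i) * inverse (e j)
      = fps_of_poly (P j) + (\<Sum>i\<in>I. fps_of_poly (P i) * e' i)"
    using insert.hyps j0
    by (simp add: e'_def distrib_right mult.assoc inverse_mult_eq_1' sum_distrib_right)
  have
    "\<forall>n<B + Suc N. fps_nth (fps_of_poly (P j) + (\<Sum>i\<in>I. fps_of_poly (P i) * e' i)) n = 0"
    using fps_mult_vanish[OF van, of "inverse (e j)"] unfolding eq .
  then have "\<forall>n<B. fps_nth ((fps_deriv ^^ Suc N) (fps_of_poly (P j) + (\<Sum>i\<in>I. fps_of_poly (P i) * e' i))) n = 0"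
    by (rule fps_deriv_vanish)
  moreover have "(fps_deriv ^^ m) (f + g) = (fps_deriv ^^ m) f + (fps_deriv ^^ m) g" for m and f g :: "'a fps"
    by (induction m) simp_all
  moreover have "(fps_deriv ^^ m) (sum f I) = (\<Sum>i\<in>I. (fps_deriv ^^ m) (f i))" for m and f :: "'i \<Rightarrow> 'a fps"
    by (induction m) (simp_all add: fps_deriv_sum)
  moreover have "(fps_deriv ^^ Suc N) (fps_of_poly (P j)) = 0"
    by (rule fps_deriv_funpow_poly_eq_0) (use insert.prems in \<open>simp add: le_imp_less_Suc\<close>)
  moreover have ed: "fps_deriv (e' i) = fps_of_poly (d' i) * e' i" if "i \<in> I" for i
  proof -
    have "fps_deriv (inverse (e j)) = - fps_deriv (e j) * inverse (e j) ^ 2"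
      using j0 by (simp add: fps_inverse_deriv)
    also have "\<dots> = - fps_of_poly (d j) * (e j * inverse (e j)) * inverse (e j)"
      using insert.prems(4)[of j] by (simp add: power2_eq_square algebra_simps)
    finally have "fps_deriv (inverse (e j)) = - fps_of_poly (d j) * inverse (e j)"
      using j0 by (simp add: inverse_mult_eq_1')
    then show ?thesis
      using insert.prems(4)[of i] that
      by (simp add: e'_def d'_def fps_of_poly_diff algebra_simps)
  qed
  ultimately have "\<forall>n<B. fps_nth (\<Sum>i\<in>I. fps_of_poly ((twist (d' i) ^^ Suc N) (P i)) * e' i) n = 0"
    using fps_deriv_twist_funpow[OF ed] by (simp del: funpow.simps)
  moreover have deg: "degree (d' i) \<le> 1" if "i \<in> I" for i
    using insert.prems(2) that unfolding d'_def by (intro degree_diff_le) auto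
  moreover have "inj_on d' I"
    using insert.prems(1) by (auto simp: inj_on_def d'_def)
  moreover have "fps_nth (e' i) 0 \<noteq> 0" if "i \<in> I" for i
    using insert.prems(3) that j0 by (simp add: e'_def)
  moreover have "degree ((twist (d' i) ^^ Suc N) (P i)) \<le> Suc (2 * N)" if "i \<in> I" for i
  proof -
    have "degree ((twist (d' i) ^^ Suc N) (P i)) \<le> degree (P i) + Suc N * degree (d' i)"
      by (rule degree_twist_funpow)
    also have "\<dots> \<le> N + Suc N * 1"
      using insert.prems(5) that deg by (intro add_mono mult_left_mono) auto
    finally show ?thesis by simp
  qed
  ultimately have "\<forall>i\<in>I. (twist (d' i) ^^ Suc N) (P i) = 0"
    using ed by (intro insert.IH[of d' e' _ "Suc (2 * N)"]) (auto simp: B_def simp del: funpow.simps)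
  moreover have "d' i \<noteq> 0" if "i \<in> I" for i
    using insert.prems(1) insert.hyps that by (auto simp: d'_def inj_on_def)
  ultimately have I0: "\<forall>i\<in>I. P i = 0"
    using twist_funpow_eq_0 by blast
  \<comment> \<open>Differentiation has destroyed \<open>P j\<close>, so it is recovered from the
    original sum, in which it is now the only term.\<close>
  have "\<forall>n<Suc N. fps_nth (fps_of_poly (P j) * e j) n = 0"
    using van I0 insert.hyps by (simp add: sum.neutral)
  with j0 insert.prems(5)[of j] have "P j = 0"
    by (intro fps_poly_eq_0[of "e j" "P j" N]) auto
  with I0 show ?case by simp
qed simp

section \<open>The series of exp (a X + b X^2) and the existence of r-bar\<close>

definition quad_fps :: "'a::field_char_0 \<Rightarrow> 'a \<Rightarrow> 'a fps" where
  "quad_fps a b = fps_exp a * (fps_exp b oo fps_X ^ 2)"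

definition quad_coeff :: "nat \<Rightarrow> 'a::field_char_0 \<Rightarrow> 'a \<Rightarrow> 'a" where
  "quad_coeff \<alpha> a b = (\<Sum>(n1, n2) | n1 + 2 * n2 = \<alpha>. a ^ n1 * b ^ n2 / (fact n1 * fact n2))"

text \<open>The reason for \<open>quad_fps\<close>: the polynomial system states that a weighted sum
  of these series has vanishing coefficients of orders 1 to r.\<close>

lemma quad_fps_nth: "fps_nth (quad_fps a b) \<alpha> = quad_coeff \<alpha> a b"
proof -
  have "fps_nth (fps_exp b oo fps_X ^ 2) m = (\<Sum>j\<le>m. if 2 * j = m then b ^ j / fact j else 0)" for m
    unfolding fps_compose_def
    by (auto simp: power_mult[symmetric] fps_X_power_nth atLeast0AtMost intro!: sum.cong)
  then have "fps_nth (quad_fps a b) \<alpha> =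
      (\<Sum>i\<le>\<alpha>. \<Sum>j\<le>\<alpha> - i. if i + 2 * j = \<alpha> then a ^ i * b ^ j / (fact i * fact j) else 0)"
    unfolding quad_fps_def fps_mult_nth
    by (auto simp: sum_distrib_left atLeast0AtMost intro!: sum.cong)
  also have "\<dots> = (\<Sum>(i, j)\<in>(SIGMA i:{..\<alpha>}. {..\<alpha> - i}).
       if i + 2 * j = \<alpha> then a ^ i * b ^ j / (fact i * fact j) else 0)"
    by (rule sum.Sigma) auto
  also have "\<dots> = quad_coeff \<alpha> a b"
    unfolding quad_coeff_def by (rule sum.mono_neutral_cong_right) (auto split: if_splits)
  finally show ?thesis .
qed

lemma quad_fps_deriv: "fps_deriv (quad_fps a b) = fps_of_poly [:a, 2 * b:] * quad_fps a b"
proof -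
  define g where "g = fps_exp b oo fps_X ^ 2"
  have "fps_deriv g = (fps_deriv (fps_exp b) oo fps_X ^ 2) * fps_deriv (fps_X ^ 2)"
    unfolding g_def by (rule fps_compose_deriv) simp
  also have "fps_deriv (fps_exp b) oo fps_X ^ 2 = fps_const b * g"
    unfolding g_def fps_exp_deriv by (rule fps_const_mult_apply_left [symmetric])
  also have "fps_deriv (fps_X ^ 2 :: 'a fps) = fps_const 2 * fps_X"
    by (simp add: power2_eq_square numeral_fps_const)
  finally have "fps_deriv g = fps_const (2 * b) * fps_X * g"
    by (simp flip: fps_const_mult)
  moreover have "fps_of_poly [:a, 2 * b:] = fps_const a + fps_const (2 * b) * fps_X"
    by (simp add: fps_of_poly_pCons)
  moreover have "fps_deriv (fps_exp a) = fps_const a * fps_exp a"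
    by simp
  ultimately show ?thesis
    unfolding quad_fps_def g_def [symmetric] fps_deriv_mult
    by (simp only: distrib_right distrib_left mult_ac add_ac)
qed

lemma quad_fps_nth_0: "fps_nth (quad_fps a b) 0 = 1"
  by (simp add: quad_fps_def fps_compose_nth_0)

lemma vanish_bound_mono: "m \<le> m' \<Longrightarrow> vanish_bound m N \<le> vanish_bound m' N"
proof (induction m arbitrary: m' N)
  case (Suc m)
  then obtain m'' where "m' = Suc m''" "m \<le> m''" by (cases m') auto
  then show ?case using Suc.IH by simp
qed simp

lemma nontrivial_solution_alt:
  "nontrivial_solution m r a b c \<longleftrightarrow>
     (\<forall>\<alpha>\<in>{1..r}. (\<Sum>j = 1..m. (c j)\<^sup>2 * quad_coeff \<alpha> (a j) (b j)) = 0) \<and>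
     (\<forall>j\<in>{1..m}. c j \<noteq> 0) \<and> (\<exists>j\<in>{1..m}. a j \<noteq> 0)"
  unfolding nontrivial_solution_def quad_coeff_def sum_distrib_left
  by (simp add: case_prod_unfold mult.assoc)

text \<open>Without this the \<open>LEAST\<close> in \<open>rbar\<close> would be unspecified. A
  solution to high order makes sum c_j^2 (exp (a_j X + b_j X^2) - 1) vanish to high order. After
  equal exponents are grouped, at most \<open>m + 1\<close> series remain, so every grouped
  coefficient is 0; but the group of a j with \<open>a j \<noteq> 0\<close> carries a positive sum
  of squares.\<close>

lemma ex_no_nontrivial_solution: "\<exists>r\<ge>1. \<not> (\<exists>a b c. nontrivial_solution m r a b c)"
proof (intro exI conjI notI)
  define r where "r = Suc (vanish_bound (Suc m) 0)"
  show "1 \<le> r" by (simp add: r_def)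
  assume "\<exists>a b c. nontrivial_solution m r a b c"
  then obtain a b c where sol': "nontrivial_solution m r a b c" by blast
  then have sol: "(\<Sum>j = 1..m. (c j)\<^sup>2 * quad_coeff \<alpha> (a j) (b j)) = 0" if "\<alpha> \<in> {1..r}" for \<alpha>
    using that unfolding nontrivial_solution_alt by blast
  from sol' have c: "c j \<noteq> 0" if "j \<in> {1..m}" for j
    using that unfolding nontrivial_solution_alt by blast
  from sol' have ex: "\<exists>j\<in>{1..m}. a j \<noteq> 0"
    unfolding nontrivial_solution_alt by blast
  define I where "I = insert (0, 0) ((\<lambda>j. (a j, b j)) ` {1..m})"
  define e where "e = (\<lambda>q::real \<times> real. quad_fps (fst q) (snd q))"
  define w where "w q = (\<Sum>j | j \<in> {1..m} \<and> (a j, b j) = q. (c j)\<^sup>2)" for q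
  \<comment> \<open>Subtracting the total weight at exponent (0, 0) makes the coefficient of order 0
    vanish, about which the system says nothing, and leaves the higher ones unchanged.\<close>
  define P where "P q = [:w q - (if q = (0, 0) then (\<Sum>j = 1..m. (c j)\<^sup>2) else 0):]" for q
  have fin: "finite I" by (simp add: I_def)
  have "card I \<le> Suc m"
    unfolding I_def using card_image_le[of "{1..m}" "\<lambda>j. (a j, b j)"]
    by (simp add: card_insert_if)
  then have bd: "vanish_bound (card I) 0 \<le> r"
    using vanish_bound_mono[of "card I" "Suc m" 0] by (simp add: r_def)
  have "fps_nth (\<Sum>q\<in>I. fps_of_poly (P q) * e q) \<alpha> = 0" if "\<alpha> < r" for \<alpha>
  proof -
    have "fps_nth (\<Sum>q\<in>I. fps_of_poly (P q) * e q) \<alpha>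
        = (\<Sum>q\<in>I. w q * quad_coeff \<alpha> (fst q) (snd q))
          - (\<Sum>q\<in>I. if q = (0, 0) then (\<Sum>j = 1..m. (c j)\<^sup>2) * quad_coeff \<alpha> (fst q) (snd q) else 0)"
      unfolding sum_subtractf[symmetric]
      by (auto simp: fps_sum_nth P_def e_def quad_fps_nth fps_of_poly_pCons algebra_simps intro!: sum.cong)
    also have "(\<Sum>q\<in>I. if q = (0, 0) then (\<Sum>j = 1..m. (c j)\<^sup>2) * quad_coeff \<alpha> (fst q) (snd q) else 0)
        = (\<Sum>j = 1..m. (c j)\<^sup>2) * quad_coeff \<alpha> 0 0"
      using fin by (simp add: sum.delta I_def)
    also have "(\<Sum>q\<in>I. w q * quad_coeff \<alpha> (fst q) (snd q))
        = (\<Sum>q\<in>I. \<Sum>j | j \<in> {1..m} \<and> (a j, b j) = q. (c j)\<^sup>2 * quad_coeff \<alpha> (a j) (b j))"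
      unfolding w_def sum_distrib_right by (intro sum.cong refl) auto
    also have "\<dots> = (\<Sum>j = 1..m. (c j)\<^sup>2 * quad_coeff \<alpha> (a j) (b j))"
      by (rule sum.group) (auto simp: I_def)
    finally have eq: "fps_nth (\<Sum>q\<in>I. fps_of_poly (P q) * e q) \<alpha>
        = (\<Sum>j = 1..m. (c j)\<^sup>2 * quad_coeff \<alpha> (a j) (b j)) - (\<Sum>j = 1..m. (c j)\<^sup>2) * quad_coeff \<alpha> 0 0" .
    have "quad_fps 0 0 = (1 :: real fps)"
      by (simp add: quad_fps_def)
    then have z: "quad_coeff \<alpha> 0 0 = (if \<alpha> = 0 then 1 else 0 :: real)"
      by (simp flip: quad_fps_nth)
    have o: "quad_coeff 0 x y = 1" for x y :: real
      by (simp add: quad_fps_nth_0 flip: quad_fps_nth)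
    show ?thesis
    proof (cases "\<alpha> = 0")
      case False
      then show ?thesis using eq sol[of \<alpha>] that by (simp add: z)
    qed (use eq in \<open>simp add: o\<close>)
  qed
  then have "\<forall>q\<in>I. P q = 0"
    using bd
    by (intro exp_poly_sum_vanish[where d = "\<lambda>q. [:fst q, 2 * snd q:]" and e = e and N = 0])
       (auto simp: fin inj_on_def e_def quad_fps_nth_0 quad_fps_deriv P_def)
  moreover obtain j where j: "j \<in> {1..m}" "a j \<noteq> 0" using ex by blast
  ultimately have "w (a j, b j) = 0"
    by (auto simp: I_def P_def)
  moreover have "w (a j, b j) > 0"
    unfolding w_def using c j by (intro sum_pos) auto
  ultimately show False by simp
qed

lemma rbar_ge_1: "1 \<le> rbar m" and no_nontrivial_solution_rbar: "\<not> nontrivial_solution m (rbar m) a b c"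
  unfolding rbar_def using LeastI_ex[OF ex_no_nontrivial_solution[of m]] by blast+

lemma quad_coeff_simps:
  "quad_coeff (Suc 0) a b = a"
  "quad_coeff 2 a b = a ^ 2 / 2 + b"
  "quad_coeff 3 a b = a ^ 3 / 6 + a * b"
  "quad_coeff 4 a b = a ^ 4 / 24 + a ^ 2 * b / 2 + b ^ 2 / 2"
proof -
  have "{(n1, n2). n1 + 2 * n2 = Suc 0} = {(1, 0)}"
    "{(n1, n2). n1 + 2 * n2 = (2::nat)} = {(2, 0), (0, 1)}"
    "{(n1, n2). n1 + 2 * n2 = (3::nat)} = {(3, 0), (1, 1)}"
    "{(n1, n2). n1 + 2 * n2 = (4::nat)} = {(4, 0), (2, 1), (0, 2)}"
    by (auto, presburger+)
  then show "quad_coeff (Suc 0) a b = a"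
    "quad_coeff 2 a b = a ^ 2 / 2 + b"
    "quad_coeff 3 a b = a ^ 3 / 6 + a * b"
    "quad_coeff 4 a b = a ^ 4 / 24 + a ^ 2 * b / 2 + b ^ 2 / 2"
    by (simp_all add: quad_coeff_def fact_numeral)
qed

text \<open>Two opposite means cancel the odd orders, and b = -1/2 cancels a^2/2 at order 2, so the
  system has a nontrivial solution up to order 3; the remaining atoms are put at 0.\<close>

lemma rbar_ge_4:
  assumes "2 \<le> m"
  shows "4 \<le> rbar m"
proof (rule ccontr)
  assume "\<not> 4 \<le> rbar m"
  then have le: "\<alpha> \<in> {Suc 0, 2, 3}" if "\<alpha> \<in> {1..rbar m}" for \<alpha>
    using that by auto
  define a b :: "nat \<Rightarrow> real" where "a j = (if j = 1 then 1 else if j = 2 then -1 else 0)"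
    and "b j = (if j = 1 \<or> j = 2 then - 1 / 2 else 0)" for j
  have split: "{1..m} = {1, 2} \<union> {3..m}" using assms by auto
  have "(\<Sum>j = 1..m. (1::real)\<^sup>2 * quad_coeff \<alpha> (a j) (b j)) = 0" if "\<alpha> \<in> {Suc 0, 2, 3}" for \<alpha>
  proof -
    have "(\<Sum>j = 3..m. (1::real)\<^sup>2 * quad_coeff \<alpha> (a j) (b j)) = 0"
      using that by (intro sum.neutral) (auto simp: a_def b_def quad_coeff_simps)
    then show ?thesis
      unfolding split using that
      by (subst sum.union_disjoint) (auto simp: a_def b_def quad_coeff_simps)
  qed
  then have "nontrivial_solution m (rbar m) a b (\<lambda>_. 1)"
    unfolding nontrivial_solution_alt using assms le by (auto simp: a_def intro!: bexI[of _ 1])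
  then show False
    by (simp add: no_nontrivial_solution_rbar)
qed

text \<open>Vanishing on a real interval makes the entire function identically zero, so its power
  series at 0 vanishes to every order and \<open>exp_poly_sum_vanish\<close> applies.\<close>

lemma quad_exp_independent:
  fixes A :: "'j \<Rightarrow> nat \<Rightarrow> complex" and u v :: "'j \<Rightarrow> complex"
  assumes "finite J" "inj_on (\<lambda>j. (u j, v j)) J"
    and zero: "\<And>s. s \<in> {-1..1} \<Longrightarrow>
      (\<Sum>j\<in>J. \<Sum>\<alpha>\<le>R. A j \<alpha> * (of_real s ^ \<alpha> * exp (u j * of_real s + v j * of_real s ^ 2))) = 0"
  shows "\<forall>j\<in>J. \<forall>\<alpha>\<le>R. A j \<alpha> = 0"
proof -
  define P where "P j = (\<Sum>\<alpha>\<le>R. monom (A j \<alpha>) \<alpha>)" for j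
  define f where "f z = (\<Sum>j\<in>J. poly (P j) z * exp (u j * z + v j * z ^ 2))" for z
  have f_alt: "f z = (\<Sum>j\<in>J. \<Sum>\<alpha>\<le>R. A j \<alpha> * (z ^ \<alpha> * exp (u j * z + v j * z ^ 2)))" for z
    by (simp add: f_def P_def poly_sum poly_monom sum_distrib_right mult.assoc)
  define U where "U = complex_of_real ` {-1..1}"
  have lim: "0 islimpt U"
    unfolding islimpt_approachable
  proof (intro allI impI)
    fix e :: real assume "e > 0"
    then show "\<exists>x'\<in>U. x' \<noteq> 0 \<and> dist x' 0 < e"
      by (intro bexI[of _ "of_real (min (e / 2) 1)"]) (auto simp: U_def)
  qed
  have fU: "f z = 0" if zU: "z \<in> U" for z
  proof -
    obtain s where "s \<in> {-1..1}" "z = of_real s" using zU by (auto simp: U_def)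
    then show ?thesis using zero[of s] by (simp only: f_alt)
  qed
  have hol: "f holomorphic_on UNIV"
    unfolding f_def
    by (intro holomorphic_intros)
  have "f z = 0" for z
    by (rule analytic_continuation[OF hol _ _ _ _ lim fU]) auto
  then have exp0: "f has_fps_expansion 0"
    by (simp add: has_fps_expansion_0_iff)
  have exp1: "f has_fps_expansion (\<Sum>j\<in>J. fps_of_poly (P j) * quad_fps (u j) (v j))"
  proof -
    have "(\<lambda>z. exp (u j * z + v j * z ^ 2)) has_fps_expansion quad_fps (u j) (v j)" for j
    proof -
      have "((\<lambda>z. exp (v j * z)) \<circ> (\<lambda>z. z ^ 2)) has_fps_expansion (fps_exp (v j) oo fps_X ^ 2)"
        by (intro has_fps_expansion_compose has_fps_expansion_exp has_fps_expansion_power has_fps_expansion_fps_X) simp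
      then show ?thesis
        unfolding quad_fps_def exp_add o_def
        by (intro has_fps_expansion_mult has_fps_expansion_exp)
    qed
    moreover have "poly (P j) has_fps_expansion fps_of_poly (P j)" for j
      by (simp add: has_fps_expansion_def)
    ultimately show ?thesis
      unfolding f_def by (intro has_fps_expansion_sum has_fps_expansion_mult)
  qed
  have sum0: "(\<Sum>j\<in>J. fps_of_poly (P j) * quad_fps (u j) (v j)) = 0"
    by (rule fps_expansion_unique_complex[OF exp1 exp0])
  have "degree (P j) \<le> R" for j
    unfolding P_def by (rule degree_sum_le) (auto intro: order.trans[OF degree_monom_le])
  moreover have "inj_on (\<lambda>j. [:u j, 2 * v j:]) J"
    using assms(2) by (simp add: inj_on_def)
  ultimately have "\<forall>j\<in>J. P j = 0"
    using assms(1)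
    by (intro exp_poly_sum_vanish[where d = "\<lambda>j. [:u j, 2 * v j:]" and e = "\<lambda>j. quad_fps (u j) (v j)" and N = R])
       (simp_all add: quad_fps_nth_0 quad_fps_deriv sum0)
  then have P0: "P j = 0" if "j \<in> J" for j using that by simp
  have co: "coeff (P j) \<alpha> = A j \<alpha>" if "\<alpha> \<le> R" for j \<alpha>
    using that by (simp add: P_def coeff_sum)
  show ?thesis
  proof (intro ballI allI impI)
    fix j \<alpha> assume "j \<in> J" "\<alpha> \<le> R"
    then show "A j \<alpha> = 0"
      using co[of \<alpha> j] by (simp only: P0 coeff_0)
  qed
qed

section \<open>Dual evaluation points\<close>

text \<open>Independent functions admit dual functionals that are finite combinations of
  evaluations. The induction adds one point at a time: where the newest function differs from its
  interpolation by the earlier ones.\<close>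

lemma dual_evaluations:
  fixes g :: "'i \<Rightarrow> 't \<Rightarrow> 'a::field"
  assumes "finite I"
    and "\<And>A. (\<And>t. t \<in> T \<Longrightarrow> (\<Sum>i\<in>I. A i * g i t) = 0) \<Longrightarrow> \<forall>i\<in>I. A i = 0"
  shows "\<exists>F w. finite F \<and> F \<subseteq> T \<and>
    (\<forall>i\<in>I. \<forall>k\<in>I. (\<Sum>t\<in>F. w i t * g k t) = (if i = k then 1 else 0))"
  using assms
proof (induction I rule: finite_induct)
  case (insert j I)
  have "\<forall>i\<in>I. A i = 0" if A: "\<And>t. t \<in> T \<Longrightarrow> (\<Sum>i\<in>I. A i * g i t) = 0" for A
  proof -
    have "\<forall>i\<in>insert j I. (if i = j then 0 else A i) = 0"
    proof (rule insert.prems)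
      fix t assume "t \<in> T"
      have "(\<Sum>i\<in>insert j I. (if i = j then 0 else A i) * g i t) = (\<Sum>i\<in>I. A i * g i t)"
        using insert.hyps by (auto intro!: sum.cong)
      then show "(\<Sum>i\<in>insert j I. (if i = j then 0 else A i) * g i t) = 0"
        using A[OF \<open>t \<in> T\<close>] by simp
    qed
    then show ?thesis using insert.hyps by (metis insertCI)
  qed
  from insert.IH[OF this] obtain F w where F: "finite F" "F \<subseteq> T"
    and w: "\<And>i k. i \<in> I \<Longrightarrow> k \<in> I \<Longrightarrow> (\<Sum>t\<in>F. w i t * g k t) = (if i = k then 1 else 0)"
    by blast
  define L where "L i f = (\<Sum>t\<in>F. w i t * f t)" for i f
  \<comment> \<open>The residual of \<open>g j\<close> after interpolation. If it vanished on
    \<open>T\<close>, \<open>g j\<close> would depend linearly on the other functions.\<close>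
  define h where "h t = g j t - (\<Sum>i\<in>I. L i (g j) * g i t)" for t
  have "\<exists>t0\<in>T. h t0 \<noteq> 0"
  proof (rule ccontr)
    assume "\<not> (\<exists>t0\<in>T. h t0 \<noteq> 0)"
    then have h0: "h t = 0" if "t \<in> T" for t using that by blast
    have "\<forall>i\<in>insert j I. (if i = j then 1 else - L i (g j)) = 0"
    proof (rule insert.prems)
      fix t assume "t \<in> T"
      have "(\<Sum>i\<in>insert j I. (if i = j then 1 else - L i (g j)) * g i t)
          = g j t + (\<Sum>i\<in>I. - L i (g j) * g i t)"
        using insert.hyps by (auto intro!: sum.cong)
      then show "(\<Sum>i\<in>insert j I. (if i = j then 1 else - L i (g j)) * g i t) = 0"
        using h0[OF \<open>t \<in> T\<close>] by (simp add: h_def sum_negf)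
    qed
    then show False by auto
  qed
  then obtain t0 where t0: "t0 \<in> T" "h t0 \<noteq> 0" by blast
  define F' where "F' = insert t0 F"
  \<comment> \<open>The weights of the functional f |-> (f t0 - sum_i L i f * g i t0) / h t0. It
    annihilates the old functions and takes the value 1 at \<open>g j\<close>; subtracting multiples
    of it corrects the old functionals.\<close>
  define v where "v t = ((if t = t0 then 1 else 0) - (if t \<in> F then (\<Sum>i\<in>I. g i t0 * w i t) else 0)) / h t0" for t
  define w' where "w' i t = (if i = j then v t else (if t \<in> F then w i t else 0) - L i (g j) * v t)" for i t
  have F': "finite F'" "F' \<subseteq> T" using F t0 by (auto simp: F'_def)
  have S: "(\<Sum>t\<in>F'. (if t \<in> F then x t else 0) * f t) = (\<Sum>t\<in>F. x t * f t)" for x f :: "'t \<Rightarrow> 'a"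
    using F by (auto simp: F'_def insert_absorb intro!: sum.mono_neutral_cong_right)
  have V: "(\<Sum>t\<in>F'. v t * f t) = (f t0 - (\<Sum>i\<in>I. L i f * g i t0)) / h t0" for f
  proof -
    have "(\<Sum>t\<in>F'. v t * f t) = ((\<Sum>t\<in>F'. (if t = t0 then 1 else 0) * f t)
        - (\<Sum>t\<in>F'. (if t \<in> F then (\<Sum>i\<in>I. g i t0 * w i t) else 0) * f t)) / h t0"
      unfolding v_def sum_subtractf[symmetric] sum_divide_distrib by (intro sum.cong) (auto simp: field_simps)
    also have "(\<Sum>t\<in>F'. (if t = t0 then 1 else 0) * f t) = f t0"
      using F' by (simp add: if_distrib[of "\<lambda>x. x * _"] sum.delta F'_def cong: if_cong)
    also have "(\<Sum>t\<in>F'. (if t \<in> F then (\<Sum>i\<in>I. g i t0 * w i t) else 0) * f t) = (\<Sum>i\<in>I. L i f * g i t0)"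
      unfolding S L_def sum_distrib_right by (subst sum.swap) (simp add: mult_ac)
    finally show ?thesis .
  qed
  have Lk: "(\<Sum>i\<in>I. L i (g k) * g i t0) = g k t0" if "k \<in> I" for k
  proof -
    have "(\<Sum>i\<in>I. L i (g k) * g i t0) = (\<Sum>i\<in>I. if i = k then g i t0 else 0)"
      using that by (intro sum.cong) (auto simp: L_def w)
    then show ?thesis using insert.hyps that by simp
  qed
  have Vk: "(\<Sum>t\<in>F'. v t * g k t) = (if k = j then 1 else 0)" if "k \<in> insert j I" for k
    using that insert.hyps t0 Lk unfolding V by (auto simp: h_def)
  have "(\<Sum>t\<in>F'. w' i t * g k t) = (if i = k then 1 else 0)" if "i \<in> insert j I" "k \<in> insert j I" for i k
  proof (cases "i = j")
    case True
    then show ?thesis using Vk[OF that(2)] by (simp add: w'_def)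
  next
    case False
    then have "(\<Sum>t\<in>F'. w' i t * g k t) = L i (g k) - L i (g j) * (\<Sum>t\<in>F'. v t * g k t)"
      by (simp add: w'_def left_diff_distrib sum_subtractf S L_def sum_distrib_left mult.assoc)
    then show ?thesis
      using that False insert.hyps by (auto simp: Vk L_def w)
  qed
  then show ?case using F' by blast
qed auto

text \<open>The dual functionals read each coefficient off finitely many evaluations, so
  \<open>C\<close> depends on the functions \<open>g\<close> alone and not on the
  combination.\<close>

lemma independent_coeff_bound:
  fixes g :: "'i \<Rightarrow> 't \<Rightarrow> 'a::real_normed_field"
  assumes "finite I"
    and "\<And>A. (\<And>t. t \<in> T \<Longrightarrow> (\<Sum>i\<in>I. A i * g i t) = 0) \<Longrightarrow> \<forall>i\<in>I. A i = 0"
  shows "\<exists>C>0. \<forall>A M. (\<forall>t\<in>T. norm (\<Sum>i\<in>I. A i * g i t) \<le> M) \<longrightarrow> 0 \<le> M \<longrightarrow> (\<forall>i\<in>I. norm (A i) \<le> C * M)"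
proof -
  have "\<exists>F w. finite F \<and> F \<subseteq> T \<and>
    (\<forall>i\<in>I. \<forall>k\<in>I. (\<Sum>t\<in>F. w i t * g k t) = (if i = k then 1 else 0))"
    using assms by (rule dual_evaluations)
  then obtain F w where F: "finite F" "F \<subseteq> T"
    and w: "\<And>i k. i \<in> I \<Longrightarrow> k \<in> I \<Longrightarrow> (\<Sum>t\<in>F. w i t * g k t) = (if i = k then 1 else 0)"
    by blast
  define C where "C = 1 + (\<Sum>i\<in>I. \<Sum>t\<in>F. norm (w i t))"
  have "C > 0" unfolding C_def by (intro add_pos_nonneg sum_nonneg) auto
  moreover have "norm (A i) \<le> C * M"
    if M: "\<forall>t\<in>T. norm (\<Sum>i\<in>I. A i * g i t) \<le> M" "0 \<le> M" and i: "i \<in> I" for A M i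
  proof -
    have "A i = (\<Sum>k\<in>I. A k * (\<Sum>t\<in>F. w i t * g k t))"
    proof -
      have "(\<Sum>k\<in>I. A k * (\<Sum>t\<in>F. w i t * g k t)) = (\<Sum>k\<in>I. if k = i then A k else 0)"
        using i by (intro sum.cong) (auto simp: w)
      then show ?thesis using assms(1) i by simp
    qed
    also have "\<dots> = (\<Sum>t\<in>F. w i t * (\<Sum>k\<in>I. A k * g k t))"
      unfolding sum_distrib_left by (subst sum.swap) (simp add: mult_ac)
    also have "norm \<dots> \<le> (\<Sum>t\<in>F. norm (w i t) * M)"
      using M F by (intro order.trans[OF norm_sum] sum_mono) (auto simp: norm_mult intro!: mult_left_mono)
    also have "\<dots> = (\<Sum>t\<in>F. norm (w i t)) * M" by (simp add: sum_distrib_right)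
    also have "\<dots> \<le> C * M"
    proof (rule mult_right_mono)
      have "(\<Sum>t\<in>F. norm (w i t)) \<le> (\<Sum>i\<in>I. \<Sum>t\<in>F. norm (w i t))"
        by (rule member_le_sum[OF i]) (auto intro: sum_nonneg assms)
      then show "(\<Sum>t\<in>F. norm (w i t)) \<le> C" by (simp add: C_def)
    qed fact
    finally show ?thesis .
  qed
  ultimately show ?thesis by blast
qed

text \<open>The common form of all compactness arguments below. It returns a finite subfamily
  because, for directions, this finite set is itself needed.\<close>

lemma compact_family_pos_bound:
  fixes h :: "'t \<Rightarrow> 'a::topological_space \<Rightarrow> real"
  assumes "compact K" and cont: "\<And>t. t \<in> T \<Longrightarrow> continuous_on K (h t)"
    and pos: "\<And>x. x \<in> K \<Longrightarrow> \<exists>t\<in>T. h t x > 0"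
  shows "\<exists>F c. finite F \<and> F \<subseteq> T \<and> c > 0 \<and> (\<forall>x\<in>K. \<exists>t\<in>F. h t x \<ge> c)"
proof -
  have "\<forall>t\<in>T. \<exists>A. open A \<and> A \<inter> K = {x \<in> K. h t x > 0}"
  proof
    fix t assume t: "t \<in> T"
    have "\<exists>A. open A \<and> A \<inter> K = h t -` {0<..} \<inter> K"
      by (rule continuous_on_open_invariant[THEN iffD1, OF cont[OF t], rule_format]) simp
    then obtain A where "open A" "A \<inter> K = h t -` {0<..} \<inter> K" by blast
    then show "\<exists>A. open A \<and> A \<inter> K = {x \<in> K. h t x > 0}" by (intro exI[of _ A]) auto
  qed
  then obtain U where U: "\<And>t. t \<in> T \<Longrightarrow> open (U t) \<and> U t \<inter> K = {x \<in> K. h t x > 0}"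
    using bchoice[of T "\<lambda>t A. open A \<and> A \<inter> K = {x \<in> K. h t x > 0}"] by blast
  have "K \<subseteq> (\<Union>t\<in>T. U t)"
    using pos U by blast
  then obtain F0 where F0: "F0 \<subseteq> T" "finite F0" "K \<subseteq> (\<Union>t\<in>F0. U t)"
    using compactE_image[OF assms(1), of T U] U by metis
  \<comment> \<open>The sum of positive parts is continuous and positive on \<open>K\<close>; some
    member of the family is at least its minimum divided by the number of members.\<close>
  define m where "m x = (\<Sum>t\<in>F0. max 0 (h t x))" for x
  have mpos: "m x > 0" if x: "x \<in> K" for x
  proof -
    obtain t where t: "t \<in> F0" "x \<in> U t" using F0(3) x by blast
    then have "h t x > 0" using U[of t] F0 x by blast
    moreover have "max 0 (h t x) \<le> m x"
      unfolding m_def by (rule member_le_sum[OF t(1)]) (auto intro: F0)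
    ultimately show ?thesis by simp
  qed
  show ?thesis
  proof (cases "K = {}")
    case True
    then show ?thesis by (intro exI[of _ "{}"] exI[of _ 1]) auto
  next
    case False
    have "continuous_on K m"
      unfolding m_def using F0 cont by (intro continuous_intros) auto
    then obtain x0 where x0: "x0 \<in> K" "\<And>x. x \<in> K \<Longrightarrow> m x0 \<le> m x"
      using continuous_attains_inf[OF assms(1) False] by blast
    have F0ne: "F0 \<noteq> {}" using mpos[OF x0(1)] by (auto simp: m_def)
    define c where "c = m x0 / real (card F0)"
    have cpos: "c > 0" using mpos[OF x0(1)] F0ne F0 by (simp add: c_def card_gt_0_iff)
    have "\<exists>t\<in>F0. h t x \<ge> c" if x: "x \<in> K" for x
    proof (rule ccontr)
      assume "\<not> (\<exists>t\<in>F0. h t x \<ge> c)"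
      then have "m x < (\<Sum>t\<in>F0. c)"
        unfolding m_def using F0ne F0 cpos by (intro sum_strict_mono) auto
      also have "\<dots> = m x0" using F0ne F0 by (simp add: c_def)
      finally show False using x0(2)[OF x] by simp
    qed
    then show ?thesis using cpos F0 by blast
  qed
qed

section \<open>The polynomial system\<close>

text \<open>Weighted homogeneity, with \<open>a\<close> of weight 1 and \<open>b\<close> of weight
  2: it carries the compactness bound from unit scale to every scale \<open>l\<close>.\<close>

lemma quad_coeff_scale: "quad_coeff \<alpha> (l * a) (l ^ 2 * b) = l ^ \<alpha> * quad_coeff \<alpha> a b"
proof -
  have "(l * a) ^ n1 * (l ^ 2 * b) ^ n2 = l ^ (n1 + 2 * n2) * (a ^ n1 * b ^ n2)" for n1 n2
    by (simp add: power_mult_distrib power_add power_mult)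
  then show ?thesis
    unfolding quad_coeff_def sum_distrib_left by (auto intro!: sum.cong)
qed

text \<open>Scaling by the imaginary unit, as -b = i^2 b: the Taylor coefficients of the complex
  factor are the real polynomials of the system up to a unit.\<close>

lemma quad_coeff_cnj: "quad_coeff \<alpha> (\<i> * of_real a) (- of_real b) = \<i> ^ \<alpha> * of_real (quad_coeff \<alpha> a b)"
proof -
  have "quad_coeff \<alpha> (\<i> * of_real a) (\<i> ^ 2 * of_real b) = \<i> ^ \<alpha> * quad_coeff \<alpha> (of_real a) (of_real b)"
    by (rule quad_coeff_scale)
  then show ?thesis
    by (simp add: quad_coeff_def case_prod_unfold)
qed

lemma continuous_on_quad_coeff [continuous_intros]:
  fixes f g :: "'a::topological_space \<Rightarrow> real"
  shows "continuous_on K f \<Longrightarrow> continuous_on K g \<Longrightarrow> continuous_on K (\<lambda>x. quad_coeff \<alpha> (f x) (g x))"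
  unfolding quad_coeff_def case_prod_unfold by (intro continuous_intros) auto

text \<open>With \<open>c j = sqrt (p j)\<close>, the choice of \<open>rbar\<close> forces all
  \<open>a j\<close> to be 0. The equation of order 4, present by \<open>rbar_ge_4\<close>, then
  reads sum p_j b_j^2 / 2 = 0 and forces the \<open>b j\<close> to be 0 as well.\<close>

lemma quad_moments_nonzero:
  fixes p a b :: "nat \<Rightarrow> real"
  assumes m: "2 \<le> m" and p: "\<And>j. j \<in> {1..m} \<Longrightarrow> p j > 0"
    and ex: "\<exists>j\<in>{1..m}. a j \<noteq> 0 \<or> b j \<noteq> 0"
  shows "\<exists>\<alpha>\<in>{1..rbar m}. (\<Sum>j = 1..m. p j * quad_coeff \<alpha> (a j) (b j)) \<noteq> 0"
proof (rule ccontr)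
  assume "\<not> ?thesis"
  then have 0: "(\<Sum>j = 1..m. p j * quad_coeff \<alpha> (a j) (b j)) = 0" if "\<alpha> \<in> {1..rbar m}" for \<alpha>
    using that by blast
  have "\<not> nontrivial_solution m (rbar m) a b (\<lambda>j. sqrt (p j))"
    by (rule no_nontrivial_solution_rbar)
  moreover have "\<forall>\<alpha>\<in>{1..rbar m}. (\<Sum>j = 1..m. (sqrt (p j))\<^sup>2 * quad_coeff \<alpha> (a j) (b j)) = 0"
  proof
    fix \<alpha> assume "\<alpha> \<in> {1..rbar m}"
    have "(\<Sum>j = 1..m. (sqrt (p j))\<^sup>2 * quad_coeff \<alpha> (a j) (b j)) = (\<Sum>j = 1..m. p j * quad_coeff \<alpha> (a j) (b j))"
      using p by (intro sum.cong) (auto simp: less_imp_le)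
    then show "(\<Sum>j = 1..m. (sqrt (p j))\<^sup>2 * quad_coeff \<alpha> (a j) (b j)) = 0"
      using 0[OF \<open>\<alpha> \<in> _\<close>] by simp
  qed
  moreover have "\<forall>j\<in>{1..m}. sqrt (p j) \<noteq> 0" using p by force
  ultimately have a0: "\<And>j. j \<in> {1..m} \<Longrightarrow> a j = 0"
    unfolding nontrivial_solution_alt by blast
  have "(\<Sum>j = 1..m. p j * (b j)\<^sup>2 / 2) = (\<Sum>j = 1..m. p j * quad_coeff 4 (a j) (b j))"
    by (intro sum.cong) (auto simp: a0 quad_coeff_simps)
  also have "\<dots> = 0" using rbar_ge_4[OF m] by (intro 0) auto
  finally have "\<forall>j\<in>{1..m}. p j * (b j)\<^sup>2 / 2 = 0"
    by (subst (asm) sum_nonneg_eq_0_iff) (use p in \<open>auto simp: less_imp_le\<close>)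
  then show False using ex a0 p by fastforce
qed

section \<open>Quantitative lower bounds for the polynomial system\<close>

lemma compact_PiE_UNIV:
  fixes S :: "'i \<Rightarrow> 'a::topological_space set"
  assumes "\<And>i. compact (S i)"
  shows "compact (PiE UNIV S)"
proof -
  have "compactin (product_topology (\<lambda>_. euclidean) UNIV) (PiE UNIV S)"
    using assms by (simp add: compactin_PiE)
  then show ?thesis by (simp add: euclidean_product_topology)
qed

text \<open>\<open>quad_moments_nonzero\<close> made uniform. The weights stay above
  \<open>c0\<close> and some deviation has absolute value exactly 1, which gives a compact set of
  configurations on which some moment is nonzero.\<close>

lemma moment_lower_bound_unit:
  assumes m: "2 \<le> m" and c0: "0 < c0"
  shows "\<exists>c>0. \<forall>p a b :: nat \<Rightarrow> real. (\<forall>j\<in>{1..m}. c0 \<le> p j \<and> p j \<le> 1 \<and> \<bar>a j\<bar> \<le> 1 \<and> \<bar>b j\<bar> \<le> 1) \<longrightarrow>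
     (\<exists>j\<in>{1..m}. \<bar>a j\<bar> = 1 \<or> \<bar>b j\<bar> = 1) \<longrightarrow>
     (\<exists>\<alpha>\<in>{1..rbar m}. c \<le> \<bar>\<Sum>j = 1..m. p j * quad_coeff \<alpha> (a j) (b j)\<bar>)"
proof -
  \<comment> \<open>A configuration is coded as a function on all of \<open>nat\<close>; the
    coordinates outside \<open>{1..m}\<close> are pinned to one point so that the product is
    compact.\<close>
  define B where "B = PiE UNIV (\<lambda>j. if j \<in> {1..m} then {c0..1} \<times> {-1..1} \<times> {-1..1} else {(0, 0, 0) :: real \<times> real \<times> real})"
  define K where "K = B \<inter> (\<Union>j\<in>{1..m}. {x. \<bar>fst (snd (x j))\<bar> = 1} \<union> {x. \<bar>snd (snd (x j))\<bar> = 1})"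
  have coord: "continuous_on A (\<lambda>x::nat \<Rightarrow> real \<times> real \<times> real. x j)" for j A
    by (rule continuous_on_subset[OF continuous_on_product_coordinates]) auto
  have "compact B"
    unfolding B_def by (rule compact_PiE_UNIV) (auto intro: compact_Times)
  moreover have "closed {x::nat \<Rightarrow> real \<times> real \<times> real. \<bar>fst (snd (x j))\<bar> = 1}"
    "closed {x::nat \<Rightarrow> real \<times> real \<times> real. \<bar>snd (snd (x j))\<bar> = 1}" for j
    by (intro closed_Collect_eq continuous_intros coord)+
  ultimately have "compact K"
    unfolding K_def by (intro compact_Int_closed closed_UN closed_Un) auto
  define h where "h \<alpha> x = \<bar>\<Sum>j = 1..m. fst (x j) * quad_coeff \<alpha> (fst (snd (x j))) (snd (snd (x j)))\<bar>"
    for \<alpha> and x :: "nat \<Rightarrow> real \<times> real \<times> real"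
  have "\<exists>F c. finite F \<and> F \<subseteq> {1..rbar m} \<and> c > 0 \<and> (\<forall>x\<in>K. \<exists>\<alpha>\<in>F. h \<alpha> x \<ge> c)"
  proof (rule compact_family_pos_bound[OF \<open>compact K\<close>])
    show "continuous_on K (h \<alpha>)" for \<alpha>
      unfolding h_def by (intro continuous_intros coord)
    fix x assume x: "x \<in> K"
    then have "x \<in> B" by (simp add: K_def)
    then have xj: "x j \<in> {c0..1} \<times> {-1..1} \<times> {-1..1}" if "j \<in> {1..m}" for j
    proof -
      have "x j \<in> (if j \<in> {1..m} then {c0..1} \<times> {-1..1} \<times> {-1..1} else {(0, 0, 0)})"
        using \<open>x \<in> B\<close> unfolding B_def by (rule PiE_mem) simp
      then show ?thesis using that by (simp only: if_True)
    qed
    have "\<exists>\<alpha>\<in>{1..rbar m}. (\<Sum>j = 1..m. fst (x j) * quad_coeff \<alpha> (fst (snd (x j))) (snd (snd (x j)))) \<noteq> 0"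
    proof (rule quad_moments_nonzero[OF m])
      show "0 < fst (x j)" if "j \<in> {1..m}" for j using xj[OF that] c0 by (auto simp: mem_Times_iff)
      obtain j where "j \<in> {1..m}" "\<bar>fst (snd (x j))\<bar> = 1 \<or> \<bar>snd (snd (x j))\<bar> = 1"
        using x by (auto simp: K_def)
      then show "\<exists>j\<in>{1..m}. fst (snd (x j)) \<noteq> 0 \<or> snd (snd (x j)) \<noteq> 0"
        by (intro bexI[of _ j]) auto
    qed
    then show "\<exists>\<alpha>\<in>{1..rbar m}. h \<alpha> x > 0" by (simp add: h_def)
  qed
  then obtain F c where F: "F \<subseteq> {1..rbar m}" and c: "c > 0" and Fc: "\<And>x. x \<in> K \<Longrightarrow> \<exists>\<alpha>\<in>F. h \<alpha> x \<ge> c"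
    by blast
  show ?thesis
  proof (intro exI[of _ c] conjI allI impI c)
    fix p a b :: "nat \<Rightarrow> real"
    assume H: "\<forall>j\<in>{1..m}. c0 \<le> p j \<and> p j \<le> 1 \<and> \<bar>a j\<bar> \<le> 1 \<and> \<bar>b j\<bar> \<le> 1"
      "\<exists>j\<in>{1..m}. \<bar>a j\<bar> = 1 \<or> \<bar>b j\<bar> = 1"
    define x where "x j = (if j \<in> {1..m} then (p j, a j, b j) else (0, 0, 0))" for j
    have "x \<in> K" using H unfolding K_def B_def x_def by (auto simp: abs_le_iff)
    from Fc[OF this] obtain \<alpha> where "\<alpha> \<in> F" "h \<alpha> x \<ge> c" by blast
    moreover have "h \<alpha> x = \<bar>\<Sum>j = 1..m. p j * quad_coeff \<alpha> (a j) (b j)\<bar>"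
      unfolding h_def by (intro arg_cong[where f = abs] sum.cong) (auto simp: x_def)
    ultimately show "\<exists>\<alpha>\<in>{1..rbar m}. c \<le> \<bar>\<Sum>j = 1..m. p j * quad_coeff \<alpha> (a j) (b j)\<bar>"
      using F by auto
  qed
qed

text \<open>Homogeneity reduces to \<open>l = 1\<close>. The factor \<open>l ^ \<alpha>\<close> lost
  in rescaling is at least \<open>l ^ rbar m\<close>, since \<open>l \<le> 1\<close> and
  \<open>\<alpha> \<le> rbar m\<close>.\<close>

lemma moment_lower_bound:
  assumes m: "2 \<le> m" and c0: "0 < c0"
  shows "\<exists>c>0. \<forall>(S :: 'i set) (p :: 'i \<Rightarrow> real) a b l. card S = m \<longrightarrow> 0 < l \<longrightarrow> l \<le> 1 \<longrightarrow>
     (\<forall>i\<in>S. c0 \<le> p i \<and> p i \<le> 1 \<and> \<bar>a i\<bar> \<le> l \<and> \<bar>b i\<bar> \<le> l\<^sup>2) \<longrightarrow>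
     (\<exists>i\<in>S. \<bar>a i\<bar> = l \<or> \<bar>b i\<bar> = l\<^sup>2) \<longrightarrow>
     (\<exists>\<alpha>\<in>{1..rbar m}. c * l ^ rbar m \<le> \<bar>\<Sum>i\<in>S. p i * quad_coeff \<alpha> (a i) (b i)\<bar>)"
proof -
  from moment_lower_bound_unit[OF assms] obtain c where c: "c > 0" and
    unit: "\<And>p a b :: nat \<Rightarrow> real. (\<forall>j\<in>{1..m}. c0 \<le> p j \<and> p j \<le> 1 \<and> \<bar>a j\<bar> \<le> 1 \<and> \<bar>b j\<bar> \<le> 1) \<Longrightarrow>
     (\<exists>j\<in>{1..m}. \<bar>a j\<bar> = 1 \<or> \<bar>b j\<bar> = 1) \<Longrightarrow>
     (\<exists>\<alpha>\<in>{1..rbar m}. c \<le> \<bar>\<Sum>j = 1..m. p j * quad_coeff \<alpha> (a j) (b j)\<bar>)"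
    by blast
  show ?thesis
  proof (intro exI[of _ c] conjI allI impI c)
    fix S :: "'i set" and p a b :: "'i \<Rightarrow> real" and l :: real
    assume S: "card S = m" and l: "0 < l" "l \<le> 1"
      and H: "\<forall>i\<in>S. c0 \<le> p i \<and> p i \<le> 1 \<and> \<bar>a i\<bar> \<le> l \<and> \<bar>b i\<bar> \<le> l\<^sup>2"
      and E: "\<exists>i\<in>S. \<bar>a i\<bar> = l \<or> \<bar>b i\<bar> = l\<^sup>2"
    have "finite S" using S m by (intro card_ge_0_finite) auto
    then obtain f where f: "bij_betw f {1..m} S"
      using S ex_bij_betw_nat_finite_1 by blast
    then have fS: "f j \<in> S" if "j \<in> {1..m}" for j using that by (rule bij_betwE[rule_format])
    have "\<exists>j\<in>{1..m}. \<bar>a (f j) / l\<bar> = 1 \<or> \<bar>b (f j) / l\<^sup>2\<bar> = 1"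
    proof -
      from E obtain i where i: "i \<in> S" "\<bar>a i\<bar> = l \<or> \<bar>b i\<bar> = l\<^sup>2" by blast
      then obtain j where "j \<in> {1..m}" "i = f j" using f by (auto simp: bij_betw_def)
      then show ?thesis using i l by (intro bexI[of _ j]) (auto simp: abs_divide)
    qed
    moreover have "\<forall>j\<in>{1..m}. c0 \<le> p (f j) \<and> p (f j) \<le> 1 \<and> \<bar>a (f j) / l\<bar> \<le> 1 \<and> \<bar>b (f j) / l\<^sup>2\<bar> \<le> 1"
      using H fS l by (auto simp: abs_divide divide_le_eq)
    ultimately obtain \<alpha> where \<alpha>: "\<alpha> \<in> {1..rbar m}"
      and le: "c \<le> \<bar>\<Sum>j = 1..m. p (f j) * quad_coeff \<alpha> (a (f j) / l) (b (f j) / l\<^sup>2)\<bar>"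
      using unit[of "\<lambda>j. p (f j)" "\<lambda>j. a (f j) / l" "\<lambda>j. b (f j) / l\<^sup>2"] by blast
    have "(\<Sum>i\<in>S. p i * quad_coeff \<alpha> (a i) (b i)) = (\<Sum>j = 1..m. p (f j) * quad_coeff \<alpha> (a (f j)) (b (f j)))"
      by (rule sum.reindex_bij_betw[OF f, symmetric])
    also have "\<dots> = l ^ \<alpha> * (\<Sum>j = 1..m. p (f j) * quad_coeff \<alpha> (a (f j) / l) (b (f j) / l\<^sup>2))"
    proof -
      have "quad_coeff \<alpha> (a i) (b i) = l ^ \<alpha> * quad_coeff \<alpha> (a i / l) (b i / l\<^sup>2)" for i
        using l by (simp flip: quad_coeff_scale)
      then show ?thesis by (simp add: sum_distrib_left mult_ac)
    qed
    finally have "\<bar>\<Sum>i\<in>S. p i * quad_coeff \<alpha> (a i) (b i)\<bar>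
        = l ^ \<alpha> * \<bar>\<Sum>j = 1..m. p (f j) * quad_coeff \<alpha> (a (f j) / l) (b (f j) / l\<^sup>2)\<bar>"
      using l by (simp add: abs_mult)
    moreover have "l ^ rbar m * c \<le> l ^ \<alpha> * \<bar>\<Sum>j = 1..m. p (f j) * quad_coeff \<alpha> (a (f j) / l) (b (f j) / l\<^sup>2)\<bar>"
      using l \<alpha> le c by (intro mult_mono power_decreasing) auto
    ultimately show "\<exists>\<alpha>\<in>{1..rbar m}. c * l ^ rbar m \<le> \<bar>\<Sum>i\<in>S. p i * quad_coeff \<alpha> (a i) (b i)\<bar>"
      using \<alpha> by (intro bexI[of _ \<alpha>]) (simp_all only: mult.commute[of c])
  qed
qed

text \<open>Truncation is by the weighted degree \<open>n1 + 2 * n2\<close>: with \<open>b\<close>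
  of size \<rho>^2, each discarded monomial is at most \<open>\<rho> ^ Suc r\<close>. Both
  exponentials are first cut at degree \<open>r\<close>, and then the monomials of weighted degree
  above \<open>r\<close> are dropped.\<close>

lemma quad_exp_taylor:
  "\<exists>K>0. \<forall>a b \<rho> t :: real. \<bar>a\<bar> \<le> \<rho> \<longrightarrow> \<bar>b\<bar> \<le> \<rho>\<^sup>2 \<longrightarrow> \<rho> \<le> 1 \<longrightarrow> \<bar>t\<bar> \<le> 1 \<longrightarrow>
     norm (exp (\<i> * of_real (a * t) - of_real (b * t\<^sup>2)) -
       (\<Sum>\<alpha>\<le>r. \<i> ^ \<alpha> * of_real (quad_coeff \<alpha> a b * t ^ \<alpha>))) \<le> K * \<rho> ^ Suc r"
proof (intro exI conjI allI impI)
  define R where "R = real (Suc r)"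
  \<comment> \<open>The first two terms pay for cutting the two exponentials, the last for the at
    most (r + 1)^2 monomials dropped from the product of the truncations.\<close>
  show "exp 1 * exp 1 + R * exp 1 + R * R > 0"
    by (intro add_pos_pos mult_pos_pos) (auto simp: R_def)
  fix a b \<rho> t :: real
  assume A: "\<bar>a\<bar> \<le> \<rho>" "\<bar>b\<bar> \<le> \<rho>\<^sup>2" "\<rho> \<le> 1" "\<bar>t\<bar> \<le> 1"
  have \<rho>: "0 \<le> \<rho>" using A by simp
  define z w where "z = \<i> * of_real (a * t)" and "w = - complex_of_real (b * t\<^sup>2)"
  have z: "norm z \<le> \<rho>"
    using mult_mono[OF A(1,4)] \<rho> by (simp add: z_def norm_mult abs_mult)
  have "t\<^sup>2 \<le> 1" using A by (simp add: abs_square_le_1)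
  then have w: "norm w \<le> \<rho>\<^sup>2"
    using mult_mono[OF A(2) \<open>t\<^sup>2 \<le> 1\<close>] \<rho> unfolding w_def norm_minus_cancel norm_of_real abs_mult by simp
  have \<rho>2: "\<rho>\<^sup>2 \<le> 1" "\<rho>\<^sup>2 \<le> \<rho>" using \<rho> A by (auto simp: power2_eq_square mult_le_one mult_left_le)
  define T where "T x = (\<Sum>n\<le>r. x ^ n / fact n)" for x :: complex
  have rem: "norm (exp x - T x) \<le> exp 1 * \<rho> ^ Suc r" if "norm x \<le> \<rho>" for x
  proof -
    have "norm (exp x - T x) \<le> exp (norm x) * (norm x ^ Suc r) / fact r"
      unfolding T_def by (rule Taylor_exp_field)
    also have "\<dots> \<le> exp (norm x) * (norm x ^ Suc r) / 1"
      by (intro divide_left_mono) (auto simp: fact_ge_1)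
    also have "\<dots> \<le> exp 1 * \<rho> ^ Suc r"
      unfolding div_by_1 using that A \<rho> by (intro mult_mono power_mono) auto
    finally show ?thesis .
  qed
  have nT: "norm (T z) \<le> R"
  proof -
    have "norm (T z) \<le> (\<Sum>n\<le>r. 1)"
      unfolding T_def
    proof (intro order.trans[OF norm_sum] sum_mono)
      fix n
      have "norm z ^ n \<le> 1" using z A by (intro power_le_one) auto
      also have "1 \<le> (fact n :: real)" by (rule fact_ge_1)
      finally show "norm (z ^ n / fact n) \<le> 1" by (simp add: norm_divide norm_power)
    qed
    then show ?thesis by (simp add: R_def)
  qed
  have "norm (exp w) \<le> exp 1"
    using w \<rho>2 by (intro order.trans[OF norm_exp]) simp
  have 1: "norm (exp z * exp w - T z * T w) \<le> (exp 1 * exp 1 + R * exp 1) * \<rho> ^ Suc r"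
  proof -
    have "exp z * exp w - T z * T w = exp w * (exp z - T z) + T z * (exp w - T w)"
      by (simp add: algebra_simps)
    also have "norm \<dots> \<le> norm (exp w) * norm (exp z - T z) + norm (T z) * norm (exp w - T w)"
      by (rule order.trans[OF norm_triangle_ineq]) (simp add: norm_mult)
    also have "\<dots> \<le> exp 1 * (exp 1 * \<rho> ^ Suc r) + R * (exp 1 * \<rho> ^ Suc r)"
      using rem[OF z] rem[of w] w \<rho>2 nT \<open>norm (exp w) \<le> exp 1\<close>
      by (intro add_mono mult_mono) (auto simp: R_def)
    finally show ?thesis by (simp add: algebra_simps)
  qed
  define g where "g n = z ^ fst n * w ^ snd n / (fact (fst n) * fact (snd n))" for n :: "nat \<times> nat"
  define Q where "Q = {..r} \<times> {..r}"
  have TT: "T z * T w = (\<Sum>n\<in>Q. g n)"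
    unfolding T_def Q_def sum_product sum.cartesian_product g_def
    by (simp add: case_prod_unfold)
  have low: "(\<Sum>\<alpha>\<le>r. \<i> ^ \<alpha> * of_real (quad_coeff \<alpha> a b * t ^ \<alpha>)) = (\<Sum>n\<in>{n\<in>Q. fst n + 2 * snd n \<le> r}. g n)"
  proof -
    have "\<i> ^ \<alpha> * of_real (quad_coeff \<alpha> a b * t ^ \<alpha>) = (\<Sum>n | n \<in> {n\<in>Q. fst n + 2 * snd n \<le> r} \<and> fst n + 2 * snd n = \<alpha>. g n)"
      if "\<alpha> \<le> r" for \<alpha>
    proof -
      have "\<i> ^ \<alpha> * of_real (quad_coeff \<alpha> a b * t ^ \<alpha>) = of_real t ^ \<alpha> * quad_coeff \<alpha> (\<i> * of_real a) (- of_real b)"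
        by (simp add: quad_coeff_cnj mult_ac)
      also have "\<dots> = quad_coeff \<alpha> (of_real t * (\<i> * of_real a)) (of_real t ^ 2 * - of_real b)"
        by (rule quad_coeff_scale[symmetric])
      also have "\<dots> = quad_coeff \<alpha> z w"
        by (simp add: z_def w_def mult_ac)
      also have "\<dots> = (\<Sum>n | n \<in> {n\<in>Q. fst n + 2 * snd n \<le> r} \<and> fst n + 2 * snd n = \<alpha>. g n)"
        unfolding quad_coeff_def g_def case_prod_unfold
        using that by (intro sum.cong) (auto simp: Q_def)
      finally show ?thesis .
    qed
    then have "(\<Sum>\<alpha>\<le>r. \<i> ^ \<alpha> * of_real (quad_coeff \<alpha> a b * t ^ \<alpha>))
       = (\<Sum>\<alpha>\<in>{..r}. \<Sum>n | n \<in> {n\<in>Q. fst n + 2 * snd n \<le> r} \<and> fst n + 2 * snd n = \<alpha>. g n)"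
      by (intro sum.cong) auto
    also have "\<dots> = (\<Sum>n\<in>{n\<in>Q. fst n + 2 * snd n \<le> r}. g n)"
      by (rule sum.group) (auto simp: Q_def)
    finally show ?thesis .
  qed
  have 2: "norm (T z * T w - (\<Sum>\<alpha>\<le>r. \<i> ^ \<alpha> * of_real (quad_coeff \<alpha> a b * t ^ \<alpha>))) \<le> R * R * \<rho> ^ Suc r"
  proof -
    have "T z * T w - (\<Sum>\<alpha>\<le>r. \<i> ^ \<alpha> * of_real (quad_coeff \<alpha> a b * t ^ \<alpha>)) = (\<Sum>n\<in>Q - {n\<in>Q. fst n + 2 * snd n \<le> r}. g n)"
      unfolding TT low by (rule sum_diff[symmetric]) (auto simp: Q_def)
    also have "norm \<dots> \<le> (\<Sum>n\<in>Q - {n\<in>Q. fst n + 2 * snd n \<le> r}. \<rho> ^ Suc r)"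
    proof (intro order.trans[OF norm_sum] sum_mono)
      fix n assume n: "n \<in> Q - {n\<in>Q. fst n + 2 * snd n \<le> r}"
      have "norm (g n) = norm z ^ fst n * norm w ^ snd n / (fact (fst n) * fact (snd n))"
        by (simp add: g_def norm_mult norm_divide norm_power)
      also have "\<dots> \<le> norm z ^ fst n * norm w ^ snd n / 1"
        using mult_mono[of 1 "fact (fst n) :: real" 1 "fact (snd n)"]
        by (intro divide_left_mono) (auto simp: fact_ge_1)
      also have "\<dots> \<le> \<rho> ^ fst n * (\<rho>\<^sup>2) ^ snd n"
        unfolding div_by_1 using z w \<rho> by (intro mult_mono power_mono) auto
      also have "\<dots> = \<rho> ^ (fst n + 2 * snd n)" by (simp add: power_add power_mult)
      also have "\<dots> \<le> \<rho> ^ Suc r" using n \<rho> A by (intro power_decreasing) auto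
      finally show "norm (g n) \<le> \<rho> ^ Suc r" .
    qed
    also have "\<dots> \<le> (\<Sum>n\<in>Q. \<rho> ^ Suc r)"
      using \<rho> by (intro sum_mono2) (auto simp: Q_def)
    also have "\<dots> = R * R * \<rho> ^ Suc r" by (simp add: Q_def R_def algebra_simps)
    finally show ?thesis .
  qed
  have "exp (\<i> * of_real (a * t) - of_real (b * t\<^sup>2)) = exp z * exp w"
    by (simp add: z_def w_def flip: exp_add)
  then show "norm (exp (\<i> * of_real (a * t) - of_real (b * t\<^sup>2)) -
       (\<Sum>\<alpha>\<le>r. \<i> ^ \<alpha> * of_real (quad_coeff \<alpha> a b * t ^ \<alpha>)))
       \<le> (exp 1 * exp 1 + R * exp 1 + R * R) * \<rho> ^ Suc r"
    using norm_triangle_ineq[of "exp z * exp w - T z * T w" "T z * T w - (\<Sum>\<alpha>\<le>r. \<i> ^ \<alpha> * of_real (quad_coeff \<alpha> a b * t ^ \<alpha>))"] 1 2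
    by (simp add: algebra_simps)
qed

section \<open>The one-dimensional inverse bound\<close>

lemma quad_coeff_0 [simp]: "quad_coeff 0 a b = 1"
  by (simp add: quad_fps_nth_0 flip: quad_fps_nth)

text \<open>Merges the constants for the finitely many cell sizes. They serve only as upper bounds,
  so their sum is a common choice.\<close>

lemma uniform_const:
  fixes Q :: "nat \<Rightarrow> real \<Rightarrow> bool"
  assumes "\<And>m. m \<le> k \<Longrightarrow> \<exists>C>0. Q m C" and "\<And>m C C'. Q m C \<Longrightarrow> C \<le> C' \<Longrightarrow> Q m C'"
  shows "\<exists>C>0. \<forall>m\<le>k. Q m C"
proof -
  have "\<forall>m\<in>{..k}. \<exists>C. C > 0 \<and> Q m C" using assms(1) by auto
  from bchoice[OF this] obtain C where C: "\<And>m. m \<le> k \<Longrightarrow> C m > 0 \<and> Q m (C m)" by auto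
  have "Q m (\<Sum>m\<le>k. C m)" if "m \<le> k" for m
  proof (rule assms(2)[of m "C m"])
    show "C m \<le> (\<Sum>m\<le>k. C m)"
      by (rule member_le_sum) (use C that in \<open>auto intro: less_imp_le\<close>)
  qed (use C that in auto)
  moreover have "(\<Sum>m\<le>k. C m) > 0" using C by (intro sum_pos) auto
  ultimately show ?thesis by blast
qed

text \<open>The Taylor order used for a cell of \<open>m\<close> atoms. A lone atom enters the loss
  linearly, and the orders 1 and 2 already determine its two deviations.\<close>

definition cell_order :: "nat \<Rightarrow> nat" where
  "cell_order m = (if m \<le> 1 then 2 else rbar m)"

lemma sum_le_card_mult:
  fixes f :: "'a \<Rightarrow> real"
  shows "(\<And>x. x \<in> A \<Longrightarrow> f x \<le> B) \<Longrightarrow> sum f A \<le> real (card A) * B"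
  by (rule sum_bounded_above)

text \<open>The size of the parameter deviations \<open>a\<^sub>i\<close>, \<open>b\<^sub>i\<close> in one cell, in the scaling of the loss.\<close>

definition cell_dev :: "'i set \<Rightarrow> ('i \<Rightarrow> real) \<Rightarrow> ('i \<Rightarrow> real) \<Rightarrow> real" where
  "cell_dev S a b = (if card S = 1 then (\<Sum>i\<in>S. \<bar>a i\<bar> + \<bar>b i\<bar>)
     else Max (insert 0 ((\<lambda>i. max \<bar>a i\<bar> (sqrt \<bar>b i\<bar>)) ` S)) ^ rbar (card S))"

text \<open>\<open>l\<close> is the scale of the cell, the largest of |a| and sqrt |b|. The bound on
  \<open>l ^ Suc (cell_order (card S))\<close> is the crucial one: the Taylor remainder of a cell is
  at most a multiple of \<eta> times its own deviation. With several atoms it is l^(r+1) <= \<eta>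
  l^r; with one atom it follows from l^2 <= |a| + |b|.\<close>

lemma cell_dev_properties:
  fixes a b :: "'i \<Rightarrow> real"
  assumes S: "finite S" and \<eta>: "\<eta> \<le> 1" "0 \<le> \<eta>" and ab: "\<And>i. i \<in> S \<Longrightarrow> \<bar>a i\<bar> \<le> \<eta> \<and> \<bar>b i\<bar> \<le> \<eta>\<^sup>2"
  obtains l where "0 \<le> l" "l \<le> \<eta>" "\<And>i. i \<in> S \<Longrightarrow> \<bar>a i\<bar> \<le> l \<and> \<bar>b i\<bar> \<le> l\<^sup>2"
    "l ^ Suc (cell_order (card S)) \<le> \<eta> * cell_dev S a b"
    "card S > 1 \<Longrightarrow> cell_dev S a b = l ^ rbar (card S)"
    "card S > 1 \<Longrightarrow> \<exists>i\<in>S. \<bar>a i\<bar> = l \<or> \<bar>b i\<bar> = l\<^sup>2"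
    "0 \<le> cell_dev S a b"
proof
  define f where "f i = max \<bar>a i\<bar> (sqrt \<bar>b i\<bar>)" for i
  define l where "l = Max (insert 0 (f ` S))"
  have l_eq: "l = Max (insert 0 ((\<lambda>i. max \<bar>a i\<bar> (sqrt \<bar>b i\<bar>)) ` S))"
    by (simp add: l_def f_def[abs_def])
  show l0: "0 \<le> l" unfolding l_def using S by (intro Max_ge) auto
  have fl: "f i \<le> l" if "i \<in> S" for i unfolding l_def using S that by (intro Max_ge) auto
  have "f i \<le> \<eta>" if "i \<in> S" for i
    using ab[OF that] \<eta> by (auto simp: f_def intro: real_le_lsqrt)
  then show l\<eta>: "l \<le> \<eta>" unfolding l_def using S \<eta> by (subst Max_le_iff) auto
  show abl: "\<bar>a i\<bar> \<le> l \<and> \<bar>b i\<bar> \<le> l\<^sup>2" if "i \<in> S" for i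
    using fl[OF that] by (auto simp: f_def intro: sqrt_le_D)
  show nonneg: "0 \<le> cell_dev S a b"
    unfolding cell_dev_def l_eq[symmetric] using l0 by (auto intro: sum_nonneg)
  show dev: "cell_dev S a b = l ^ rbar (card S)" if "card S > 1"
    using that by (simp add: cell_dev_def l_eq)
  show "\<exists>i\<in>S. \<bar>a i\<bar> = l \<or> \<bar>b i\<bar> = l\<^sup>2" if "card S > 1"
  proof -
    have ne: "S \<noteq> {}" using that by auto
    have "l \<in> insert 0 (f ` S)" unfolding l_def using S by (intro Max_in) auto
    then obtain i where i: "i \<in> S" "l = f i"
    proof (cases "l = 0")
      case True
      obtain i where "i \<in> S" using ne by blast
      moreover have "f i = 0" using fl[OF \<open>i \<in> S\<close>] True by (auto simp: f_def)
      ultimately show ?thesis using True that by simp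
    qed auto
    then show ?thesis by (intro bexI[of _ i]) (auto simp: f_def max_def)
  qed
  show "l ^ Suc (cell_order (card S)) \<le> \<eta> * cell_dev S a b"
  proof (cases "card S > 1")
    case True
    then show ?thesis using dev l0 l\<eta> by (simp add: cell_order_def mult_right_mono)
  next
    case False
    have "l\<^sup>2 \<le> cell_dev S a b"
    proof (cases "S = {}")
      case True
      then show ?thesis using nonneg by (simp add: l_def)
    next
      case ne: False
      then have "card S = 1" using False S by (metis One_nat_def card_0_eq le_less linorder_not_less less_one)
      then obtain i where i: "S = {i}" by (rule card_1_singletonE)
      then have "l = f i" by (auto simp: l_def f_def max_def)
      moreover have "(f i)\<^sup>2 \<le> \<bar>a i\<bar> + \<bar>b i\<bar>"
      proof (cases "f i = \<bar>a i\<bar>")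
        case True
        have "\<bar>a i\<bar> * \<bar>a i\<bar> \<le> \<bar>a i\<bar> * 1" using ab[of i] i \<eta> by (intro mult_left_mono) auto
        then show ?thesis using True by (simp add: power2_eq_square)
      next
        case False
        then have "f i = sqrt \<bar>b i\<bar>" by (metis f_def max_def)
        then show ?thesis by simp
      qed
      ultimately show ?thesis using i by (simp add: cell_dev_def)
    qed
    moreover have "cell_order (card S) = 2" using False by (simp add: cell_order_def)
    ultimately show ?thesis
      using l0 l\<eta> by (simp add: numeral_eq_Suc mult_mono)
  qed
qed

text \<open>With at least two atoms the scale of the cell is attained by one of them, so
  \<open>moment_lower_bound\<close> makes some coefficient at least a constant times
  \<open>l ^ rbar m\<close>. With one atom the coefficients p a and p (a^2/2 + b) give the
  deviations directly.\<close>

lemma cell_dev_bound: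
  assumes c0: "0 < c0"
  shows "\<exists>C>0. \<forall>m\<le>k. \<forall>(S :: 'i set) p a b B. finite S \<longrightarrow> card S = m \<longrightarrow>
    (\<forall>i\<in>S. c0 \<le> p i \<and> p i \<le> 1 \<and> \<bar>a i\<bar> \<le> 1 \<and> \<bar>b i\<bar> \<le> 1) \<longrightarrow>
    (\<forall>\<alpha>\<in>{1..cell_order m}. \<bar>\<Sum>i\<in>S. p i * quad_coeff \<alpha> (a i) (b i)\<bar> \<le> B) \<longrightarrow>
    cell_dev S a b \<le> C * B"
proof (rule uniform_const)
  fix m C C'
  assume H: "\<forall>(S :: 'i set) p a b B. finite S \<longrightarrow> card S = m \<longrightarrow>
    (\<forall>i\<in>S. c0 \<le> p i \<and> p i \<le> 1 \<and> \<bar>a i\<bar> \<le> 1 \<and> \<bar>b i\<bar> \<le> 1) \<longrightarrow>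
    (\<forall>\<alpha>\<in>{1..cell_order m}. \<bar>\<Sum>i\<in>S. p i * quad_coeff \<alpha> (a i) (b i)\<bar> \<le> B) \<longrightarrow>
    cell_dev S a b \<le> C * B" and le: "C \<le> C'"
  show "\<forall>(S :: 'i set) p a b B. finite S \<longrightarrow> card S = m \<longrightarrow>
    (\<forall>i\<in>S. c0 \<le> p i \<and> p i \<le> 1 \<and> \<bar>a i\<bar> \<le> 1 \<and> \<bar>b i\<bar> \<le> 1) \<longrightarrow>
    (\<forall>\<alpha>\<in>{1..cell_order m}. \<bar>\<Sum>i\<in>S. p i * quad_coeff \<alpha> (a i) (b i)\<bar> \<le> B) \<longrightarrow>
    cell_dev S a b \<le> C' * B"
  proof (intro allI impI)
    fix S :: "'i set" and p a b B
    assume A: "finite S" "card S = m" "\<forall>i\<in>S. c0 \<le> p i \<and> p i \<le> 1 \<and> \<bar>a i\<bar> \<le> 1 \<and> \<bar>b i\<bar> \<le> 1"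
      and B: "\<forall>\<alpha>\<in>{1..cell_order m}. \<bar>\<Sum>i\<in>S. p i * quad_coeff \<alpha> (a i) (b i)\<bar> \<le> B"
    have "1 \<in> {1..cell_order m}" using rbar_ge_1[of m] by (auto simp: cell_order_def)
    then have "0 \<le> B" using B by force
    have "cell_dev S a b \<le> C * B" using H A B by blast
    also have "\<dots> \<le> C' * B" using le \<open>0 \<le> B\<close> by (rule mult_right_mono)
    finally show "cell_dev S a b \<le> C' * B" .
  qed
next
  fix m :: nat
  assume "m \<le> k"
  show "\<exists>C>0. \<forall>(S :: 'i set) p a b B. finite S \<longrightarrow> card S = m \<longrightarrow>
    (\<forall>i\<in>S. c0 \<le> p i \<and> p i \<le> 1 \<and> \<bar>a i\<bar> \<le> 1 \<and> \<bar>b i\<bar> \<le> 1) \<longrightarrow>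
    (\<forall>\<alpha>\<in>{1..cell_order m}. \<bar>\<Sum>i\<in>S. p i * quad_coeff \<alpha> (a i) (b i)\<bar> \<le> B) \<longrightarrow>
    cell_dev S a b \<le> C * B"
  proof (cases "2 \<le> m")
    case True
    from moment_lower_bound[OF True c0] obtain c where c: "c > 0" and
      mom: "\<And>(S :: 'i set) (p :: 'i \<Rightarrow> real) a b l. card S = m \<Longrightarrow> 0 < l \<Longrightarrow> l \<le> 1 \<Longrightarrow>
       (\<forall>i\<in>S. c0 \<le> p i \<and> p i \<le> 1 \<and> \<bar>a i\<bar> \<le> l \<and> \<bar>b i\<bar> \<le> l\<^sup>2) \<Longrightarrow>
       (\<exists>i\<in>S. \<bar>a i\<bar> = l \<or> \<bar>b i\<bar> = l\<^sup>2) \<Longrightarrow>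
       (\<exists>\<alpha>\<in>{1..rbar m}. c * l ^ rbar m \<le> \<bar>\<Sum>i\<in>S. p i * quad_coeff \<alpha> (a i) (b i)\<bar>)"
      by blast
    show ?thesis
    proof (intro exI[of _ "1 / c"] conjI allI impI)
      show "1 / c > 0" using c by simp
      fix S :: "'i set" and p a b B
      assume S: "finite S" "card S = m"
        and A: "\<forall>i\<in>S. c0 \<le> p i \<and> p i \<le> 1 \<and> \<bar>a i\<bar> \<le> 1 \<and> \<bar>b i\<bar> \<le> 1"
        and B: "\<forall>\<alpha>\<in>{1..cell_order m}. \<bar>\<Sum>i\<in>S. p i * quad_coeff \<alpha> (a i) (b i)\<bar> \<le> B"
      have B0: "0 \<le> B" using B rbar_ge_1[of m] True by (force simp: cell_order_def)
      have A1: "\<bar>a i\<bar> \<le> 1 \<and> \<bar>b i\<bar> \<le> 1\<^sup>2" if "i \<in> S" for i using A that by simp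
      obtain l where l: "0 \<le> l" "l \<le> 1" "\<And>i. i \<in> S \<Longrightarrow> \<bar>a i\<bar> \<le> l \<and> \<bar>b i\<bar> \<le> l\<^sup>2"
        and l': "card S > 1 \<Longrightarrow> cell_dev S a b = l ^ rbar (card S)"
          "card S > 1 \<Longrightarrow> \<exists>i\<in>S. \<bar>a i\<bar> = l \<or> \<bar>b i\<bar> = l\<^sup>2"
        by (rule cell_dev_properties[of S 1 a b, OF S(1) _ _ A1]) simp_all
      have l4: "cell_dev S a b = l ^ rbar m" and l5: "\<exists>i\<in>S. \<bar>a i\<bar> = l \<or> \<bar>b i\<bar> = l\<^sup>2"
        using l' S True by auto
      show "cell_dev S a b \<le> 1 / c * B"
      proof (cases "l = 0")
        case True
        then have "cell_dev S a b = 0" using l4 rbar_ge_1[of m] by simp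
        then show ?thesis using B0 c by simp
      next
        case False
        then have "\<exists>\<alpha>\<in>{1..rbar m}. c * l ^ rbar m \<le> \<bar>\<Sum>i\<in>S. p i * quad_coeff \<alpha> (a i) (b i)\<bar>"
          using l l5 A S by (intro mom) auto
        then have "c * l ^ rbar m \<le> B" using B True by (force simp: cell_order_def)
        then show ?thesis using l4 c by (simp add: field_simps)
      qed
    qed
  next
    case False
    show ?thesis
    \<comment> \<open>For one atom, c0 |a| <= B, and c0 |b| <= 2 B because a^2/2 <= |a|; this adds
      up to 3.\<close>
    proof (intro exI[of _ "3 / c0"] conjI allI impI)
      show "3 / c0 > 0" using c0 by simp
      fix S :: "'i set" and p a b B
      assume S: "finite S" "card S = m"
        and A: "\<forall>i\<in>S. c0 \<le> p i \<and> p i \<le> 1 \<and> \<bar>a i\<bar> \<le> 1 \<and> \<bar>b i\<bar> \<le> 1"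
        and B: "\<forall>\<alpha>\<in>{1..cell_order m}. \<bar>\<Sum>i\<in>S. p i * quad_coeff \<alpha> (a i) (b i)\<bar> \<le> B"
      have co: "cell_order m = 2" using False by (simp add: cell_order_def)
      have B1: "\<bar>\<Sum>i\<in>S. p i * quad_coeff 1 (a i) (b i)\<bar> \<le> B"
        and B2: "\<bar>\<Sum>i\<in>S. p i * quad_coeff 2 (a i) (b i)\<bar> \<le> B"
        using B unfolding co by auto
      show "cell_dev S a b \<le> 3 / c0 * B"
      proof (cases "m = 1")
        case True
        then obtain i where i: "S = {i}" using S card_1_singletonE by blast
        have p: "c0 \<le> p i" "p i > 0" and ai: "\<bar>a i\<bar> \<le> 1" using A i c0 by auto
        have "c0 * \<bar>a i\<bar> \<le> p i * \<bar>a i\<bar>" using p by (intro mult_right_mono) auto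
        also have "\<dots> \<le> B" using B1 i p by (simp add: quad_coeff_simps abs_mult)
        finally have 1: "c0 * \<bar>a i\<bar> \<le> B" .
        have "c0 * \<bar>a i ^ 2 / 2 + b i\<bar> \<le> p i * \<bar>a i ^ 2 / 2 + b i\<bar>" using p by (intro mult_right_mono) auto
        also have "\<dots> \<le> B" using B2 i p by (simp add: quad_coeff_simps abs_mult)
        finally have 2: "c0 * \<bar>a i ^ 2 / 2 + b i\<bar> \<le> B" .
        have "\<bar>a i\<bar> * \<bar>a i\<bar> \<le> \<bar>a i\<bar> * 1" using ai by (intro mult_left_mono) auto
        then have "a i ^ 2 \<le> \<bar>a i\<bar>" by (simp add: power2_eq_square)
        then have "\<bar>b i\<bar> \<le> \<bar>a i ^ 2 / 2 + b i\<bar> + \<bar>a i\<bar>" 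
          using abs_triangle_ineq4[of "a i ^ 2 / 2 + b i" "a i ^ 2 / 2"] by simp
        then have "c0 * \<bar>b i\<bar> \<le> c0 * (\<bar>a i ^ 2 / 2 + b i\<bar> + \<bar>a i\<bar>)" using c0 by (intro mult_left_mono) auto
        then have "c0 * (\<bar>a i\<bar> + \<bar>b i\<bar>) \<le> 3 * B" using 1 2 by (simp add: algebra_simps)
        then show ?thesis using i c0 by (simp add: cell_dev_def field_simps)
      next
        case m: False
        then have "m = 0" using False by simp
        then have "S = {}" using S by simp
        \<comment> \<open>An empty cell falls under the power branch of \<open>cell_dev\<close> with
          maximum 0, and a zero power has to be ruled out.\<close>
        moreover have "0 < rbar 0" using rbar_ge_1[of 0] by simp
        ultimately show ?thesis using B1 c0 by (simp add: cell_dev_def zero_power)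
      qed
    qed
  qed
qed

lemma quad_exp_taylor_uniform:
  fixes r :: "nat \<Rightarrow> nat"
  shows "\<exists>K>0. \<forall>m\<le>k. \<forall>a b \<rho> t :: real. \<bar>a\<bar> \<le> \<rho> \<longrightarrow> \<bar>b\<bar> \<le> \<rho>\<^sup>2 \<longrightarrow> \<rho> \<le> 1 \<longrightarrow> \<bar>t\<bar> \<le> 1 \<longrightarrow>
     norm (exp (\<i> * of_real (a * t) - of_real (b * t\<^sup>2)) -
       (\<Sum>\<alpha>\<le>r m. \<i> ^ \<alpha> * of_real (quad_coeff \<alpha> a b * t ^ \<alpha>))) \<le> K * \<rho> ^ Suc (r m)"
proof (rule uniform_const)
  fix m C C'
  assume H: "\<forall>a b \<rho> t :: real. \<bar>a\<bar> \<le> \<rho> \<longrightarrow> \<bar>b\<bar> \<le> \<rho>\<^sup>2 \<longrightarrow> \<rho> \<le> 1 \<longrightarrow> \<bar>t\<bar> \<le> 1 \<longrightarrow>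
     norm (exp (\<i> * of_real (a * t) - of_real (b * t\<^sup>2)) -
       (\<Sum>\<alpha>\<le>r m. \<i> ^ \<alpha> * of_real (quad_coeff \<alpha> a b * t ^ \<alpha>))) \<le> C * \<rho> ^ Suc (r m)"
    and le: "C \<le> C'"
  show "\<forall>a b \<rho> t :: real. \<bar>a\<bar> \<le> \<rho> \<longrightarrow> \<bar>b\<bar> \<le> \<rho>\<^sup>2 \<longrightarrow> \<rho> \<le> 1 \<longrightarrow> \<bar>t\<bar> \<le> 1 \<longrightarrow>
     norm (exp (\<i> * of_real (a * t) - of_real (b * t\<^sup>2)) -
       (\<Sum>\<alpha>\<le>r m. \<i> ^ \<alpha> * of_real (quad_coeff \<alpha> a b * t ^ \<alpha>))) \<le> C' * \<rho> ^ Suc (r m)"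
  proof (intro allI impI)
    fix a b \<rho> t :: real
    assume A: "\<bar>a\<bar> \<le> \<rho>" "\<bar>b\<bar> \<le> \<rho>\<^sup>2" "\<rho> \<le> 1" "\<bar>t\<bar> \<le> 1"
    have "C * \<rho> ^ Suc (r m) \<le> C' * \<rho> ^ Suc (r m)"
      using A le by (intro mult_right_mono) auto
    with H A show "norm (exp (\<i> * of_real (a * t) - of_real (b * t\<^sup>2)) -
       (\<Sum>\<alpha>\<le>r m. \<i> ^ \<alpha> * of_real (quad_coeff \<alpha> a b * t ^ \<alpha>))) \<le> C' * \<rho> ^ Suc (r m)"
      by (meson order.trans)
  qed
qed (rule quad_exp_taylor)

text \<open>The expansion of the sum is a combination of independent functions plus remainders.
  Coefficients are bounded by the supremum \<open>M\<close> plus the remainders, deviations by the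
  coefficients, and remainders by \<eta> times the deviations; a small \<eta> closes the
  circle.\<close>

lemma local_inverse_bound:
  fixes J :: "'j set" and \<mu> v :: "'j \<Rightarrow> real"
  assumes J: "finite J" and inj: "inj_on (\<lambda>j. (\<mu> j, v j)) J" and v: "\<forall>j\<in>J. 0 \<le> v j"
    and c0: "0 < c0"
  shows "\<exists>C>0. \<exists>\<eta>>0. \<forall>(S :: 'j \<Rightarrow> 'i set) p a b p0 M.
    (\<forall>j\<in>J. finite (S j) \<and> card (S j) \<le> k \<and>
       (\<forall>i\<in>S j. c0 \<le> p i \<and> p i \<le> 1 \<and> \<bar>a j i\<bar> \<le> \<eta> \<and> \<bar>b j i\<bar> \<le> \<eta>\<^sup>2)) \<longrightarrow>
    (\<forall>s\<in>{-1..1}. norm (\<Sum>j\<in>J. exp (\<i> * of_real (\<mu> j * s) - of_real (v j * s\<^sup>2)) *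
       ((\<Sum>i\<in>S j. of_real (p i) * exp (\<i> * of_real (a j i * s) - of_real (b j i * s\<^sup>2))) - of_real (p0 j))) \<le> M) \<longrightarrow>
    (\<forall>j\<in>J. \<bar>(\<Sum>i\<in>S j. p i) - p0 j\<bar> \<le> C * M \<and> cell_dev (S j) (a j) (b j) \<le> C * M)"
proof -
  define R where "R = (\<Sum>m\<le>k. cell_order m)"
  have R: "cell_order m \<le> R" if "m \<le> k" for m
    unfolding R_def using that by (intro member_le_sum) auto
  define g where "g = (\<lambda>(j, \<alpha>) s. of_real s ^ \<alpha> * exp (\<i> * of_real (\<mu> j * s) - of_real (v j * s\<^sup>2)))"
  define I where "I = J \<times> {..R}"
  have "\<exists>C>0. \<forall>A M. (\<forall>s\<in>{-1..1}. norm (\<Sum>i\<in>I. A i * g i s) \<le> M) \<longrightarrow> 0 \<le> M \<longrightarrow> (\<forall>i\<in>I. norm (A i) \<le> C * M)"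
  proof (rule independent_coeff_bound)
    show "finite I" using J by (simp add: I_def)
    fix A :: "'j \<times> nat \<Rightarrow> complex"
    assume A: "\<And>s. s \<in> {-1..1} \<Longrightarrow> (\<Sum>i\<in>I. A i * g i s) = 0"
    have "\<forall>j\<in>J. \<forall>\<alpha>\<le>R. A (j, \<alpha>) = 0"
    proof (rule quad_exp_independent[where u = "\<lambda>j. \<i> * of_real (\<mu> j)" and v = "\<lambda>j. - of_real (v j)"])
      show "inj_on (\<lambda>j. (\<i> * complex_of_real (\<mu> j), - complex_of_real (v j))) J"
        using inj by (auto simp: inj_on_def)
      fix s :: real assume "s \<in> {-1..1}"
      from A[OF this] show "(\<Sum>j\<in>J. \<Sum>\<alpha>\<le>R. A (j, \<alpha>) * (of_real s ^ \<alpha> *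
          exp (\<i> * of_real (\<mu> j) * of_real s + - of_real (v j) * of_real s ^ 2))) = 0"
        unfolding I_def g_def sum.cartesian_product case_prod_unfold by (simp add: mult.assoc)
    qed fact
    then show "\<forall>i\<in>I. A i = 0" by (auto simp: I_def)
  qed
  then obtain C1 where C1: "C1 > 0" and
    ind: "\<And>A M i. (\<forall>s\<in>{-1..1}. norm (\<Sum>i\<in>I. A i * g i s) \<le> M) \<Longrightarrow> 0 \<le> M \<Longrightarrow> i \<in> I \<Longrightarrow> norm (A i) \<le> C1 * M"
    by blast
  from cell_dev_bound[OF c0, of k, where 'i = 'i] obtain C2 where C2: "C2 > 0" and
    dev0: "\<forall>m\<le>k. \<forall>(S :: 'i set) p a b B. finite S \<longrightarrow> card S = m \<longrightarrow>
    (\<forall>i\<in>S. c0 \<le> p i \<and> p i \<le> 1 \<and> \<bar>a i\<bar> \<le> 1 \<and> \<bar>b i\<bar> \<le> 1) \<longrightarrow>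
    (\<forall>\<alpha>\<in>{1..cell_order m}. \<bar>\<Sum>i\<in>S. p i * quad_coeff \<alpha> (a i) (b i)\<bar> \<le> B) \<longrightarrow>
    cell_dev S a b \<le> C2 * B" by (elim exE conjE) (rule that)
  have dev: "cell_dev S a b \<le> C2 * B" if "card S \<le> k" "finite S"
    "\<forall>i\<in>S. c0 \<le> p i \<and> p i \<le> 1 \<and> \<bar>a i\<bar> \<le> 1 \<and> \<bar>b i\<bar> \<le> 1"
    "\<forall>\<alpha>\<in>{1..cell_order (card S)}. \<bar>\<Sum>i\<in>S. p i * quad_coeff \<alpha> (a i) (b i)\<bar> \<le> B"
    for S :: "'i set" and p a b B
    using dev0[rule_format, OF that(1) that(2) refl] that(3,4) by blast
  from quad_exp_taylor_uniform[of k cell_order] obtain K where K: "K > 0" and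
    tay: "\<And>m a b \<rho> t :: real. m \<le> k \<Longrightarrow> \<bar>a\<bar> \<le> \<rho> \<Longrightarrow> \<bar>b\<bar> \<le> \<rho>\<^sup>2 \<Longrightarrow> \<rho> \<le> 1 \<Longrightarrow> \<bar>t\<bar> \<le> 1 \<Longrightarrow>
     norm (exp (\<i> * of_real (a * t) - of_real (b * t\<^sup>2)) -
       (\<Sum>\<alpha>\<le>cell_order m. \<i> ^ \<alpha> * of_real (quad_coeff \<alpha> a b * t ^ \<alpha>))) \<le> K * \<rho> ^ Suc (cell_order m)"
    by meson
  define L where "L = real (card J) * C2 * C1"
  have L0: "0 \<le> L" using C1 C2 by (simp add: L_def)
  \<comment> \<open>Chosen so that \<open>L * (real k * K * \<eta>) \<le> 1 / 2\<close>:
    \<open>L\<close> carries a supremum bound to the total deviation, and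
    \<open>real k * K * \<eta>\<close> carries the total deviation back to the remainders.\<close>
  define \<eta> where "\<eta> = min 1 (1 / (2 * (L * real k * K + 1)))"
  have den: "L * real k * K + 1 > 0" using L0 K by (simp add: add_nonneg_pos)
  have \<eta>: "0 < \<eta>" "\<eta> \<le> 1" using den by (auto simp: \<eta>_def)
  have "\<eta> * (2 * (L * real k * K + 1)) \<le> 1"
    using den mult_right_mono[of \<eta> "1 / (2 * (L * real k * K + 1))" "2 * (L * real k * K + 1)"]
    by (simp add: \<eta>_def)
  then have \<eta>L: "L * (real k * K * \<eta>) \<le> 1 / 2"
    using \<eta> by (simp add: algebra_simps)
  define C where "C = 2 * C1 + 2 * C2 * C1"
  have C: "C > 0" using C1 C2 by (simp add: C_def add_pos_pos)
  show ?thesis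
  proof (rule exI[of _ C], rule conjI[OF C], rule exI[of _ \<eta>], intro conjI allI impI \<eta>(1))
    fix S :: "'j \<Rightarrow> 'i set" and p :: "'i \<Rightarrow> real" and a b :: "'j \<Rightarrow> 'i \<Rightarrow> real" and p0 :: "'j \<Rightarrow> real" and M :: real
    assume H: "\<forall>j\<in>J. finite (S j) \<and> card (S j) \<le> k \<and>
       (\<forall>i\<in>S j. c0 \<le> p i \<and> p i \<le> 1 \<and> \<bar>a j i\<bar> \<le> \<eta> \<and> \<bar>b j i\<bar> \<le> \<eta>\<^sup>2)"
    assume M: "\<forall>s\<in>{-1..1}. norm (\<Sum>j\<in>J. exp (\<i> * of_real (\<mu> j * s) - of_real (v j * s\<^sup>2)) *
       ((\<Sum>i\<in>S j. of_real (p i) * exp (\<i> * of_real (a j i * s) - of_real (b j i * s\<^sup>2))) - of_real (p0 j))) \<le> M"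
    have M0: "0 \<le> M" by (rule order.trans[OF norm_ge_zero M[rule_format, of 0]]) simp
    define W where "W j = cell_dev (S j) (a j) (b j)" for j
    define r where "r j = cell_order (card (S j))" for j
    have rR: "r j \<le> R" if "j \<in> J" for j using H that R by (simp add: r_def)
    \<comment> \<open>At order 0 this is the weight discrepancy of the cell, since
      \<open>quad_coeff 0\<close> is 1; at higher orders it is a moment of the deviations.\<close>
    define E where "E j \<alpha> = (\<Sum>i\<in>S j. p i * quad_coeff \<alpha> (a j i) (b j i)) - (if \<alpha> = 0 then p0 j else 0)" for j \<alpha>
    \<comment> \<open>Cells are expanded to different orders \<open>r j\<close>; padding with zeros
      brings them to the common degree \<open>R\<close> over which independence is stated.\<close>
    define A where "A = (\<lambda>(j, \<alpha>). if \<alpha> \<le> r j then \<i> ^ \<alpha> * complex_of_real (E j \<alpha>) else 0)"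
    define T where "T a b m s = (\<Sum>\<alpha>\<le>m. \<i> ^ \<alpha> * complex_of_real (quad_coeff \<alpha> a b * s ^ \<alpha>))" for a b s :: real and m
    have lprop: "\<exists>l. 0 \<le> l \<and> l \<le> \<eta> \<and> (\<forall>i\<in>S j. \<bar>a j i\<bar> \<le> l \<and> \<bar>b j i\<bar> \<le> l\<^sup>2) \<and> l ^ Suc (r j) \<le> \<eta> * W j"
      and W0: "0 \<le> W j" if "j \<in> J" for j
    proof -
      have fin: "finite (S j)" and ab: "\<And>i. i \<in> S j \<Longrightarrow> \<bar>a j i\<bar> \<le> \<eta> \<and> \<bar>b j i\<bar> \<le> \<eta>\<^sup>2"
        using H that by auto
      obtain l where "0 \<le> l" "l \<le> \<eta>" "\<And>i. i \<in> S j \<Longrightarrow> \<bar>a j i\<bar> \<le> l \<and> \<bar>b j i\<bar> \<le> l\<^sup>2"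
        "l ^ Suc (cell_order (card (S j))) \<le> \<eta> * cell_dev (S j) (a j) (b j)"
        and W: "0 \<le> cell_dev (S j) (a j) (b j)"
        by (rule cell_dev_properties[of "S j" \<eta> "a j" "b j", OF fin \<eta>(2) less_imp_le[OF \<eta>(1)] ab]) (assumption, rule that)
      then show "\<exists>l. 0 \<le> l \<and> l \<le> \<eta> \<and> (\<forall>i\<in>S j. \<bar>a j i\<bar> \<le> l \<and> \<bar>b j i\<bar> \<le> l\<^sup>2) \<and> l ^ Suc (r j) \<le> \<eta> * W j"
        by (intro exI[of _ l]) (simp add: W_def r_def)
      show "0 \<le> W j" using W by (simp add: W_def)
    qed
    define W' where "W' = (\<Sum>j\<in>J. W j)"
    have W'0: "0 \<le> W'" unfolding W'_def using W0 by (rule sum_nonneg)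
    \<comment> \<open>The bound for the truncated expansion: the given supremum plus the sum of all
      Taylor remainders.\<close>
    define M' where "M' = M + real k * K * \<eta> * W'"
    have M'0: "0 \<le> M'" using M0 W'0 K \<eta> by (simp add: M'_def)
    have main: "norm (\<Sum>i\<in>I. A i * g i s) \<le> M'" if s: "s \<in> {-1..1}" for s
    proof -
      define e where "e j = exp (\<i> * complex_of_real (\<mu> j * s) - complex_of_real (v j * s\<^sup>2))" for j
      define x where "x j i = exp (\<i> * complex_of_real (a j i * s) - complex_of_real (b j i * s\<^sup>2))" for j i
      have s1: "\<bar>s\<bar> \<le> 1" using s by auto
      have e1: "norm (e j) \<le> 1" if "j \<in> J" for j
        using v that by (simp add: e_def)
      have "(\<Sum>i\<in>I. A i * g i s) = (\<Sum>j\<in>J. e j * ((\<Sum>i\<in>S j. of_real (p i) * T (a j i) (b j i) (r j) s) - of_real (p0 j)))"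
      proof -
        have "(\<Sum>\<alpha>\<le>R. A (j, \<alpha>) * g (j, \<alpha>) s) = e j * ((\<Sum>i\<in>S j. of_real (p i) * T (a j i) (b j i) (r j) s) - of_real (p0 j))"
          if j: "j \<in> J" for j
        proof -
          have "(\<Sum>\<alpha>\<le>R. A (j, \<alpha>) * g (j, \<alpha>) s) = (\<Sum>\<alpha>\<le>r j. \<i> ^ \<alpha> * complex_of_real (E j \<alpha>) * g (j, \<alpha>) s)"
            using rR[OF j] by (intro sum.mono_neutral_cong_right) (auto simp: A_def)
          also have "\<dots> = e j * ((\<Sum>\<alpha>\<le>r j. \<Sum>i\<in>S j. of_real (p i) * (\<i> ^ \<alpha> * of_real (quad_coeff \<alpha> (a j i) (b j i) * s ^ \<alpha>)))
              - (\<Sum>\<alpha>\<le>r j. if \<alpha> = 0 then of_real (p0 j) else 0))"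
            unfolding sum_subtractf[symmetric] sum_distrib_left
            by (intro sum.cong) (auto simp: E_def g_def e_def sum_distrib_left sum_distrib_right algebra_simps)
          also have "(\<Sum>\<alpha>\<le>r j. \<Sum>i\<in>S j. of_real (p i) * (\<i> ^ \<alpha> * of_real (quad_coeff \<alpha> (a j i) (b j i) * s ^ \<alpha>)))
              = (\<Sum>i\<in>S j. of_real (p i) * T (a j i) (b j i) (r j) s)"
            unfolding T_def sum_distrib_left by (rule sum.swap)
          finally show ?thesis by simp
        qed
        moreover have "(\<Sum>i\<in>I. A i * g i s) = (\<Sum>j\<in>J. \<Sum>\<alpha>\<le>R. A (j, \<alpha>) * g (j, \<alpha>) s)"
          unfolding I_def sum.cartesian_product by (simp add: case_prod_unfold)
        ultimately show ?thesis by simp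
      qed
      also have "\<dots> = (\<Sum>j\<in>J. e j * ((\<Sum>i\<in>S j. of_real (p i) * x j i) - of_real (p0 j)))
          - (\<Sum>j\<in>J. e j * (\<Sum>i\<in>S j. of_real (p i) * (x j i - T (a j i) (b j i) (r j) s)))"
        unfolding sum_subtractf[symmetric] by (intro sum.cong) (auto simp: algebra_simps sum_subtractf)
      also have "norm \<dots> \<le> M + norm (\<Sum>j\<in>J. e j * (\<Sum>i\<in>S j. of_real (p i) * (x j i - T (a j i) (b j i) (r j) s)))"
        by (rule order.trans[OF norm_triangle_ineq4]) (use M s in \<open>simp add: e_def x_def\<close>)
      also have "norm (\<Sum>j\<in>J. e j * (\<Sum>i\<in>S j. of_real (p i) * (x j i - T (a j i) (b j i) (r j) s)))
          \<le> (\<Sum>j\<in>J. real k * K * \<eta> * W j)"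
      proof (intro order.trans[OF norm_sum] sum_mono)
        fix j assume j: "j \<in> J"
        from lprop[OF j] obtain l where l: "0 \<le> l" "l \<le> \<eta>" "\<And>i. i \<in> S j \<Longrightarrow> \<bar>a j i\<bar> \<le> l \<and> \<bar>b j i\<bar> \<le> l\<^sup>2"
          "l ^ Suc (r j) \<le> \<eta> * W j" by blast
        have card: "card (S j) \<le> k" using H j by auto
        have "norm (e j * (\<Sum>i\<in>S j. of_real (p i) * (x j i - T (a j i) (b j i) (r j) s)))
            \<le> 1 * norm (\<Sum>i\<in>S j. of_real (p i) * (x j i - T (a j i) (b j i) (r j) s))"
          unfolding norm_mult using e1[OF j] by (intro mult_right_mono) auto
        also have "\<dots> \<le> (\<Sum>i\<in>S j. K * l ^ Suc (r j))"
          unfolding mult_1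
        proof (intro order.trans[OF norm_sum] sum_mono)
          fix i assume i: "i \<in> S j"
          have p: "0 \<le> p i" "p i \<le> 1" using H i j c0 by (force, force)
          have "norm (x j i - T (a j i) (b j i) (r j) s) \<le> K * l ^ Suc (r j)"
            unfolding x_def T_def r_def using l(3)[OF i] l(2) \<eta>(2) card s1 by (intro tay) auto
          then have "p i * norm (x j i - T (a j i) (b j i) (r j) s) \<le> 1 * (K * l ^ Suc (r j))"
            using p by (intro mult_mono) auto
          then show "norm (of_real (p i) * (x j i - T (a j i) (b j i) (r j) s)) \<le> K * l ^ Suc (r j)"
            using p by (simp add: norm_mult)
        qed
        also have "\<dots> = real (card (S j)) * (K * l ^ Suc (r j))" by simp
        also have "\<dots> \<le> real k * (K * (\<eta> * W j))"
          using card l K by (intro mult_mono) auto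
        finally show "norm (e j * (\<Sum>i\<in>S j. of_real (p i) * (x j i - T (a j i) (b j i) (r j) s))) \<le> real k * K * \<eta> * W j"
          by (simp add: mult.assoc)
      qed
      also have "(\<Sum>j\<in>J. real k * K * \<eta> * W j) = real k * K * \<eta> * W'" by (simp add: W'_def sum_distrib_left)
      finally show ?thesis by (simp add: M'_def)
    qed
    have EC: "\<bar>E j \<alpha>\<bar> \<le> C1 * M'" if j: "j \<in> J" and \<alpha>: "\<alpha> \<le> r j" for j \<alpha>
    proof -
      have "norm (A (j, \<alpha>)) \<le> C1 * M'"
        using main M'0 j \<alpha> rR[OF j] by (intro ind) (auto simp: I_def)
      then show ?thesis using \<alpha> by (simp add: A_def norm_mult norm_power)
    qed
    have Wj: "W j \<le> C2 * (C1 * M')" if j: "j \<in> J" for j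
      unfolding W_def
    proof (rule dev[where p = p])
      show "\<forall>\<alpha>\<in>{1..cell_order (card (S j))}. \<bar>\<Sum>i\<in>S j. p i * quad_coeff \<alpha> (a j i) (b j i)\<bar> \<le> C1 * M'"
      proof
        fix \<alpha> assume "\<alpha> \<in> {1..cell_order (card (S j))}"
        then show "\<bar>\<Sum>i\<in>S j. p i * quad_coeff \<alpha> (a j i) (b j i)\<bar> \<le> C1 * M'"
          using EC[OF j, of \<alpha>] by (simp add: r_def E_def)
      qed
      have "\<eta>\<^sup>2 \<le> 1" using \<eta> by (simp add: power_le_one)
      then show "\<forall>i\<in>S j. c0 \<le> p i \<and> p i \<le> 1 \<and> \<bar>a j i\<bar> \<le> 1 \<and> \<bar>b j i\<bar> \<le> 1"
        using H j \<eta> by (meson order.trans)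
    qed (use H j in auto)
    have "W' \<le> (\<Sum>j\<in>J. C2 * (C1 * M'))" unfolding W'_def using Wj by (rule sum_mono)
    also have "\<dots> = L * M'" by (simp add: L_def)
    \<comment> \<open>Absorption: the total deviation bounds itself with factor at most 1/2, hence
      W' <= 2 L M and then M' <= 2 M.\<close>
    finally have "W' \<le> L * M + L * (real k * K * \<eta>) * W'" by (simp add: M'_def algebra_simps)
    also have "\<dots> \<le> L * M + 1 / 2 * W'" using \<eta>L W'0 by (intro add_left_mono mult_right_mono) auto
    finally have "W' \<le> 2 * (L * M)" by simp
    then have "real k * K * \<eta> * W' \<le> real k * K * \<eta> * (2 * (L * M))"
      using K \<eta> by (intro mult_left_mono) auto
    also have "\<dots> = 2 * (L * (real k * K * \<eta>)) * M" by (simp add: algebra_simps)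
    also have "\<dots> \<le> 1 * M" using \<eta>L M0 by (intro mult_right_mono) auto
    finally have M': "M' \<le> 2 * M" by (simp add: M'_def)
    show "\<forall>j\<in>J. \<bar>(\<Sum>i\<in>S j. p i) - p0 j\<bar> \<le> C * M \<and> cell_dev (S j) (a j) (b j) \<le> C * M"
    proof (intro ballI conjI)
      fix j assume j: "j \<in> J"
      have "\<bar>(\<Sum>i\<in>S j. p i) - p0 j\<bar> \<le> C1 * M'"
        using EC[OF j, of 0] by (simp add: E_def)
      also have "\<dots> \<le> C1 * (2 * M)" using C1 M' by (intro mult_left_mono) auto
      also have "\<dots> \<le> C * M" using C1 C2 M0 by (simp add: C_def algebra_simps)
      finally show "\<bar>(\<Sum>i\<in>S j. p i) - p0 j\<bar> \<le> C * M" .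
      have "W j \<le> C2 * (C1 * (2 * M))"
        using Wj[OF j] C1 C2 M' by (meson mult_left_mono less_imp_le order.trans)
      also have "\<dots> \<le> C * M" using C1 C2 M0 by (simp add: C_def algebra_simps)
      finally show "cell_dev (S j) (a j) (b j) \<le> C * M" by (simp add: W_def)
    qed
  qed
qed

section \<open>Characteristic functions of Gaussian mixtures\<close>

lemma quad_form_sum: "t \<bullet> (M *v t) = (\<Sum>i\<in>UNIV. \<Sum>j\<in>UNIV. t $ i * (M $ i $ j * t $ j))"
  for t :: "real^'d::finite"
  by (simp add: inner_vec_def matrix_vector_mult_def sum_distrib_left)

lemma continuous_on_quad_form [continuous_intros]:
  fixes f :: "'a::topological_space \<Rightarrow> real^'d::finite^'d"
  assumes "continuous_on A f" "continuous_on A g"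
  shows "continuous_on A (\<lambda>x. g x \<bullet> (f x *v g x))"
  unfolding quad_form_sum by (intro continuous_intros assms)

lemma symmetric_mats_iff: "M \<in> symmetric_mats \<longleftrightarrow> transpose M = M"
  by (simp add: symmetric_mats_def)

lemma symmetric_inner:
  fixes M :: "real^'d::finite^'d"
  assumes "M \<in> symmetric_mats"
  shows "x \<bullet> (M *v y) = y \<bullet> (M *v x)"
  using assms by (metis dot_lmul_matrix inner_commute symmetric_mats_iff transpose_matrix_vector vector_transpose_matrix)

lemma quad_form_add:
  fixes M :: "real^'d::finite^'d"
  assumes "M \<in> symmetric_mats"
  shows "(x + s *\<^sub>R y) \<bullet> (M *v (x + s *\<^sub>R y)) = x \<bullet> (M *v x) + 2 * s * (x \<bullet> (M *v y)) + s\<^sup>2 * (y \<bullet> (M *v y))"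
  using symmetric_inner[OF assms, of y x]
  by (simp add: matrix_vector_right_distrib matrix_vector_mult_scaleR inner_add_left inner_add_right power2_eq_square algebra_simps)

lemma quad_form_eq_0:
  fixes M :: "real^'d::finite^'d"
  assumes M: "M \<in> symmetric_mats" and 0: "\<And>w. w \<bullet> (M *v w) = 0"
  shows "M = 0"
proof -
  have "x \<bullet> (M *v y) = 0" for x y
    using quad_form_add[OF M, of x 1 y] 0 by simp
  then have "M *v y = 0 *v y" for y
    by (metis inner_eq_zero_iff matrix_vector_mult_0)
  then show ?thesis by (simp add: matrix_eq)
qed

text \<open>A linear and a quadratic form that vanish on a ball vanish identically: compare their
  values at u0, u0 + s w and u0 - s w.\<close>

lemma exists_nonvanishing_in_ball:
  fixes M :: "real^'d::finite^'d"
  assumes M: "M \<in> symmetric_mats" and e: "e > 0" and ne: "x \<noteq> 0 \<or> M \<noteq> 0"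
  shows "\<exists>u\<in>ball u0 e. u \<bullet> x \<noteq> 0 \<or> u \<bullet> (M *v u) \<noteq> 0"
proof (rule ccontr)
  assume "\<not> ?thesis"
  then have 0: "u \<bullet> x = 0" "u \<bullet> (M *v u) = 0" if "u \<in> ball u0 e" for u using that by auto
  have "w \<bullet> x = 0 \<and> w \<bullet> (M *v w) = 0" for w
  proof (cases "w = 0")
    case False
    define s where "s = e / (2 * norm w)"
    have s: "s > 0" "s * norm w < e" using e False by (auto simp: s_def)
    have in_ball: "u0 \<in> ball u0 e" "u0 + s *\<^sub>R w \<in> ball u0 e" "u0 + (- s) *\<^sub>R w \<in> ball u0 e"
      using s e by (auto simp: dist_norm)
    have "(u0 + s *\<^sub>R w) \<bullet> x = u0 \<bullet> x + s * (w \<bullet> x)" by (simp add: inner_add_left)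
    then have "w \<bullet> x = 0" using 0(1)[OF in_ball(1)] 0(1)[OF in_ball(2)] s by simp
    moreover have "2 * s * (u0 \<bullet> (M *v w)) + s\<^sup>2 * (w \<bullet> (M *v w)) = 0"
      using 0(2)[OF in_ball(1)] 0(2)[OF in_ball(2)] quad_form_add[OF M, of u0 s w] by linarith
    moreover have "2 * (- s) * (u0 \<bullet> (M *v w)) + (- s)\<^sup>2 * (w \<bullet> (M *v w)) = 0"
      using 0(2)[OF in_ball(1)] 0(2)[OF in_ball(3)] quad_form_add[OF M, of u0 "- s" w] by linarith
    ultimately have "s\<^sup>2 * (w \<bullet> (M *v w)) = 0" by simp
    then show ?thesis using \<open>w \<bullet> x = 0\<close> s by simp
  qed simp
  then have "x = 0" "M = 0"
    using quad_form_eq_0[OF M] by (metis inner_eq_zero_iff, blast)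
  then show False using ne by simp
qed

text \<open>Each condition is open and can be met in every ball, so the ball is shrunk for one
  difference after another. A whole ball is kept to leave room for the norming directions.\<close>

lemma nonvanishing_ball:
  fixes D :: "((real^'d::finite) \<times> (real^'d^'d)) set"
  assumes "finite D" "\<And>x M. (x, M) \<in> D \<Longrightarrow> M \<in> symmetric_mats \<and> (x \<noteq> 0 \<or> M \<noteq> 0)"
  shows "\<exists>u0 e. e > 0 \<and> (\<forall>u\<in>ball u0 e. \<forall>(x, M)\<in>D. u \<bullet> x \<noteq> 0 \<or> u \<bullet> (M *v u) \<noteq> 0)"
  using assms
proof (induction D rule: finite_induct)
  case empty
  show ?case by (intro exI[of _ 0] exI[of _ 1]) auto
next
  case (insert d D)
  obtain x M where d: "d = (x, M)" by (cases d)
  have "\<exists>u0 e. e > 0 \<and> (\<forall>u\<in>ball u0 e. \<forall>(x, M)\<in>D. u \<bullet> x \<noteq> 0 \<or> u \<bullet> (M *v u) \<noteq> 0)"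
  proof (rule insert.IH)
    show "M \<in> symmetric_mats \<and> (x \<noteq> 0 \<or> M \<noteq> 0)" if "(x, M) \<in> D" for x M
      by (rule insert.prems) (use that in simp)
  qed
  then obtain u0 e where e: "e > 0"
    and D: "\<forall>u\<in>ball u0 e. \<forall>(x, M)\<in>D. u \<bullet> x \<noteq> 0 \<or> u \<bullet> (M *v u) \<noteq> 0" by (elim exE conjE)
  have "M \<in> symmetric_mats" "x \<noteq> 0 \<or> M \<noteq> 0" using insert.prems d by auto
  from exists_nonvanishing_in_ball[OF this(1) e this(2)] obtain u1
    where u1: "u1 \<in> ball u0 e" "u1 \<bullet> x \<noteq> 0 \<or> u1 \<bullet> (M *v u1) \<noteq> 0" by blast
  have "open ({u. u \<bullet> x \<noteq> 0} \<union> {u. u \<bullet> (M *v u) \<noteq> 0})"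
    by (intro open_Un open_Collect_neq continuous_intros)
  then have "open (ball u0 e \<inter> ({u. u \<bullet> x \<noteq> 0} \<union> {u. u \<bullet> (M *v u) \<noteq> 0}))" by (intro open_Int open_ball)
  moreover have "u1 \<in> ball u0 e \<inter> ({u. u \<bullet> x \<noteq> 0} \<union> {u. u \<bullet> (M *v u) \<noteq> 0})"
    using u1 by blast
  ultimately obtain e1 where "e1 > 0" "ball u1 e1 \<subseteq> ball u0 e \<inter> ({u. u \<bullet> x \<noteq> 0} \<union> {u. u \<bullet> (M *v u) \<noteq> 0})"
    unfolding open_contains_ball by blast
  then show ?case
    using D d by (intro exI[of _ u1] exI[of _ e1]) blast
qed

text \<open>One direction cannot bound a vector or a symmetric matrix. By compactness of the unit
  spheres finitely many do, and they may all be taken from a prescribed ball.\<close>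

lemma norming_directions:
  fixes u0 :: "real^'d::finite"
  assumes e: "e > 0"
  shows "\<exists>F C. finite F \<and> F \<subseteq> ball u0 e \<and> C > 0 \<and> (\<forall>x. \<exists>u\<in>F. norm x \<le> C * \<bar>u \<bullet> x\<bar>) \<and>
     (\<forall>M\<in>symmetric_mats. \<exists>u\<in>F. norm M \<le> C * \<bar>u \<bullet> (M *v u)\<bar>)"
proof -
  have "\<exists>F c. finite F \<and> F \<subseteq> ball u0 e \<and> c > 0 \<and> (\<forall>x\<in>sphere 0 1. \<exists>u\<in>F. \<bar>u \<bullet> x\<bar> \<ge> c)"
  proof (rule compact_family_pos_bound)
    show "compact (sphere (0 :: real^'d) 1)" by simp
    show "continuous_on (sphere 0 1) (\<lambda>x. \<bar>u \<bullet> x\<bar>)" for u :: "real^'d" by (intro continuous_intros)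
    fix x :: "real^'d" assume "x \<in> sphere 0 1"
    then have "x \<noteq> 0" by auto
    moreover have "(0 :: real^'d^'d) \<in> symmetric_mats" by (simp add: symmetric_mats_def transpose_def vec_eq_iff)
    ultimately show "\<exists>u\<in>ball u0 e. \<bar>u \<bullet> x\<bar> > 0"
      using exists_nonvanishing_in_ball[of 0 e x u0] e by (auto simp: matrix_vector_mult_0)
  qed
  then obtain F c where F: "finite F" "F \<subseteq> ball u0 e" and c: "c > 0"
    and Fc: "\<And>x. norm x = 1 \<Longrightarrow> \<exists>u\<in>F. \<bar>u \<bullet> x\<bar> \<ge> c" by (auto simp: dist_norm)
  define K where "K = symmetric_mats \<inter> sphere (0 :: real^'d^'d) 1"
  have "closed (symmetric_mats :: (real^'d^'d) set)"
  proof -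
    have eq: "symmetric_mats = (\<Inter>i. \<Inter>j. {M :: real^'d^'d. M $ j $ i = M $ i $ j})"
      by (auto simp: symmetric_mats_def transpose_def vec_eq_iff)
    show ?thesis
      unfolding eq by (intro closed_INT ballI closed_Collect_eq continuous_intros)
  qed
  then have "compact K" unfolding K_def by (intro closed_Int_compact) auto
  have "\<exists>F c. finite F \<and> F \<subseteq> ball u0 e \<and> c > 0 \<and> (\<forall>M\<in>K. \<exists>u\<in>F. \<bar>u \<bullet> (M *v u)\<bar> \<ge> c)"
  proof (rule compact_family_pos_bound[OF \<open>compact K\<close>])
    show "continuous_on K (\<lambda>M. \<bar>u \<bullet> (M *v u)\<bar>)" for u by (intro continuous_intros)
    fix M assume "M \<in> K"
    then have "M \<in> symmetric_mats" "M \<noteq> 0" by (auto simp: K_def)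
    then show "\<exists>u\<in>ball u0 e. \<bar>u \<bullet> (M *v u)\<bar> > 0"
      using exists_nonvanishing_in_ball[of M e 0 u0] e by auto
  qed
  then obtain F' c' where F': "finite F'" "F' \<subseteq> ball u0 e" and c': "c' > 0"
    and Fc': "\<And>M. M \<in> K \<Longrightarrow> \<exists>u\<in>F'. \<bar>u \<bullet> (M *v u)\<bar> \<ge> c'" by blast
  define C where "C = 1 / c + 1 / c'"
  have C: "C > 0" "1 / c \<le> C" "1 / c' \<le> C" using c c' by (auto simp: C_def add_pos_pos)
  have 1: "\<exists>u\<in>F. norm x \<le> C * \<bar>u \<bullet> x\<bar>" for x
  proof (cases "x = 0")
    case True
    from Fc[of "axis undefined 1"] obtain u where "u \<in> F" by (auto simp: norm_axis_1)
    then show ?thesis using True by auto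
  next
    case False
    then obtain u where u: "u \<in> F" "\<bar>u \<bullet> (x /\<^sub>R norm x)\<bar> \<ge> c" using Fc[of "x /\<^sub>R norm x"] by auto
    then have "c * norm x \<le> \<bar>u \<bullet> x\<bar>" using False by (simp add: abs_mult field_simps)
    then have "norm x \<le> 1 / c * \<bar>u \<bullet> x\<bar>" using c by (simp add: field_simps)
    also have "\<dots> \<le> C * \<bar>u \<bullet> x\<bar>" using C by (intro mult_right_mono) auto
    finally show ?thesis using u by blast
  qed
  have 2: "\<exists>u\<in>F \<union> F'. norm M \<le> C * \<bar>u \<bullet> (M *v u)\<bar>" if M: "M \<in> symmetric_mats" for M
  proof (cases "M = 0")
    case True
    from 1[of 0] obtain u where "u \<in> F" by blast
    then show ?thesis using True by auto
  next
    case False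
    have "M /\<^sub>R norm M \<in> K"
      using False M by (auto simp: K_def symmetric_mats_def transpose_def vec_eq_iff)
    from Fc'[OF this] obtain u where u: "u \<in> F'" "\<bar>u \<bullet> ((M /\<^sub>R norm M) *v u)\<bar> \<ge> c'" by blast
    have "c' * norm M \<le> \<bar>u \<bullet> (M *v u)\<bar>"
      using u(2) False by (simp add: scaleR_matrix_vector_assoc[symmetric] abs_mult field_simps)
    then have "norm M \<le> 1 / c' * \<bar>u \<bullet> (M *v u)\<bar>" using c' by (simp add: field_simps)
    also have "\<dots> \<le> C * \<bar>u \<bullet> (M *v u)\<bar>" using C by (intro mult_right_mono) auto
    finally show ?thesis using u by blast
  qed
  show ?thesis
    using F F' C(1) 1 2 by (intro exI[of _ "F \<union> F'"] exI[of _ C]) blast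
qed

text \<open>Both demands at once: every \<open>u\<close> in \<open>F\<close> separates the
  parameters in \<open>T\<close>, as independence along a line requires, and together the directions
  recover the norms of all deviations.\<close>

lemma generic_directions:
  fixes T :: "'d::finite param set"
  assumes T: "finite T" "\<forall>\<theta>\<in>T. snd \<theta> \<in> symmetric_mats"
  shows "\<exists>F C. finite F \<and> C > 0 \<and> (\<forall>u\<in>F. inj_on (\<lambda>\<theta>. (u \<bullet> fst \<theta>, u \<bullet> (snd \<theta> *v u) / 2)) T) \<and>
     (\<forall>x. \<exists>u\<in>F. norm x \<le> C * \<bar>u \<bullet> x\<bar>) \<and>
     (\<forall>M\<in>symmetric_mats. \<exists>u\<in>F. norm M \<le> C * \<bar>u \<bullet> (M *v u)\<bar>)"
proof -
  define D where "D = (\<lambda>(\<theta>, \<theta>'). (fst \<theta> - fst \<theta>', snd \<theta> - snd \<theta>')) ` {(\<theta>, \<theta>'). \<theta> \<in> T \<and> \<theta>' \<in> T \<and> \<theta> \<noteq> \<theta>'}"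
  have "{(\<theta>, \<theta>'). \<theta> \<in> T \<and> \<theta>' \<in> T \<and> \<theta> \<noteq> \<theta>'} \<subseteq> T \<times> T" by auto
  then have "finite D" unfolding D_def using T(1) by (meson finite_SigmaI finite_imageI finite_subset)
  moreover have "M \<in> symmetric_mats \<and> (x \<noteq> 0 \<or> M \<noteq> 0)" if xM: "(x, M) \<in> D" for x M
  proof -
    obtain \<theta> \<theta>' where t: "\<theta> \<in> T" "\<theta>' \<in> T" "\<theta> \<noteq> \<theta>'" "x = fst \<theta> - fst \<theta>'" "M = snd \<theta> - snd \<theta>'"
      using xM by (auto simp: D_def)
    have "snd \<theta> \<in> symmetric_mats" "snd \<theta>' \<in> symmetric_mats" using t T(2) by auto
    then have "M \<in> symmetric_mats" by (simp add: t symmetric_mats_def transpose_def vec_eq_iff)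
    then show ?thesis using t by (auto simp: prod_eq_iff)
  qed
  ultimately obtain u0 e where e: "e > 0"
    and D: "\<And>u. u \<in> ball u0 e \<Longrightarrow> \<forall>(x, M)\<in>D. u \<bullet> x \<noteq> 0 \<or> u \<bullet> (M *v u) \<noteq> 0"
    using nonvanishing_ball[of D] by blast
  have inj: "inj_on (\<lambda>\<theta>. (u \<bullet> fst \<theta>, u \<bullet> (snd \<theta> *v u) / 2)) T" if "u \<in> ball u0 e" for u
  proof (rule inj_onI, rule ccontr)
    fix \<theta> \<theta>' assume A: "\<theta> \<in> T" "\<theta>' \<in> T" "\<theta> \<noteq> \<theta>'"
      and eq: "(u \<bullet> fst \<theta>, u \<bullet> (snd \<theta> *v u) / 2) = (u \<bullet> fst \<theta>', u \<bullet> (snd \<theta>' *v u) / 2)"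
    have "(fst \<theta> - fst \<theta>', snd \<theta> - snd \<theta>') \<in> D" using A by (force simp: D_def)
    with D[OF that] have "u \<bullet> (fst \<theta> - fst \<theta>') \<noteq> 0 \<or> u \<bullet> ((snd \<theta> - snd \<theta>') *v u) \<noteq> 0" by blast
    then show False using eq by (simp add: inner_diff_right matrix_vector_mult_diff_rdistrib)
  qed
  from norming_directions[OF e, of u0] obtain F C where
    "finite F" "F \<subseteq> ball u0 e" "C > 0" "\<forall>x. \<exists>u\<in>F. norm x \<le> C * \<bar>u \<bullet> x\<bar>"
    "\<forall>M\<in>symmetric_mats. \<exists>u\<in>F. norm M \<le> C * \<bar>u \<bullet> (M *v u)\<bar>" by blast
  with inj show ?thesis by (intro exI[of _ F] exI[of _ C]) auto
qed

text \<open>A closed form only. That it is the Fourier integral of the density is shown in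
  \<open>gaussian_cf_integral\<close>, so the inverse bounds need no integration.\<close>

definition gauss_cf :: "'d::finite param \<Rightarrow> real^'d \<Rightarrow> complex" where
  "gauss_cf \<theta> t = exp (\<i> * of_real (t \<bullet> fst \<theta>) - of_real (t \<bullet> (snd \<theta> *v t) / 2))"

definition mixture_cf :: "'d::finite param pmf \<Rightarrow> real^'d \<Rightarrow> complex" where
  "mixture_cf G t = (\<Sum>\<theta>\<in>set_pmf G. of_real (pmf G \<theta>) * gauss_cf \<theta> t)"

lemma gauss_cf_scaleR:
  "gauss_cf \<theta> (s *\<^sub>R u) = exp (\<i> * of_real (u \<bullet> fst \<theta> * s) - of_real (u \<bullet> (snd \<theta> *v u) / 2 * s\<^sup>2))"
  by (simp add: gauss_cf_def matrix_vector_mult_scaleR power2_eq_square mult_ac)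

text \<open>Identifiability of finite Gaussian mixtures: restrict to the line spanned by a
  separating direction and use independence with \<open>R = 0\<close>.\<close>

lemma gauss_cf_independent:
  fixes T :: "'d::finite param set"
  assumes T: "finite T" "\<forall>\<theta>\<in>T. snd \<theta> \<in> symmetric_mats"
    and 0: "\<And>t. (\<Sum>\<theta>\<in>T. w \<theta> * gauss_cf \<theta> t) = 0"
  shows "\<forall>\<theta>\<in>T. w \<theta> = 0"
proof -
  from generic_directions[OF T] obtain F and C :: real where F: "\<forall>u\<in>F. inj_on (\<lambda>\<theta>. (u \<bullet> fst \<theta>, u \<bullet> (snd \<theta> *v u) / 2)) T"
    and "\<forall>x::real^'d. \<exists>u\<in>F. norm x \<le> C * \<bar>u \<bullet> x\<bar>" by blast
  then obtain u where u: "inj_on (\<lambda>\<theta>. (u \<bullet> fst \<theta>, u \<bullet> (snd \<theta> *v u) / 2)) T" by blast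
  have "\<forall>\<theta>\<in>T. \<forall>\<alpha>\<le>(0::nat). w \<theta> = 0"
  proof (rule quad_exp_independent[where A = "\<lambda>\<theta> \<alpha>. w \<theta>" and u = "\<lambda>\<theta>. \<i> * of_real (u \<bullet> fst \<theta>)" and v = "\<lambda>\<theta>. - of_real (u \<bullet> (snd \<theta> *v u) / 2)" and R = 0])
    show "inj_on (\<lambda>\<theta>. (\<i> * complex_of_real (u \<bullet> fst \<theta>), - complex_of_real (u \<bullet> (snd \<theta> *v u) / 2))) T"
      using u by (auto simp: inj_on_def)
    fix s :: real
    show "(\<Sum>\<theta>\<in>T. \<Sum>\<alpha>\<le>0. w \<theta> * (complex_of_real s ^ \<alpha> * exp (\<i> * complex_of_real (u \<bullet> fst \<theta>) * complex_of_real s +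
       - complex_of_real (u \<bullet> (snd \<theta> *v u) / 2) * (complex_of_real s)\<^sup>2))) = 0"
      using 0[of "s *\<^sub>R u"] by (simp add: gauss_cf_scaleR mult.assoc)
  qed fact
  then show ?thesis by simp
qed

section \<open>Mixing measures: compactness and the loss\<close>

lemma continuous_on_gauss_cf [continuous_intros]:
  fixes f :: "'a::topological_space \<Rightarrow> 'd::finite param"
  assumes "continuous_on A f"
  shows "continuous_on A (\<lambda>x. gauss_cf (f x) t)"
  unfolding gauss_cf_def by (intro continuous_intros assms) auto

lemma param_dist_0_iff: "param_dist \<theta> \<theta>' = 0 \<longleftrightarrow> \<theta> = \<theta>'"
  by (auto simp: param_dist_def add_nonneg_eq_0_iff prod_eq_iff)

lemma continuous_on_param_dist [continuous_intros]:
  fixes f g :: "'a::topological_space \<Rightarrow> 'd::finite param"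
  shows "continuous_on A f \<Longrightarrow> continuous_on A g \<Longrightarrow> continuous_on A (\<lambda>x. param_dist (f x) (g x))"
  unfolding param_dist_def by (intro continuous_intros)

text \<open>Indexing by position makes the configurations compact although atoms may merge. Atom 0
  is the one far from \<open>G0\<close>; it keeps weight at least \<open>c0\<close> where
  \<open>G0\<close> has none, which identifiability forbids if the characteristic functions
  agree.\<close>

lemma indexed_mixture_separation:
  fixes \<Theta> :: "'d::finite param set" and m :: nat
  assumes \<Theta>: "compact \<Theta>" "snd ` \<Theta> \<subseteq> symmetric_mats"
    and G0: "finite (set_pmf G0)" "set_pmf G0 \<subseteq> \<Theta>"
    and c0: "0 < c0" and \<delta>: "0 < \<delta>" and m: "0 < m"
  shows "\<exists>c>0. \<forall>p \<theta>. (\<forall>i<m. c0 \<le> p i \<and> p i \<le> 1 \<and> \<theta> i \<in> \<Theta>) \<longrightarrow>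
     (\<forall>\<theta>0\<in>set_pmf G0. \<delta> \<le> param_dist (\<theta> 0) \<theta>0) \<longrightarrow>
     (\<exists>t. c \<le> norm ((\<Sum>i<m. of_real (p i) * gauss_cf (\<theta> i) t) - mixture_cf G0 t))"
proof -
  define B where "B = PiE UNIV (\<lambda>i. if i < m then {c0..1} \<times> \<Theta> else {(0::real, 0)})"
  define K where "K = B \<inter> (\<Inter>\<theta>0\<in>set_pmf G0. {x. \<delta> \<le> param_dist (snd (x 0)) \<theta>0})"
  have coord: "continuous_on A (\<lambda>x::nat \<Rightarrow> real \<times> 'd param. x j)" for j A
    by (rule continuous_on_subset[OF continuous_on_product_coordinates]) auto
  have "compact B"
    unfolding B_def using \<Theta>(1) by (intro compact_PiE_UNIV) (auto intro: compact_Times)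
  moreover have "closed {x::nat \<Rightarrow> real \<times> 'd param. \<delta> \<le> param_dist (snd (x 0)) \<theta>0}" for \<theta>0
    by (intro closed_Collect_le continuous_intros coord)
  ultimately have "compact K"
    unfolding K_def by (intro compact_Int_closed closed_INT ballI)
  define h where "h t x = norm ((\<Sum>i<m. of_real (fst (x i)) * gauss_cf (snd (x i)) t) - mixture_cf G0 t)"
    for t and x :: "nat \<Rightarrow> real \<times> 'd param"
  have "\<exists>F c. finite F \<and> F \<subseteq> UNIV \<and> c > 0 \<and> (\<forall>x\<in>K. \<exists>t\<in>F. h t x \<ge> c)"
  proof (rule compact_family_pos_bound[OF \<open>compact K\<close>])
    show "continuous_on K (h t)" for t
      unfolding h_def by (intro continuous_intros coord)
    fix x assume x: "x \<in> K"
    then have "x \<in> B" by (simp add: K_def)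
    have xi: "c0 \<le> fst (x i)" "snd (x i) \<in> \<Theta>" if "i < m" for i
    proof -
      have "x i \<in> (if i < m then {c0..1} \<times> \<Theta> else {(0::real, 0)})"
        using \<open>x \<in> B\<close> unfolding B_def by (rule PiE_mem) simp
      then show "c0 \<le> fst (x i)" "snd (x i) \<in> \<Theta>" using that by (auto simp: mem_Times_iff)
    qed
    define T where "T = set_pmf G0 \<union> (\<lambda>i. snd (x i)) ` {..<m}"
    \<comment> \<open>Indexed atoms may coincide, so weights at equal parameters are added before
      independence is applied.\<close>
    define w where "w \<theta> = (\<Sum>i | i \<in> {..<m} \<and> snd (x i) = \<theta>. fst (x i))" for \<theta>
    show "\<exists>t\<in>UNIV. h t x > 0"
    proof (rule ccontr)
      assume "\<not> ?thesis"
      then have h0: "h t x = 0" for t by (auto simp: h_def)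
      have "\<forall>\<theta>\<in>T. complex_of_real (w \<theta> - pmf G0 \<theta>) = 0"
      proof (rule gauss_cf_independent)
        show "finite T" using G0 by (simp add: T_def)
        show "\<forall>\<theta>\<in>T. snd \<theta> \<in> symmetric_mats"
          using \<Theta>(2) G0 xi by (auto simp: T_def)
        fix t
        have "(\<Sum>\<theta>\<in>T. of_real (w \<theta>) * gauss_cf \<theta> t) = (\<Sum>\<theta>\<in>T. \<Sum>i | i \<in> {..<m} \<and> snd (x i) = \<theta>. of_real (fst (x i)) * gauss_cf (snd (x i)) t)"
          unfolding w_def of_real_sum sum_distrib_right by (intro sum.cong refl) auto
        also have "\<dots> = (\<Sum>i<m. of_real (fst (x i)) * gauss_cf (snd (x i)) t)"
          using \<open>finite T\<close> by (intro sum.group) (auto simp: T_def)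
        finally have 1: "(\<Sum>\<theta>\<in>T. of_real (w \<theta>) * gauss_cf \<theta> t) = (\<Sum>i<m. of_real (fst (x i)) * gauss_cf (snd (x i)) t)" .
        have 2: "(\<Sum>\<theta>\<in>T. of_real (pmf G0 \<theta>) * gauss_cf \<theta> t) = mixture_cf G0 t"
          unfolding mixture_cf_def using \<open>finite T\<close>
          by (intro sum.mono_neutral_right) (auto simp: T_def set_pmf_iff)
        have "(\<Sum>\<theta>\<in>T. complex_of_real (w \<theta> - pmf G0 \<theta>) * gauss_cf \<theta> t)
          = (\<Sum>i<m. of_real (fst (x i)) * gauss_cf (snd (x i)) t) - mixture_cf G0 t"
          unfolding 1[symmetric] 2[symmetric] by (simp add: sum_subtractf left_diff_distrib)
        also have "\<dots> = 0" using h0[of t] by (simp add: h_def)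
        finally show "(\<Sum>\<theta>\<in>T. complex_of_real (w \<theta> - pmf G0 \<theta>) * gauss_cf \<theta> t) = 0" .
      qed
      moreover have "snd (x 0) \<in> T" using m by (auto simp: T_def)
      ultimately have "w (snd (x 0)) = pmf G0 (snd (x 0))" by (simp flip: of_real_diff)
      moreover have "snd (x 0) \<notin> set_pmf G0"
      proof
        assume "snd (x 0) \<in> set_pmf G0"
        then have "\<delta> \<le> param_dist (snd (x 0)) (snd (x 0))" using x by (simp add: K_def)
        then show False using \<delta> by (simp add: param_dist_def)
      qed
      moreover have "w (snd (x 0)) > 0"
        unfolding w_def
      proof (rule sum_pos)
        show "0 < fst (x i)" if "i \<in> {i. i \<in> {..<m} \<and> snd (x i) = snd (x 0)}" for i
          using xi(1)[of i] that c0 by simp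
      qed (use m in auto)
      ultimately show False by (simp add: set_pmf_iff)
    qed
  qed
  then obtain F c where c: "c > 0" and Fc: "\<And>x. x \<in> K \<Longrightarrow> \<exists>t\<in>F. h t x \<ge> c" by blast
  show ?thesis
  proof (rule exI[of _ c], intro conjI allI impI c)
    fix p :: "nat \<Rightarrow> real" and \<theta> :: "nat \<Rightarrow> 'd param"
    assume H: "\<forall>i<m. c0 \<le> p i \<and> p i \<le> 1 \<and> \<theta> i \<in> \<Theta>" "\<forall>\<theta>0\<in>set_pmf G0. \<delta> \<le> param_dist (\<theta> 0) \<theta>0"
    define x where "x i = (if i < m then (p i, \<theta> i) else (0, 0))" for i
    have "x \<in> K" using H m unfolding K_def B_def x_def by auto
    from Fc[OF this] obtain t where "h t x \<ge> c" by blast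
    moreover have "(\<Sum>i<m. of_real (fst (x i)) * gauss_cf (snd (x i)) t) = (\<Sum>i<m. of_real (p i) * gauss_cf (\<theta> i) t)"
      by (intro sum.cong) (auto simp: x_def)
    ultimately show "\<exists>t. c \<le> norm ((\<Sum>i<m. of_real (p i) * gauss_cf (\<theta> i) t) - mixture_cf G0 t)"
      by (auto simp: h_def)
  qed
qed

lemma far_mixture_separation:
  fixes \<Theta> :: "'d::finite param set"
  assumes \<Theta>: "compact \<Theta>" "snd ` \<Theta> \<subseteq> symmetric_mats"
    and G0: "finite (set_pmf G0)" "set_pmf G0 \<subseteq> \<Theta>"
    and c0: "0 < c0" and \<delta>: "0 < \<delta>"
  shows "\<exists>C>0. \<forall>G\<in>mixing_le k \<Theta>. (\<forall>\<theta>\<in>set_pmf G. c0 \<le> pmf G \<theta>) \<longrightarrow>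
     (\<exists>\<theta>\<in>set_pmf G. \<forall>\<theta>0\<in>set_pmf G0. \<delta> \<le> param_dist \<theta> \<theta>0) \<longrightarrow>
     (\<exists>t. 1 \<le> C * norm (mixture_cf G t - mixture_cf G0 t))"
proof -
  \<comment> \<open>A bound of the form 1 <= C * norm, unlike c <= norm, is preserved when the
    constant grows, as \<open>uniform_const\<close> demands.\<close>
  have "\<exists>C>0. \<forall>m\<le>k. \<forall>p \<theta>. (\<forall>i<m. c0 \<le> p i \<and> p i \<le> 1 \<and> \<theta> i \<in> \<Theta>) \<longrightarrow> 0 < m \<longrightarrow>
     (\<forall>\<theta>0\<in>set_pmf G0. \<delta> \<le> param_dist (\<theta> 0) \<theta>0) \<longrightarrow>
     (\<exists>t. 1 \<le> C * norm ((\<Sum>i<m. of_real (p i) * gauss_cf (\<theta> i) t) - mixture_cf G0 t))"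
  proof (rule uniform_const)
    fix m C C'
    assume H: "\<forall>p \<theta>. (\<forall>i<m. c0 \<le> p i \<and> p i \<le> 1 \<and> \<theta> i \<in> \<Theta>) \<longrightarrow> 0 < m \<longrightarrow>
     (\<forall>\<theta>0\<in>set_pmf G0. \<delta> \<le> param_dist (\<theta> 0) \<theta>0) \<longrightarrow>
     (\<exists>t. 1 \<le> C * norm ((\<Sum>i<m. of_real (p i) * gauss_cf (\<theta> i) t) - mixture_cf G0 t))" and le: "C \<le> C'"
    have "1 \<le> C * y \<Longrightarrow> 0 \<le> y \<Longrightarrow> 1 \<le> C' * y" for y
      using mult_right_mono[OF le, of y] by linarith
    with H show "\<forall>p \<theta>. (\<forall>i<m. c0 \<le> p i \<and> p i \<le> 1 \<and> \<theta> i \<in> \<Theta>) \<longrightarrow> 0 < m \<longrightarrow>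
     (\<forall>\<theta>0\<in>set_pmf G0. \<delta> \<le> param_dist (\<theta> 0) \<theta>0) \<longrightarrow>
     (\<exists>t. 1 \<le> C' * norm ((\<Sum>i<m. of_real (p i) * gauss_cf (\<theta> i) t) - mixture_cf G0 t))"
      by (meson norm_ge_zero)
  next
    fix m :: nat
    show "\<exists>C>0. \<forall>p \<theta>. (\<forall>i<m. c0 \<le> p i \<and> p i \<le> 1 \<and> \<theta> i \<in> \<Theta>) \<longrightarrow> 0 < m \<longrightarrow>
     (\<forall>\<theta>0\<in>set_pmf G0. \<delta> \<le> param_dist (\<theta> 0) \<theta>0) \<longrightarrow>
     (\<exists>t. 1 \<le> C * norm ((\<Sum>i<m. of_real (p i) * gauss_cf (\<theta> i) t) - mixture_cf G0 t))"
    proof (cases "0 < m")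
      case True
      from indexed_mixture_separation[OF \<Theta> G0 c0 \<delta> True] obtain c where c: "c > 0"
        and sep: "\<forall>p \<theta>. (\<forall>i<m. c0 \<le> p i \<and> p i \<le> 1 \<and> \<theta> i \<in> \<Theta>) \<longrightarrow>
     (\<forall>\<theta>0\<in>set_pmf G0. \<delta> \<le> param_dist (\<theta> 0) \<theta>0) \<longrightarrow>
     (\<exists>t. c \<le> norm ((\<Sum>i<m. of_real (p i) * gauss_cf (\<theta> i) t) - mixture_cf G0 t))" by (elim exE conjE)
      have "c \<le> y \<longleftrightarrow> 1 \<le> 1 / c * y" for y using c by (simp add: field_simps)
      then show ?thesis using sep c by (intro exI[of _ "1 / c"]) simp
    qed (auto intro: exI[of _ 1])
  qed
  then obtain C where C: "C > 0" and
    sep: "\<forall>m\<le>k. \<forall>p \<theta>. (\<forall>i<m. c0 \<le> p i \<and> p i \<le> 1 \<and> \<theta> i \<in> \<Theta>) \<longrightarrow> 0 < m \<longrightarrow>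
     (\<forall>\<theta>0\<in>set_pmf G0. \<delta> \<le> param_dist (\<theta> 0) \<theta>0) \<longrightarrow>
     (\<exists>t. 1 \<le> C * norm ((\<Sum>i<m. of_real (p i) * gauss_cf (\<theta> i) t) - mixture_cf G0 t))" by (elim exE conjE)
  show ?thesis
  proof (rule exI[of _ C], intro conjI ballI impI C)
    fix G assume G: "G \<in> mixing_le k \<Theta>" and w: "\<forall>\<theta>\<in>set_pmf G. c0 \<le> pmf G \<theta>"
      and ex: "\<exists>\<theta>\<in>set_pmf G. \<forall>\<theta>0\<in>set_pmf G0. \<delta> \<le> param_dist \<theta> \<theta>0"
    have fin: "finite (set_pmf G)" "set_pmf G \<subseteq> \<Theta>" "card (set_pmf G) \<le> k" using G by (auto simp: mixing_le_def)
    obtain f where f: "bij_betw f {..<card (set_pmf G)} (set_pmf G)"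
      using ex_bij_betw_nat_finite[OF fin(1)] by (auto simp: atLeast0LessThan)
    define m where "m = card (set_pmf G)"
    have m: "0 < m" using fin(1) set_pmf_not_empty by (auto simp: m_def card_gt_0_iff)
    obtain \<theta> where \<theta>: "\<theta> \<in> set_pmf G" "\<forall>\<theta>0\<in>set_pmf G0. \<delta> \<le> param_dist \<theta> \<theta>0" using ex by blast
    have "\<theta> \<in> f ` {..<m}" using f \<theta>(1) by (simp add: bij_betw_def m_def)
    then obtain i where i: "i < m" "f i = \<theta>" by auto
    \<comment> \<open>The enumeration is changed so that the far atom has index 0.\<close>
    define g where "g = f \<circ> Transposition.transpose 0 i"
    have "bij_betw (Transposition.transpose 0 i) {..<m} {..<m}"
      using i m by (simp add: bij_betw_transpose_iff)
    then have g: "bij_betw g {..<m} (set_pmf G)"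
      unfolding g_def using f by (auto simp: m_def intro: bij_betw_trans)
    have g0: "g 0 = \<theta>" using i by (simp add: g_def)
    have gi: "g j \<in> set_pmf G" if "j < m" for j using bij_betwE[OF g] that by auto
    have "\<exists>t. 1 \<le> C * norm ((\<Sum>i<m. of_real (pmf G (g i)) * gauss_cf (g i) t) - mixture_cf G0 t)"
    proof (rule sep[rule_format])
      show "c0 \<le> pmf G (g j) \<and> pmf G (g j) \<le> 1 \<and> g j \<in> \<Theta>" if "j < m" for j
        using w gi[OF that] fin(2) by (auto simp: pmf_le_1)
    qed (use fin m \<theta> g0 in \<open>auto simp: m_def\<close>)
    moreover have "(\<Sum>i<m. of_real (pmf G (g i)) * gauss_cf (g i) t) = mixture_cf G t" for t
      unfolding mixture_cf_def by (rule sum.reindex_bij_betw[OF g])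
    ultimately show "\<exists>t. 1 \<le> C * norm (mixture_cf G t - mixture_cf G0 t)" by simp
  qed
qed

section \<open>Bounds for the loss, cell by cell\<close>

lemma cell_dev_ge:
  fixes a b :: "'i \<Rightarrow> real"
  assumes S: "finite S" and i: "i \<in> S"
  shows "card S = 1 \<Longrightarrow> \<bar>a i\<bar> \<le> cell_dev S a b \<and> \<bar>b i\<bar> \<le> cell_dev S a b"
    and "card S > 1 \<Longrightarrow> \<bar>a i\<bar> ^ rbar (card S) \<le> cell_dev S a b \<and>
      \<bar>b i\<bar> powr (real (rbar (card S)) / 2) \<le> cell_dev S a b"
proof -
  show "\<bar>a i\<bar> \<le> cell_dev S a b \<and> \<bar>b i\<bar> \<le> cell_dev S a b" if 1: "card S = 1"
  proof -
    have "S = {i}" using 1 i by (metis card_1_singletonE singletonD)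
    then show ?thesis by (simp add: cell_dev_def)
  qed
  assume "card S > 1"
  define r where "r = rbar (card S)"
  define l where "l = Max (insert 0 ((\<lambda>i. max \<bar>a i\<bar> (sqrt \<bar>b i\<bar>)) ` S))"
  have dev: "cell_dev S a b = l ^ r" using \<open>card S > 1\<close> by (simp add: cell_dev_def l_def r_def)
  have "max \<bar>a i\<bar> (sqrt \<bar>b i\<bar>) \<le> l" unfolding l_def using S i by (intro Max_ge) auto
  then have l: "\<bar>a i\<bar> \<le> l" "sqrt \<bar>b i\<bar> \<le> l" by auto
  have "\<bar>b i\<bar> powr (real r / 2) = sqrt \<bar>b i\<bar> ^ r"
    by (cases "b i = 0") (use rbar_ge_1[of "card S"] in \<open>auto simp: r_def zero_power powr_half_sqrt[symmetric] powr_powr powr_realpow[symmetric]\<close>)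
  then show "\<bar>a i\<bar> ^ rbar (card S) \<le> cell_dev S a b \<and> \<bar>b i\<bar> powr (real (rbar (card S)) / 2) \<le> cell_dev S a b"
    using l unfolding dev r_def[symmetric] by (auto intro: power_mono)
qed

lemma voronoi_cell_subset: "voronoi_cell G G0 \<theta>0 \<subseteq> set_pmf G"
  by (auto simp: voronoi_cell_def)

text \<open>There are at most \<open>k\<close> cells of at most \<open>k\<close> atoms, hence k^2 D
  for each of the two deviation sums and k D for the weights.\<close>

lemma mixing_loss_le:
  fixes G G0 :: "'d::finite param pmf"
  assumes G: "finite (set_pmf G)" "card (set_pmf G) \<le> k" and G0: "finite (set_pmf G0)" "card (set_pmf G0) \<le> k"
    and D: "0 \<le> D"
    and weights: "\<And>\<theta>0. \<theta>0 \<in> set_pmf G0 \<Longrightarrow> \<bar>(\<Sum>\<theta>\<in>voronoi_cell G G0 \<theta>0. pmf G \<theta>) - pmf G0 \<theta>0\<bar> \<le> D"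
    and single: "\<And>\<theta>0 \<theta>. \<theta>0 \<in> set_pmf G0 \<Longrightarrow> card (voronoi_cell G G0 \<theta>0) = 1 \<Longrightarrow> \<theta> \<in> voronoi_cell G G0 \<theta>0 \<Longrightarrow>
      param_dist \<theta> \<theta>0 \<le> D"
    and multi: "\<And>\<theta>0 \<theta>. \<theta>0 \<in> set_pmf G0 \<Longrightarrow> card (voronoi_cell G G0 \<theta>0) > 1 \<Longrightarrow> \<theta> \<in> voronoi_cell G G0 \<theta>0 \<Longrightarrow>
      norm (fst \<theta> - fst \<theta>0) ^ rbar (card (voronoi_cell G G0 \<theta>0)) +
      norm (snd \<theta> - snd \<theta>0) powr (real (rbar (card (voronoi_cell G G0 \<theta>0))) / 2) \<le> D"
  shows "mixing_loss G G0 \<le> (2 * (real k * real k) + real k) * D"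
proof -
  have cellcard: "real (card (voronoi_cell G G0 \<theta>0)) \<le> real k" for \<theta>0
    using card_mono[OF G(1) voronoi_cell_subset] G(2) by (meson of_nat_mono order.trans)
  have inner: "(\<Sum>\<theta>\<in>voronoi_cell G G0 \<theta>0. pmf G \<theta> * f \<theta>) \<le> real k * D"
    if f: "\<And>\<theta>. \<theta> \<in> voronoi_cell G G0 \<theta>0 \<Longrightarrow> f \<theta> \<le> D" "\<And>\<theta>. 0 \<le> f \<theta>" for f and \<theta>0
  proof -
    have "pmf G \<theta> * f \<theta> \<le> D" if "\<theta> \<in> voronoi_cell G G0 \<theta>0" for \<theta>
      using mult_mono[OF pmf_le_1 f(1)[OF that], of G \<theta>] f(2) by simp
    then have "(\<Sum>\<theta>\<in>voronoi_cell G G0 \<theta>0. pmf G \<theta> * f \<theta>) \<le> real (card (voronoi_cell G G0 \<theta>0)) * D"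
      by (rule sum_le_card_mult)
    also have "\<dots> \<le> real k * D" using cellcard D by (intro mult_right_mono)
    finally show ?thesis .
  qed
  have outer: "(\<Sum>\<theta>0 | \<theta>0 \<in> set_pmf G0 \<and> P \<theta>0. g \<theta>0) \<le> real k * E"
    if "\<And>\<theta>0. \<theta>0 \<in> set_pmf G0 \<Longrightarrow> P \<theta>0 \<Longrightarrow> g \<theta>0 \<le> E" "0 \<le> E" for P g E
  proof -
    have "(\<Sum>\<theta>0 | \<theta>0 \<in> set_pmf G0 \<and> P \<theta>0. g \<theta>0) \<le> real (card {\<theta>0. \<theta>0 \<in> set_pmf G0 \<and> P \<theta>0}) * E"
      using that by (intro sum_le_card_mult) auto
    also have "\<dots> \<le> real k * E"
      using card_mono[OF G0(1), of "{\<theta>0. \<theta>0 \<in> set_pmf G0 \<and> P \<theta>0}"] G0(2) that(2)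
      by (intro mult_right_mono) auto
    finally show ?thesis .
  qed
  have "mixing_loss G G0 \<le> real k * (real k * D) + real k * (real k * D) + real k * D"
    unfolding mixing_loss_def
  proof (intro add_mono outer inner)
    show "(\<Sum>\<theta>0\<in>set_pmf G0. \<bar>(\<Sum>\<theta>\<in>voronoi_cell G G0 \<theta>0. pmf G \<theta>) - pmf G0 \<theta>0\<bar>) \<le> real k * D"
      using outer[of "\<lambda>_. True" "\<lambda>\<theta>0. \<bar>(\<Sum>\<theta>\<in>voronoi_cell G G0 \<theta>0. pmf G \<theta>) - pmf G0 \<theta>0\<bar>" D] weights D by simp
  qed (use single multi D in \<open>auto simp: param_dist_def\<close>)
  then show ?thesis by (simp add: algebra_simps)
qed

lemma mixing_loss_nonneg: "0 \<le> mixing_loss G G0"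
  unfolding mixing_loss_def param_dist_def
  by (intro add_nonneg_nonneg sum_nonneg mult_nonneg_nonneg zero_le_power) auto

lemma power_le_sum_powers:
  fixes x :: real and k m :: nat and r :: "nat \<Rightarrow> nat"
  assumes "m \<le> k" "0 \<le> x" "x \<le> B" "1 \<le> B"
  shows "x ^ r m \<le> (\<Sum>m\<le>k. B ^ r m)" "x powr (real (r m) / 2) \<le> (\<Sum>m\<le>k. B ^ r m)"
proof -
  have "B ^ r m \<le> (\<Sum>m\<le>k. B ^ r m)"
    using assms by (intro member_le_sum) auto
  moreover have "x ^ r m \<le> B ^ r m" using assms by (intro power_mono) auto
  moreover have "x powr (real (r m) / 2) \<le> B ^ r m"
  proof -
    have "x powr (real (r m) / 2) \<le> B powr (real (r m) / 2)"
      using assms by (intro powr_mono2) auto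
    also have "\<dots> \<le> B powr real (r m)" using assms by (intro powr_mono) auto
    also have "\<dots> = B ^ r m" using assms by (simp add: powr_realpow)
    finally show ?thesis .
  qed
  ultimately show "x ^ r m \<le> (\<Sum>m\<le>k. B ^ r m)" "x powr (real (r m) / 2) \<le> (\<Sum>m\<le>k. B ^ r m)" by linarith+
qed

text \<open>The crude bound used where nothing better is available: for mixtures far from
  \<open>G0\<close>, and on the exceptional event.\<close>

lemma mixing_loss_bounded:
  fixes \<Theta> :: "'d::finite param set"
  assumes \<Theta>: "bounded \<Theta>" and G0: "G0 \<in> mixing_le k \<Theta>"
  shows "\<exists>L>0. \<forall>G\<in>mixing_le k \<Theta>. mixing_loss G G0 \<le> L"
proof -
  obtain B0 where B0: "\<And>\<theta>. \<theta> \<in> \<Theta> \<Longrightarrow> norm \<theta> \<le> B0" using \<Theta> by (auto simp: bounded_iff)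
  define B where "B = max 1 (2 * B0)"
  have B: "1 \<le> B" by (simp add: B_def)
  have nB: "norm (fst \<theta> - fst \<theta>') \<le> B" "norm (snd \<theta> - snd \<theta>') \<le> B" if "\<theta> \<in> \<Theta>" "\<theta>' \<in> \<Theta>" for \<theta> \<theta>'
  proof -
    have "norm (\<theta> - \<theta>') \<le> B" using norm_triangle_ineq4[of \<theta> \<theta>'] B0[OF that(1)] B0[OF that(2)] by (simp add: B_def)
    moreover have "norm (fst z) \<le> norm z" "norm (snd z) \<le> norm z" for z :: "'d param"
      by (metis norm_fst_le prod.collapse, metis norm_snd_le prod.collapse)
    ultimately show "norm (fst \<theta> - fst \<theta>') \<le> B" "norm (snd \<theta> - snd \<theta>') \<le> B"
      by (metis fst_diff order.trans, metis snd_diff order.trans)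
  qed
  define D where "D = 2 * B + 2 * (\<Sum>m\<le>k. B ^ rbar m)"
  have S0: "0 \<le> (\<Sum>m\<le>k. B ^ rbar m)" using B by (intro sum_nonneg) auto
  have D: "2 \<le> D" using S0 B by (simp add: D_def)
  have "mixing_loss G G0 \<le> (2 * (real k * real k) + real k) * D" if G: "G \<in> mixing_le k \<Theta>" for G
  proof (rule mixing_loss_le)
    show "finite (set_pmf G)" "card (set_pmf G) \<le> k" "finite (set_pmf G0)" "card (set_pmf G0) \<le> k"
      using G G0 by (auto simp: mixing_le_def)
    show "0 \<le> D" using D by simp
    fix \<theta>0 assume \<theta>0: "\<theta>0 \<in> set_pmf G0"
    have "set_pmf G \<subseteq> \<Theta>" "set_pmf G0 \<subseteq> \<Theta>" using G G0 by (auto simp: mixing_le_def)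
    then have inT: "\<theta>0 \<in> \<Theta>" "\<And>\<theta>. \<theta> \<in> voronoi_cell G G0 \<theta>0 \<Longrightarrow> \<theta> \<in> \<Theta>"
      using \<theta>0 voronoi_cell_subset[of G G0 \<theta>0] by blast+
    have "(\<Sum>\<theta>\<in>voronoi_cell G G0 \<theta>0. pmf G \<theta>) \<le> (\<Sum>\<theta>\<in>set_pmf G. pmf G \<theta>)"
      using G by (intro sum_mono2 voronoi_cell_subset) (auto simp: mixing_le_def)
    also have "\<dots> = 1" using G by (intro sum_pmf_eq_1) (auto simp: mixing_le_def)
    finally have "(\<Sum>\<theta>\<in>voronoi_cell G G0 \<theta>0. pmf G \<theta>) \<le> 1" .
    moreover have "0 \<le> (\<Sum>\<theta>\<in>voronoi_cell G G0 \<theta>0. pmf G \<theta>)" by (intro sum_nonneg) auto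
    ultimately show "\<bar>(\<Sum>\<theta>\<in>voronoi_cell G G0 \<theta>0. pmf G \<theta>) - pmf G0 \<theta>0\<bar> \<le> D"
      using pmf_le_1[of G0 \<theta>0] pmf_nonneg[of G0 \<theta>0] D by linarith
    fix \<theta> assume \<theta>: "\<theta> \<in> voronoi_cell G G0 \<theta>0"
    note n = nB[OF inT(2)[OF \<theta>] inT(1)]
    show "param_dist \<theta> \<theta>0 \<le> D" using n S0 by (simp add: param_dist_def D_def)
    have "card (voronoi_cell G G0 \<theta>0) \<le> k"
      using card_mono[OF _ voronoi_cell_subset, of G G0 \<theta>0] G by (auto simp: mixing_le_def)
    from power_le_sum_powers(1)[OF this norm_ge_zero n(1) B, of rbar]
      power_le_sum_powers(2)[OF this norm_ge_zero n(2) B, of rbar]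
    show "norm (fst \<theta> - fst \<theta>0) ^ rbar (card (voronoi_cell G G0 \<theta>0)) +
      norm (snd \<theta> - snd \<theta>0) powr (real (rbar (card (voronoi_cell G G0 \<theta>0))) / 2) \<le> D"
      using B by (simp add: D_def)
  qed
  moreover have "0 \<le> (2 * (real k * real k) + real k) * D" using D by simp
  ultimately show ?thesis
    by (intro exI[of _ "(2 * (real k * real k) + real k) * D + 1"] conjI ballI)
       (simp_all only: add_nonneg_pos zero_less_one add_increasing2 zero_le_one)
qed

text \<open>Voronoi cells may overlap at ties. If each atom of \<open>G\<close> is within \<delta>
  of some atom of \<open>G0\<close>, and these are at least 2 \<delta> apart, the cells are these
  balls, which partition the support.\<close>

definition near_cell :: "real \<Rightarrow> 'd::finite param pmf \<Rightarrow> 'd param \<Rightarrow> 'd param set" where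
  "near_cell \<delta> G \<theta>0 = {\<theta> \<in> set_pmf G. param_dist \<theta> \<theta>0 < \<delta>}"

lemma param_dist_commute: "param_dist \<theta> \<theta>' = param_dist \<theta>' \<theta>"
  by (simp add: param_dist_def norm_minus_commute)

lemma param_dist_triangle: "param_dist x z \<le> param_dist x y + param_dist y z"
proof -
  have "norm (fst x - fst z) \<le> norm (fst x - fst y) + norm (fst y - fst z)"
    using norm_triangle_ineq[of "fst x - fst y" "fst y - fst z"] by simp
  moreover have "norm (snd x - snd z) \<le> norm (snd x - snd y) + norm (snd y - snd z)"
    using norm_triangle_ineq[of "snd x - snd y" "snd y - snd z"] by simp
  ultimately show ?thesis by (simp add: param_dist_def)
qed

lemma voronoi_cell_eq_near_cell:
  assumes sep: "\<And>\<theta> \<theta>'. \<theta> \<in> set_pmf G0 \<Longrightarrow> \<theta>' \<in> set_pmf G0 \<Longrightarrow> \<theta> \<noteq> \<theta>' \<Longrightarrow> 2 * \<delta> \<le> param_dist \<theta> \<theta>'"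
    and near: "\<And>\<theta>. \<theta> \<in> set_pmf G \<Longrightarrow> \<exists>\<theta>0\<in>set_pmf G0. param_dist \<theta> \<theta>0 < \<delta>"
    and \<theta>0: "\<theta>0 \<in> set_pmf G0"
  shows "voronoi_cell G G0 \<theta>0 = near_cell \<delta> G \<theta>0"
proof (intro equalityI subsetI)
  fix \<theta> assume \<theta>: "\<theta> \<in> voronoi_cell G G0 \<theta>0"
  then have "\<theta> \<in> set_pmf G" by (simp add: voronoi_cell_def)
  from near[OF this] obtain \<theta>1 where \<theta>1: "\<theta>1 \<in> set_pmf G0" "param_dist \<theta> \<theta>1 < \<delta>" by blast
  then have "param_dist \<theta> \<theta>0 < \<delta>"
    using \<theta> unfolding voronoi_cell_def by (cases "\<theta>1 = \<theta>0") force+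
  then show "\<theta> \<in> near_cell \<delta> G \<theta>0" using \<open>\<theta> \<in> set_pmf G\<close> by (simp add: near_cell_def)
next
  fix \<theta> assume \<theta>: "\<theta> \<in> near_cell \<delta> G \<theta>0"
  have "param_dist \<theta> \<theta>0 \<le> param_dist \<theta> \<theta>1" if "\<theta>1 \<in> set_pmf G0 - {\<theta>0}" for \<theta>1
    using sep[OF \<theta>0, of \<theta>1] that \<theta> param_dist_triangle[of \<theta>0 \<theta>1 \<theta>] param_dist_commute[of \<theta> \<theta>0]
    by (auto simp: near_cell_def)
  then show "\<theta> \<in> voronoi_cell G G0 \<theta>0"
    using \<theta> by (auto simp: voronoi_cell_def near_cell_def)
qed

lemma sum_near_cells:
  assumes sep: "\<And>\<theta> \<theta>'. \<theta> \<in> set_pmf G0 \<Longrightarrow> \<theta>' \<in> set_pmf G0 \<Longrightarrow> \<theta> \<noteq> \<theta>' \<Longrightarrow> 2 * \<delta> \<le> param_dist \<theta> \<theta>'"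
    and near: "\<And>\<theta>. \<theta> \<in> set_pmf G \<Longrightarrow> \<exists>\<theta>0\<in>set_pmf G0. param_dist \<theta> \<theta>0 < \<delta>"
    and fin: "finite (set_pmf G)" "finite (set_pmf G0)"
  shows "(\<Sum>\<theta>\<in>set_pmf G. f \<theta>) = (\<Sum>\<theta>0\<in>set_pmf G0. \<Sum>\<theta>\<in>near_cell \<delta> G \<theta>0. f \<theta>)"
proof -
  have "set_pmf G = (\<Union>\<theta>0\<in>set_pmf G0. near_cell \<delta> G \<theta>0)"
    using near by (auto simp: near_cell_def)
  then have "(\<Sum>\<theta>\<in>set_pmf G. f \<theta>) = sum f (\<Union>\<theta>0\<in>set_pmf G0. near_cell \<delta> G \<theta>0)" by simp
  also have "\<dots> = (\<Sum>\<theta>0\<in>set_pmf G0. \<Sum>\<theta>\<in>near_cell \<delta> G \<theta>0. f \<theta>)"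
  proof (rule sum.UNION_disjoint)
    show "\<forall>i\<in>set_pmf G0. \<forall>j\<in>set_pmf G0. i \<noteq> j \<longrightarrow> near_cell \<delta> G i \<inter> near_cell \<delta> G j = {}"
    proof (intro ballI impI equals0I)
      fix i j \<theta> assume "i \<in> set_pmf G0" "j \<in> set_pmf G0" "i \<noteq> j" "\<theta> \<in> near_cell \<delta> G i \<inter> near_cell \<delta> G j"
      then show False
        using sep[of i j] param_dist_triangle[of i j \<theta>] param_dist_commute[of \<theta> i] by (auto simp: near_cell_def)
    qed
  qed (use fin in \<open>auto simp: near_cell_def\<close>)
  finally show ?thesis .
qed

section \<open>Reduction to one direction\<close>

text \<open>In one direction \<open>u\<close>, and for atoms close to those of \<open>G0\<close>, the mixture is a one-dimensional
  problem for the deviations \<open>u \<bullet> (\<mu> - \<mu>0)\<close> and \<open>u \<bullet> ((\<Sigma> - \<Sigma>0) u) / 2\<close>.\<close>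

definition mean_dev :: "real^'d::finite \<Rightarrow> 'd param \<Rightarrow> 'd param \<Rightarrow> real" where
  "mean_dev u \<theta>0 \<theta> = u \<bullet> (fst \<theta> - fst \<theta>0)"

definition cov_dev :: "real^'d::finite \<Rightarrow> 'd param \<Rightarrow> 'd param \<Rightarrow> real" where
  "cov_dev u \<theta>0 \<theta> = u \<bullet> ((snd \<theta> - snd \<theta>0) *v u) / 2"

lemma directional_dev_bound:
  fixes u :: "real^'d::finite"
  shows "\<exists>K>0. \<forall>\<theta> \<theta>0. \<bar>mean_dev u \<theta>0 \<theta>\<bar> \<le> K * param_dist \<theta> \<theta>0 \<and> \<bar>cov_dev u \<theta>0 \<theta>\<bar> \<le> K * param_dist \<theta> \<theta>0"
proof -
  have "linear (\<lambda>M :: real^'d^'d. u \<bullet> (M *v u) / 2)"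
    by (rule linearI) (simp_all add: matrix_vector_mult_add_rdistrib inner_add_right add_divide_distrib scaleR_matrix_vector_assoc[symmetric])
  then obtain K0 where K0: "\<And>M. \<bar>u \<bullet> (M *v u) / 2\<bar> \<le> K0 * norm M"
    using linear_bounded by (metis real_norm_def)
  define K where "K = norm u + \<bar>K0\<bar> + 1"
  have K: "norm u \<le> K" "K0 \<le> K" "0 \<le> K" using norm_ge_zero[of u] abs_ge_self[of K0] abs_ge_zero[of K0] unfolding K_def by linarith+
  have "\<bar>mean_dev u \<theta>0 \<theta>\<bar> \<le> K * param_dist \<theta> \<theta>0 \<and> \<bar>cov_dev u \<theta>0 \<theta>\<bar> \<le> K * param_dist \<theta> \<theta>0" for \<theta> \<theta>0
  proof
    have "\<bar>mean_dev u \<theta>0 \<theta>\<bar> \<le> norm u * norm (fst \<theta> - fst \<theta>0)"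
      unfolding mean_dev_def by (rule Cauchy_Schwarz_ineq2)
    also have "\<dots> \<le> K * param_dist \<theta> \<theta>0" using K by (intro mult_mono) (auto simp: param_dist_def)
    finally show "\<bar>mean_dev u \<theta>0 \<theta>\<bar> \<le> K * param_dist \<theta> \<theta>0" .
    have "\<bar>cov_dev u \<theta>0 \<theta>\<bar> \<le> K0 * norm (snd \<theta> - snd \<theta>0)" unfolding cov_dev_def by (rule K0)
    also have "\<dots> \<le> K * param_dist \<theta> \<theta>0" using K by (intro mult_mono) (auto simp: param_dist_def)
    finally show "\<bar>cov_dev u \<theta>0 \<theta>\<bar> \<le> K * param_dist \<theta> \<theta>0" .
  qed
  moreover have "K > 0" by (simp add: K_def add_nonneg_pos)
  ultimately show ?thesis by blast
qed

definition near_mixture :: "real \<Rightarrow> real \<Rightarrow> nat \<Rightarrow> 'd::finite param pmf \<Rightarrow> 'd param pmf \<Rightarrow> bool" where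
  "near_mixture \<delta> c0 k G0 G \<longleftrightarrow> finite (set_pmf G) \<and> card (set_pmf G) \<le> k \<and>
     (\<forall>\<theta>\<in>set_pmf G. c0 \<le> pmf G \<theta> \<and> (\<exists>\<theta>0\<in>set_pmf G0. param_dist \<theta> \<theta>0 < \<delta>))"

text \<open>The exponent of \<open>gauss_cf\<close> is linear in the parameter. Along the line
  through \<open>u\<close> its value at an atom is therefore the value at the centre of the cell
  times exp (i a s - b s^2), the form treated by \<open>local_inverse_bound\<close>.\<close>

lemma directional_inverse_bound:
  fixes G0 :: "'d::finite param pmf"
  assumes G0: "finite (set_pmf G0)" and pos: "\<And>\<theta>. \<theta> \<in> set_pmf G0 \<Longrightarrow> 0 \<le> u \<bullet> (snd \<theta> *v u)"
    and inj: "inj_on (\<lambda>\<theta>. (u \<bullet> fst \<theta>, u \<bullet> (snd \<theta> *v u) / 2)) (set_pmf G0)"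
    and c0: "0 < c0" and \<delta>1: "0 < \<delta>1"
    and sep: "\<And>\<theta> \<theta>'. \<theta> \<in> set_pmf G0 \<Longrightarrow> \<theta>' \<in> set_pmf G0 \<Longrightarrow> \<theta> \<noteq> \<theta>' \<Longrightarrow> 2 * \<delta>1 \<le> param_dist \<theta> \<theta>'"
  shows "\<exists>C>0. \<exists>\<delta>>0. \<forall>G M. near_mixture \<delta> c0 k G0 G \<longrightarrow> (\<forall>t. norm (mixture_cf G t - mixture_cf G0 t) \<le> M) \<longrightarrow>
    (\<forall>\<theta>0\<in>set_pmf G0. \<bar>(\<Sum>\<theta>\<in>voronoi_cell G G0 \<theta>0. pmf G \<theta>) - pmf G0 \<theta>0\<bar> \<le> C * M \<and>
       cell_dev (voronoi_cell G G0 \<theta>0) (mean_dev u \<theta>0) (cov_dev u \<theta>0) \<le> C * M)"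
proof -
  let ?\<mu> = "\<lambda>\<theta>. u \<bullet> fst \<theta>" and ?v = "\<lambda>\<theta>. u \<bullet> (snd \<theta> *v u) / 2"
  have v0: "\<forall>\<theta>\<in>set_pmf G0. 0 \<le> ?v \<theta>" using pos by simp
  from local_inverse_bound[where \<mu> = ?\<mu> and v = ?v and J = "set_pmf G0" and k = k and 'i = "'d param", OF G0 inj v0 c0]
  obtain C \<eta> where C: "C > 0" and \<eta>: "\<eta> > 0" and loc:
    "\<forall>(S :: 'd param \<Rightarrow> 'd param set) p a b p0 M.
    (\<forall>j\<in>set_pmf G0. finite (S j) \<and> card (S j) \<le> k \<and>
       (\<forall>i\<in>S j. c0 \<le> p i \<and> p i \<le> 1 \<and> \<bar>a j i\<bar> \<le> \<eta> \<and> \<bar>b j i\<bar> \<le> \<eta>\<^sup>2)) \<longrightarrow>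
    (\<forall>s\<in>{-1..1}. norm (\<Sum>j\<in>set_pmf G0. exp (\<i> * of_real (?\<mu> j * s) - of_real (?v j * s\<^sup>2)) *
       ((\<Sum>i\<in>S j. of_real (p i) * exp (\<i> * of_real (a j i * s) - of_real (b j i * s\<^sup>2))) - of_real (p0 j))) \<le> M) \<longrightarrow>
    (\<forall>j\<in>set_pmf G0. \<bar>(\<Sum>i\<in>S j. p i) - p0 j\<bar> \<le> C * M \<and> cell_dev (S j) (a j) (b j) \<le> C * M)"
    by (elim exE conjE) (rule that)
  from directional_dev_bound[of u] obtain K where K: "K > 0"
    "\<And>\<theta> \<theta>0. \<bar>mean_dev u \<theta>0 \<theta>\<bar> \<le> K * param_dist \<theta> \<theta>0" "\<And>\<theta> \<theta>0. \<bar>cov_dev u \<theta>0 \<theta>\<bar> \<le> K * param_dist \<theta> \<theta>0"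
    by blast
  \<comment> \<open>Three demands: Voronoi cells are balls (\<open>\<delta>1\<close>), mean
    deviations are at most \<eta>, and covariance deviations, of weight 2, are at most
    \<eta>^2.\<close>
  define \<delta> where "\<delta> = min \<delta>1 (min (\<eta> / K) (\<eta>\<^sup>2 / K))"
  have \<delta>: "0 < \<delta>" "\<delta> \<le> \<delta>1" "K * \<delta> \<le> \<eta>" "K * \<delta> \<le> \<eta>\<^sup>2"
    using \<delta>1 \<eta> K(1) by (auto simp: \<delta>_def min_def field_simps)
  show ?thesis
  proof (rule exI[of _ C], rule conjI[OF C], rule exI[of _ \<delta>], rule conjI[OF \<delta>(1)], intro allI impI)
    fix G M
    assume near: "near_mixture \<delta> c0 k G0 G" and M: "\<forall>t. norm (mixture_cf G t - mixture_cf G0 t) \<le> M"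
    have G: "finite (set_pmf G)" "card (set_pmf G) \<le> k" "\<And>\<theta>. \<theta> \<in> set_pmf G \<Longrightarrow> c0 \<le> pmf G \<theta>"
      and near': "\<And>\<theta>. \<theta> \<in> set_pmf G \<Longrightarrow> \<exists>\<theta>0\<in>set_pmf G0. param_dist \<theta> \<theta>0 < \<delta>"
      using near by (auto simp: near_mixture_def)
    have sep': "2 * \<delta> \<le> param_dist \<theta> \<theta>'" if "\<theta> \<in> set_pmf G0" "\<theta>' \<in> set_pmf G0" "\<theta> \<noteq> \<theta>'" for \<theta> \<theta>'
      using sep[OF that] \<delta>(2) by linarith
    define S where "S = near_cell \<delta> G"
    have S: "voronoi_cell G G0 \<theta>0 = S \<theta>0" if "\<theta>0 \<in> set_pmf G0" for \<theta>0
      unfolding S_def using sep' near' that by (rule voronoi_cell_eq_near_cell)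
    have "\<forall>j\<in>set_pmf G0. \<bar>(\<Sum>i\<in>S j. pmf G i) - pmf G0 j\<bar> \<le> C * M \<and> cell_dev (S j) (mean_dev u j) (cov_dev u j) \<le> C * M"
    proof (rule loc[THEN spec, THEN spec, THEN spec, THEN spec, THEN spec, THEN spec, THEN mp, THEN mp])
      show "\<forall>j\<in>set_pmf G0. finite (S j) \<and> card (S j) \<le> k \<and>
         (\<forall>i\<in>S j. c0 \<le> pmf G i \<and> pmf G i \<le> 1 \<and> \<bar>mean_dev u j i\<bar> \<le> \<eta> \<and> \<bar>cov_dev u j i\<bar> \<le> \<eta>\<^sup>2)"
      proof (intro ballI conjI)
        fix j assume "j \<in> set_pmf G0"
        have sub: "S j \<subseteq> set_pmf G" by (auto simp: S_def near_cell_def)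
        show "finite (S j)" using sub G(1) by (rule finite_subset)
        show "card (S j) \<le> k" using card_mono[OF G(1) sub] G(2) by simp
        fix i assume i: "i \<in> S j"
        show "c0 \<le> pmf G i" using i sub G(3) by blast
        show "pmf G i \<le> 1" by (rule pmf_le_1)
        have "K * param_dist i j \<le> K * \<delta>" using i K(1) by (intro mult_left_mono) (auto simp: S_def near_cell_def)
        then show "\<bar>mean_dev u j i\<bar> \<le> \<eta>" "\<bar>cov_dev u j i\<bar> \<le> \<eta>\<^sup>2"
          using K(2)[of j i] K(3)[of j i] \<delta> by linarith+
      qed
      show "\<forall>s\<in>{-1..1}. norm (\<Sum>j\<in>set_pmf G0. exp (\<i> * of_real (?\<mu> j * s) - of_real (?v j * s\<^sup>2)) *
         ((\<Sum>i\<in>S j. of_real (pmf G i) * exp (\<i> * of_real (mean_dev u j i * s) - of_real (cov_dev u j i * s\<^sup>2))) - of_real (pmf G0 j))) \<le> M"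
      proof
      fix s :: real assume "s \<in> {-1..1}"
      have "exp (\<i> * of_real (?\<mu> j * s) - of_real (?v j * s\<^sup>2)) * exp (\<i> * of_real (mean_dev u j i * s) - of_real (cov_dev u j i * s\<^sup>2))
          = gauss_cf i (s *\<^sub>R u)" for i j
        unfolding gauss_cf_scaleR exp_add[symmetric]
        by (intro arg_cong[where f = exp])
           (simp add: mean_dev_def cov_dev_def inner_diff_right matrix_vector_mult_diff_rdistrib diff_divide_distrib ring_distribs)
      then have "(\<Sum>j\<in>set_pmf G0. exp (\<i> * of_real (?\<mu> j * s) - of_real (?v j * s\<^sup>2)) *
         ((\<Sum>i\<in>S j. of_real (pmf G i) * exp (\<i> * of_real (mean_dev u j i * s) - of_real (cov_dev u j i * s\<^sup>2))) - of_real (pmf G0 j)))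
        = (\<Sum>j\<in>set_pmf G0. (\<Sum>i\<in>S j. of_real (pmf G i) * gauss_cf i (s *\<^sub>R u)) - of_real (pmf G0 j) * gauss_cf j (s *\<^sub>R u))"
        by (intro sum.cong refl) (simp add: right_diff_distrib sum_distrib_left mult_ac gauss_cf_scaleR)
      also have "\<dots> = mixture_cf G (s *\<^sub>R u) - mixture_cf G0 (s *\<^sub>R u)"
        unfolding mixture_cf_def S_def sum_subtractf
        by (subst sum_near_cells[where G = G, OF sep' near' G(1) G0]) simp_all
      finally show "norm (\<Sum>j\<in>set_pmf G0. exp (\<i> * of_real (?\<mu> j * s) - of_real (?v j * s\<^sup>2)) *
         ((\<Sum>i\<in>S j. of_real (pmf G i) * exp (\<i> * of_real (mean_dev u j i * s) - of_real (cov_dev u j i * s\<^sup>2))) - of_real (pmf G0 j))) \<le> M"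
        using M by simp
      qed
    qed
    then show "\<forall>\<theta>0\<in>set_pmf G0. \<bar>(\<Sum>\<theta>\<in>voronoi_cell G G0 \<theta>0. pmf G \<theta>) - pmf G0 \<theta>0\<bar> \<le> C * M \<and>
       cell_dev (voronoi_cell G G0 \<theta>0) (mean_dev u \<theta>0) (cov_dev u \<theta>0) \<le> C * M"
      by (simp add: S)
  qed
qed

section \<open>From all directions to the loss\<close>

lemma uniform_const2:
  fixes Q :: "'a \<Rightarrow> real \<Rightarrow> real \<Rightarrow> bool"
  assumes F: "finite F" and ex: "\<And>u. u \<in> F \<Longrightarrow> \<exists>C>0. \<exists>\<delta>>0. Q u C \<delta>"
    and mono: "\<And>u C C' \<delta> \<delta>'. Q u C \<delta> \<Longrightarrow> C \<le> C' \<Longrightarrow> \<delta>' \<le> \<delta> \<Longrightarrow> Q u C' \<delta>'"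
  shows "\<exists>C>0. \<exists>\<delta>>0. \<forall>u\<in>F. Q u C \<delta>"
  using F ex
proof (induction F rule: finite_induct)
  case empty
  show ?case by (rule exI[of _ 1], simp, rule exI[of _ 1], simp)
next
  case (insert u F)
  have "\<exists>C>0. \<exists>\<delta>>0. \<forall>u\<in>F. Q u C \<delta>" by (rule insert.IH) (use insert.prems in blast)
  then obtain C \<delta> where 1: "C > 0" "\<delta> > 0" "\<forall>u\<in>F. Q u C \<delta>" by blast
  obtain C' \<delta>' where 2: "C' > 0" "\<delta>' > 0" "Q u C' \<delta>'" using insert.prems[of u] by blast
  have pos: "max C C' > 0" "min \<delta> \<delta>' > 0" using 1 2 by auto
  show ?case
  proof (rule exI[of _ "max C C'"], rule conjI[OF pos(1)], rule exI[of _ "min \<delta> \<delta>'"], rule conjI[OF pos(2)], rule ballI)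
    fix w assume "w \<in> insert u F"
    then show "Q w (max C C') (min \<delta> \<delta>')"
      using 1(3) 2(3) mono[of u C' \<delta>' "max C C'" "min \<delta> \<delta>'"] mono[of w C \<delta> "max C C'" "min \<delta> \<delta>'"] by auto
  qed
qed

lemma near_mixture_mono: "near_mixture \<delta>' c0 k G0 G \<Longrightarrow> \<delta>' \<le> \<delta> \<Longrightarrow> near_mixture \<delta> c0 k G0 G"
  unfolding near_mixture_def by (meson less_le_trans)

lemma finite_separation:
  assumes "finite T"
  shows "\<exists>\<delta>>0. \<forall>\<theta>\<in>T. \<forall>\<theta>'\<in>T. \<theta> \<noteq> \<theta>' \<longrightarrow> 2 * \<delta> \<le> param_dist \<theta> \<theta>'"
proof -
  define D where "D = insert 1 ((\<lambda>(\<theta>, \<theta>'). param_dist \<theta> \<theta>') ` {(\<theta>, \<theta>'). \<theta> \<in> T \<and> \<theta>' \<in> T \<and> \<theta> \<noteq> \<theta>'})"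
  have "{(\<theta>, \<theta>'). \<theta> \<in> T \<and> \<theta>' \<in> T \<and> \<theta> \<noteq> \<theta>'} \<subseteq> T \<times> T" by auto
  then have fin: "finite D" unfolding D_def using assms by (meson finite.insertI finite_SigmaI finite_imageI finite_subset)
  have "0 \<le> param_dist \<theta> \<theta>'" for \<theta> \<theta>' :: "'a param" by (simp add: param_dist_def)
  then have pos: "\<forall>d\<in>D. 0 < d" by (auto simp: D_def order_less_le param_dist_0_iff eq_commute[of 0])
  have "Min D > 0" using pos fin by (subst Min_gr_iff) (auto simp: D_def)
  moreover have "Min D \<le> param_dist \<theta> \<theta>'" if "\<theta> \<in> T" "\<theta>' \<in> T" "\<theta> \<noteq> \<theta>'" for \<theta> \<theta>'
    using fin that by (intro Min_le) (force simp: D_def)+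
  ultimately show ?thesis by (intro exI[of _ "Min D / 2"]) auto
qed

text \<open>For each atom some direction sees its mean deviation in full up to a constant, another
  its covariance deviation. The cell deviations in all directions are bounded by the same multiple
  of \<open>M\<close>, so the directions may vary with the atom.\<close>

lemma mixing_loss_cf_bound:
  fixes \<Theta> :: "'d::finite param set"
  assumes \<Theta>: "compact \<Theta>" "snd ` \<Theta> \<subseteq> pos_def_mats" and G0: "G0 \<in> mixing_le k \<Theta>" and c0: "0 < c0"
  shows "\<exists>C>0. \<forall>G\<in>mixing_le k \<Theta>. \<forall>M. (\<forall>\<theta>\<in>set_pmf G. c0 \<le> pmf G \<theta>) \<longrightarrow>
    (\<forall>t. norm (mixture_cf G t - mixture_cf G0 t) \<le> M) \<longrightarrow> mixing_loss G G0 \<le> C * M"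
proof -
  have sym: "snd ` \<Theta> \<subseteq> symmetric_mats" using \<Theta>(2) by (auto simp: pos_def_mats_def)
  have G0': "finite (set_pmf G0)" "set_pmf G0 \<subseteq> \<Theta>" "card (set_pmf G0) \<le> k" using G0 by (auto simp: mixing_le_def)
  have pos: "0 \<le> u \<bullet> (snd \<theta> *v u)" if "\<theta> \<in> \<Theta>" for u \<theta>
    using \<Theta>(2) that by (cases "u = 0") (force simp: pos_def_mats_def)+
  have sym0: "\<forall>\<theta>\<in>set_pmf G0. snd \<theta> \<in> symmetric_mats" using G0' sym by blast
  from finite_separation[OF G0'(1)] obtain \<delta>1 where \<delta>1: "\<delta>1 > 0"
    and sep: "\<And>\<theta> \<theta>'. \<theta> \<in> set_pmf G0 \<Longrightarrow> \<theta>' \<in> set_pmf G0 \<Longrightarrow> \<theta> \<noteq> \<theta>' \<Longrightarrow> 2 * \<delta>1 \<le> param_dist \<theta> \<theta>'" by blast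
  from generic_directions[OF G0'(1) sym0] obtain F and Cn :: real where F: "finite F" and Cn: "Cn > 0"
    and inj: "\<forall>u\<in>F. inj_on (\<lambda>\<theta>. (u \<bullet> fst \<theta>, u \<bullet> (snd \<theta> *v u) / 2)) (set_pmf G0)"
    and Fx: "\<forall>x. \<exists>u\<in>F. norm x \<le> Cn * \<bar>u \<bullet> x\<bar>"
    and FM: "\<forall>M\<in>symmetric_mats. \<exists>u\<in>F. norm M \<le> Cn * \<bar>u \<bullet> (M *v u)\<bar>" by (elim exE conjE)
  define Q where "Q u C \<delta> \<longleftrightarrow> (\<forall>G M. near_mixture \<delta> c0 k G0 G \<longrightarrow> (\<forall>t. norm (mixture_cf G t - mixture_cf G0 t) \<le> M) \<longrightarrow>
    (\<forall>\<theta>0\<in>set_pmf G0. \<bar>(\<Sum>\<theta>\<in>voronoi_cell G G0 \<theta>0. pmf G \<theta>) - pmf G0 \<theta>0\<bar> \<le> C * M \<and>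
       cell_dev (voronoi_cell G G0 \<theta>0) (mean_dev u \<theta>0) (cov_dev u \<theta>0) \<le> C * M))" for u C \<delta>
  have "\<exists>C>0. \<exists>\<delta>>0. \<forall>u\<in>F. Q u C \<delta>"
  proof (rule uniform_const2[OF F])
    show "\<exists>C>0. \<exists>\<delta>>0. Q u C \<delta>" if "u \<in> F" for u
      unfolding Q_def
    proof (rule directional_inverse_bound[OF G0'(1) _ inj[rule_format, OF that] c0 \<delta>1])
      show "0 \<le> u \<bullet> (snd \<theta> *v u)" if "\<theta> \<in> set_pmf G0" for \<theta>
        using that G0'(2) by (intro pos) blast
    qed (rule sep)
    show "Q u C' \<delta>'" if Q: "Q u C \<delta>" and le: "C \<le> C'" "\<delta>' \<le> \<delta>" for u C C' \<delta> \<delta>'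
      unfolding Q_def
    proof (intro allI impI ballI)
      fix G M \<theta>0
      assume A: "near_mixture \<delta>' c0 k G0 G" "\<forall>t. norm (mixture_cf G t - mixture_cf G0 t) \<le> M" "\<theta>0 \<in> set_pmf G0"
      have "0 \<le> M" using A(2) norm_ge_zero order.trans by blast
      then have "C * M \<le> C' * M" using le by (intro mult_right_mono)
      moreover have "\<bar>(\<Sum>\<theta>\<in>voronoi_cell G G0 \<theta>0. pmf G \<theta>) - pmf G0 \<theta>0\<bar> \<le> C * M \<and>
       cell_dev (voronoi_cell G G0 \<theta>0) (mean_dev u \<theta>0) (cov_dev u \<theta>0) \<le> C * M"
        using Q[unfolded Q_def, rule_format, OF near_mixture_mono[OF A(1) le(2)] A(2)[rule_format] A(3)] .
      ultimately show "\<bar>(\<Sum>\<theta>\<in>voronoi_cell G G0 \<theta>0. pmf G \<theta>) - pmf G0 \<theta>0\<bar> \<le> C' * M \<and>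
       cell_dev (voronoi_cell G G0 \<theta>0) (mean_dev u \<theta>0) (cov_dev u \<theta>0) \<le> C' * M" by linarith
    qed
  qed
  then obtain C1 \<delta> where C1: "C1 > 0" and \<delta>: "\<delta> > 0" and Q: "\<And>u. u \<in> F \<Longrightarrow> Q u C1 \<delta>" by blast
  from far_mixture_separation[OF \<Theta>(1) sym G0'(1,2) c0 \<delta>, of k] obtain C2 where C2: "C2 > 0" and
    far: "\<forall>G\<in>mixing_le k \<Theta>. (\<forall>\<theta>\<in>set_pmf G. c0 \<le> pmf G \<theta>) \<longrightarrow>
     (\<exists>\<theta>\<in>set_pmf G. \<forall>\<theta>0\<in>set_pmf G0. \<delta> \<le> param_dist \<theta> \<theta>0) \<longrightarrow>
     (\<exists>t. 1 \<le> C2 * norm (mixture_cf G t - mixture_cf G0 t))" by (elim exE conjE)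
  from mixing_loss_bounded[OF compact_imp_bounded[OF \<Theta>(1)] G0] obtain L where L: "L > 0"
    "\<And>G. G \<in> mixing_le k \<Theta> \<Longrightarrow> mixing_loss G G0 \<le> L" by blast
  \<comment> \<open>The factor 2 undoes the division by 2 in \<open>cov_dev\<close>; the maximum
    with 1 makes powers of the constant increase with the exponent.\<close>
  define Cm where "Cm = max 1 (2 * Cn)"
  have Cm: "1 \<le> Cm" "Cn \<le> Cm" "2 * Cn \<le> Cm" using Cn by (auto simp: Cm_def)
  \<comment> \<open>Lone atoms lose a factor \<open>Cm\<close> in each of two norms. In larger cells
    \<open>Cm\<close> is raised to a power depending on the cell size, bounded by the sum over all
    sizes.\<close>
  define D where "D = 2 * Cm + 2 * (\<Sum>m\<le>k. Cm ^ rbar m)"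
  have S0: "0 \<le> (\<Sum>m\<le>k. Cm ^ rbar m)" using Cm by (intro sum_nonneg) auto
  have D: "1 \<le> D" using S0 Cm by (simp add: D_def)
  define N where "N = 2 * (real k * real k) + real k"
  \<comment> \<open>The first summand serves mixtures near \<open>G0\<close>, the second the others,
    whose loss is at most \<open>L\<close>.\<close>
  define C where "C = N * (D * C1) + L * C2"
  have N0: "0 \<le> N" by (simp add: N_def)
  have Cpos: "C > 0" using N0 D C1 L C2 by (simp add: C_def add_nonneg_pos)
  show ?thesis
  proof (rule exI[of _ C], intro conjI ballI allI impI Cpos)
    fix G M
    assume G: "G \<in> mixing_le k \<Theta>" and w: "\<forall>\<theta>\<in>set_pmf G. c0 \<le> pmf G \<theta>"
      and M: "\<forall>t. norm (mixture_cf G t - mixture_cf G0 t) \<le> M"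
    have M0: "0 \<le> M" using M norm_ge_zero order.trans by blast
    show "mixing_loss G G0 \<le> C * M"
    proof (cases "\<exists>\<theta>\<in>set_pmf G. \<forall>\<theta>0\<in>set_pmf G0. \<delta> \<le> param_dist \<theta> \<theta>0")
      case True
      with far G w obtain t where "1 \<le> C2 * norm (mixture_cf G t - mixture_cf G0 t)" by blast
      also have "\<dots> \<le> C2 * M" using M C2 by (intro mult_left_mono) auto
      finally have "L * 1 \<le> L * (C2 * M)" using L(1) by (intro mult_left_mono) auto
      moreover have "0 \<le> N * (D * C1) * M" using N0 D C1 M0 by simp
      ultimately show ?thesis using L(2)[OF G] by (simp add: C_def algebra_simps)
    next
      case False
      have G': "finite (set_pmf G)" "set_pmf G \<subseteq> \<Theta>" "card (set_pmf G) \<le> k" using G by (auto simp: mixing_le_def)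
      have near: "near_mixture \<delta> c0 k G0 G"
        unfolding near_mixture_def using False w G' by (auto simp: not_le)
      have dev: "cell_dev (voronoi_cell G G0 \<theta>0) (mean_dev u \<theta>0) (cov_dev u \<theta>0) \<le> C1 * M"
        and weight: "\<bar>(\<Sum>\<theta>\<in>voronoi_cell G G0 \<theta>0. pmf G \<theta>) - pmf G0 \<theta>0\<bar> \<le> C1 * M"
        if "u \<in> F" "\<theta>0 \<in> set_pmf G0" for u \<theta>0
        using Q[OF that(1)] near M that(2) unfolding Q_def by blast+
      have finc: "finite (voronoi_cell G G0 \<theta>0)" for \<theta>0
        using voronoi_cell_subset G'(1) by (rule finite_subset)
      have B: "0 \<le> C1 * M" "C1 * M \<le> D * (C1 * M)" using C1 M0 D by (auto intro: mult_right_mono[of 1 D, simplified])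
      have dirs: "\<exists>u\<in>F. norm (fst \<theta> - fst \<theta>0) \<le> Cm * \<bar>mean_dev u \<theta>0 \<theta>\<bar>"
        "\<exists>u\<in>F. norm (snd \<theta> - snd \<theta>0) \<le> Cm * \<bar>cov_dev u \<theta>0 \<theta>\<bar>"
        if "\<theta> \<in> voronoi_cell G G0 \<theta>0" "\<theta>0 \<in> set_pmf G0" for \<theta> \<theta>0
      proof -
        obtain u where "u \<in> F" "norm (fst \<theta> - fst \<theta>0) \<le> Cn * \<bar>mean_dev u \<theta>0 \<theta>\<bar>"
          using Fx unfolding mean_dev_def by blast
        moreover have "Cn * \<bar>mean_dev u \<theta>0 \<theta>\<bar> \<le> Cm * \<bar>mean_dev u \<theta>0 \<theta>\<bar>" using Cm by (intro mult_right_mono) auto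
        ultimately show "\<exists>u\<in>F. norm (fst \<theta> - fst \<theta>0) \<le> Cm * \<bar>mean_dev u \<theta>0 \<theta>\<bar>" by (meson order.trans)
        have "snd \<theta> \<in> symmetric_mats" "snd \<theta>0 \<in> symmetric_mats"
          using that sym G' G0' voronoi_cell_subset[of G G0 \<theta>0] by blast+
        then have "snd \<theta> - snd \<theta>0 \<in> symmetric_mats" by (auto simp: symmetric_mats_def transpose_def vec_eq_iff)
        from FM[rule_format, OF this] obtain u where u: "u \<in> F" "norm (snd \<theta> - snd \<theta>0) \<le> 2 * Cn * \<bar>cov_dev u \<theta>0 \<theta>\<bar>"
          unfolding cov_dev_def by auto
        moreover have "2 * Cn * \<bar>cov_dev u \<theta>0 \<theta>\<bar> \<le> Cm * \<bar>cov_dev u \<theta>0 \<theta>\<bar>" using Cm by (intro mult_right_mono) auto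
        ultimately show "\<exists>u\<in>F. norm (snd \<theta> - snd \<theta>0) \<le> Cm * \<bar>cov_dev u \<theta>0 \<theta>\<bar>" by (meson order.trans)
      qed
      have "mixing_loss G G0 \<le> N * (D * (C1 * M))"
        unfolding N_def
      proof (rule mixing_loss_le[OF G'(1,3) G0'(1,3)])
        show "0 \<le> D * (C1 * M)" using B by linarith
        fix \<theta>0 assume \<theta>0: "\<theta>0 \<in> set_pmf G0"
        obtain u where "u \<in> F" using Fx by blast
        from weight[OF this \<theta>0] B(2) show "\<bar>(\<Sum>\<theta>\<in>voronoi_cell G G0 \<theta>0. pmf G \<theta>) - pmf G0 \<theta>0\<bar> \<le> D * (C1 * M)" by linarith
        fix \<theta> assume \<theta>: "\<theta> \<in> voronoi_cell G G0 \<theta>0"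
        from dirs[OF \<theta> \<theta>0] obtain u u' where u: "u \<in> F" "norm (fst \<theta> - fst \<theta>0) \<le> Cm * \<bar>mean_dev u \<theta>0 \<theta>\<bar>"
          and u': "u' \<in> F" "norm (snd \<theta> - snd \<theta>0) \<le> Cm * \<bar>cov_dev u' \<theta>0 \<theta>\<bar>" by blast
        show "param_dist \<theta> \<theta>0 \<le> D * (C1 * M)" if 1: "card (voronoi_cell G G0 \<theta>0) = 1"
        proof -
          have "\<bar>mean_dev u \<theta>0 \<theta>\<bar> \<le> C1 * M" "\<bar>cov_dev u' \<theta>0 \<theta>\<bar> \<le> C1 * M"
            using cell_dev_ge(1)[OF finc \<theta> 1, of "mean_dev u \<theta>0" "cov_dev u \<theta>0"] dev[OF u(1) \<theta>0]
              cell_dev_ge(1)[OF finc \<theta> 1, of "mean_dev u' \<theta>0" "cov_dev u' \<theta>0"] dev[OF u'(1) \<theta>0] by linarith+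
          then have "Cm * \<bar>mean_dev u \<theta>0 \<theta>\<bar> \<le> Cm * (C1 * M)" "Cm * \<bar>cov_dev u' \<theta>0 \<theta>\<bar> \<le> Cm * (C1 * M)"
            using Cm by (auto intro!: mult_left_mono)
          then have "param_dist \<theta> \<theta>0 \<le> 2 * Cm * (C1 * M)" using u u' by (simp add: param_dist_def)
          also have "\<dots> \<le> D * (C1 * M)" using S0 B by (intro mult_right_mono) (simp_all add: D_def)
          finally show ?thesis .
        qed
        show "norm (fst \<theta> - fst \<theta>0) ^ rbar (card (voronoi_cell G G0 \<theta>0)) +
           norm (snd \<theta> - snd \<theta>0) powr (real (rbar (card (voronoi_cell G G0 \<theta>0))) / 2) \<le> D * (C1 * M)"
          if 2: "card (voronoi_cell G G0 \<theta>0) > 1"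
        proof -
          define m where "m = card (voronoi_cell G G0 \<theta>0)"
          have mk: "m \<le> k" unfolding m_def using card_mono[OF G'(1) voronoi_cell_subset, of G0 \<theta>0] G'(3) by simp
          have d: "\<bar>mean_dev u \<theta>0 \<theta>\<bar> ^ rbar m \<le> C1 * M" "\<bar>cov_dev u' \<theta>0 \<theta>\<bar> powr (real (rbar m) / 2) \<le> C1 * M"
            using cell_dev_ge(2)[OF finc \<theta> 2, of "mean_dev u \<theta>0" "cov_dev u \<theta>0"] dev[OF u(1) \<theta>0]
              cell_dev_ge(2)[OF finc \<theta> 2, of "mean_dev u' \<theta>0" "cov_dev u' \<theta>0"] dev[OF u'(1) \<theta>0]
            unfolding m_def by linarith+
          note ps = power_le_sum_powers[OF mk, of Cm Cm rbar]
          have "norm (fst \<theta> - fst \<theta>0) ^ rbar m \<le> (Cm * \<bar>mean_dev u \<theta>0 \<theta>\<bar>) ^ rbar m"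
            using u by (intro power_mono) auto
          also have "\<dots> = Cm ^ rbar m * \<bar>mean_dev u \<theta>0 \<theta>\<bar> ^ rbar m" by (rule power_mult_distrib)
          also have "\<dots> \<le> (\<Sum>m\<le>k. Cm ^ rbar m) * (C1 * M)"
            using ps(1) d(1) Cm S0 by (intro mult_mono) auto
          finally have 1: "norm (fst \<theta> - fst \<theta>0) ^ rbar m \<le> (\<Sum>m\<le>k. Cm ^ rbar m) * (C1 * M)" .
          have "norm (snd \<theta> - snd \<theta>0) powr (real (rbar m) / 2) \<le> (Cm * \<bar>cov_dev u' \<theta>0 \<theta>\<bar>) powr (real (rbar m) / 2)"
            using u' by (intro powr_mono2) auto
          also have "\<dots> = Cm powr (real (rbar m) / 2) * \<bar>cov_dev u' \<theta>0 \<theta>\<bar> powr (real (rbar m) / 2)"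
            by (rule powr_mult)
          also have "\<dots> \<le> (\<Sum>m\<le>k. Cm ^ rbar m) * (C1 * M)"
            using ps(2) d(2) Cm S0 by (intro mult_mono) auto
          finally have 2: "norm (snd \<theta> - snd \<theta>0) powr (real (rbar m) / 2) \<le> (\<Sum>m\<le>k. Cm ^ rbar m) * (C1 * M)" .
          have "2 * (\<Sum>m\<le>k. Cm ^ rbar m) * (C1 * M) \<le> D * (C1 * M)"
            using Cm B by (intro mult_right_mono) (simp_all add: D_def)
          then show ?thesis using 1 2 unfolding m_def[symmetric] by linarith
        qed
      qed
      also have "\<dots> \<le> C * M" using L C2 M0 by (simp add: C_def algebra_simps)
      finally show ?thesis .
    qed
  qed
qed

section \<open>Diagonalisation and Gaussian integrals\<close>

lemma Basis_vec_real: "(Basis :: (real^'d::finite) set) = range (\<lambda>i. axis i 1)"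
  by (auto simp: Basis_vec_def)

lemma prod_Basis_vec: "(\<Prod>b\<in>(Basis :: (real^'d::finite) set). f b) = (\<Prod>i\<in>UNIV. f (axis i 1))"
  unfolding Basis_vec_real by (rule prod.reindex_cong[of "\<lambda>i. axis i 1"]) (auto simp: inj_on_def axis_eq_axis)

lemma inner_axis_1 [simp]: "x \<bullet> axis i (1::real) = x $ i"
  by (simp add: inner_axis)

lemma borel_measurable_vec_lambda [measurable (raw)]:
  fixes f :: "'i::finite \<Rightarrow> 'a \<Rightarrow> real"
  assumes "\<And>i. f i \<in> borel_measurable M"
  shows "(\<lambda>x. \<chi> i. f i x) \<in> borel_measurable M"
  by (subst borel_measurable_euclidean_space) (auto simp: Basis_vec_real assms)

text \<open>Checked on boxes; it gives access to Fubini and to products over coordinates on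
  \<open>real^'d\<close>.\<close>

lemma lborel_vec_eq: "(lborel :: (real^'d::finite) measure) = distr (\<Pi>\<^sub>M i\<in>UNIV. lborel) borel (\<lambda>f. \<chi> i. f i)"
proof (rule lborel_eqI)
  interpret product_sigma_finite "\<lambda>_::'d. lborel :: real measure" by standard
  fix l u :: "real^'d"
  assume lu: "\<And>b. b \<in> Basis \<Longrightarrow> l \<bullet> b \<le> u \<bullet> b"
  have le: "l $ i \<le> u $ i" for i using lu[of "axis i 1"] by (simp add: Basis_vec_real)
  have meas: "(\<lambda>f. \<chi> i. f i) \<in> borel_measurable (\<Pi>\<^sub>M i\<in>(UNIV::'d set). (lborel :: real measure))"
    by measurable
  have eq: "(\<lambda>f. \<chi> i. f i) -` box l u \<inter> space (\<Pi>\<^sub>M i\<in>(UNIV::'d set). (lborel :: real measure)) = (\<Pi>\<^sub>E i\<in>UNIV. {l $ i<..<u $ i})"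
    by (auto simp: mem_box Basis_vec_real space_PiM PiE_iff)
  have "emeasure (distr (\<Pi>\<^sub>M i\<in>UNIV. lborel) borel (\<lambda>f. \<chi> i. f i)) (box l u)
      = emeasure (\<Pi>\<^sub>M i\<in>(UNIV::'d set). (lborel :: real measure)) (\<Pi>\<^sub>E i\<in>UNIV. {l $ i<..<u $ i})"
    using meas by (subst emeasure_distr) (simp_all only: eq, simp_all)
  also have "\<dots> = (\<Prod>i\<in>UNIV. ennreal (u $ i - l $ i))"
    using le by (subst emeasure_PiM) auto
  also have "\<dots> = ennreal (\<Prod>i\<in>UNIV. u $ i - l $ i)"
    using le by (intro prod_ennreal) auto
  finally show "emeasure (distr (\<Pi>\<^sub>M i\<in>UNIV. lborel) borel (\<lambda>f. \<chi> i. f i)) (box l u) = ennreal (\<Prod>b\<in>Basis. (u - l) \<bullet> b)"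
    by (simp add: prod_Basis_vec)
qed simp

lemma borel_measurable_matrix_vector_mult [measurable]:
  "(\<lambda>x. (A :: real^'d::finite^'d) *v x) \<in> borel_measurable borel"
  by (intro borel_measurable_continuous_onI linear_continuous_on) simp

lemma lborel_coordinate_permutation:
  fixes \<sigma> :: "'d::finite \<Rightarrow> 'd"
  assumes \<sigma>: "bij \<sigma>"
  shows "distr lborel borel (\<lambda>x :: real^'d. \<chi> i. x $ \<sigma> i) = lborel"
proof (rule lborel_eqI[symmetric])
  fix l u :: "real^'d"
  assume lu: "\<And>b. b \<in> Basis \<Longrightarrow> l \<bullet> b \<le> u \<bullet> b"
  have le: "l $ i \<le> u $ i" for i using lu[of "axis i 1"] by (simp add: Basis_vec_real)
  define \<tau> where "\<tau> = inv \<sigma>"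
  have \<tau>: "\<sigma> (\<tau> i) = i" "\<tau> (\<sigma> i) = i" for i using \<sigma> by (auto simp: \<tau>_def bij_is_surj surj_f_inv_f bij_is_inj)
  have eq: "(\<lambda>x :: real^'d. \<chi> i. x $ \<sigma> i) -` box l u = box (\<chi> i. l $ \<tau> i) (\<chi> i. u $ \<tau> i)"
    by (auto simp: mem_box Basis_vec_real) (metis \<tau>)+
  have "emeasure (distr lborel borel (\<lambda>x :: real^'d. \<chi> i. x $ \<sigma> i)) (box l u) = emeasure lborel (box (\<chi> i. l $ \<tau> i) (\<chi> i. u $ \<tau> i))"
    by (subst emeasure_distr) (simp_all add: eq)
  also have "\<dots> = ennreal (\<Prod>i\<in>UNIV. u $ \<tau> i - l $ \<tau> i)"
  proof -
    have "\<forall>b\<in>Basis. (\<chi> i. l $ \<tau> i) \<bullet> b \<le> (\<chi> i. u $ \<tau> i) \<bullet> b"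
      using le by (auto simp: Basis_vec_real)
    then show ?thesis by (simp add: emeasure_lborel_box_eq prod_Basis_vec)
  qed
  also have "(\<Prod>i\<in>UNIV. u $ \<tau> i - l $ \<tau> i) = (\<Prod>i\<in>UNIV. u $ i - l $ i)"
    using \<sigma> by (intro prod.reindex_bij_betw) (simp add: \<tau>_def bij_imp_bij_inv)
  finally show "emeasure (distr lborel borel (\<lambda>x :: real^'d. \<chi> i. x $ \<sigma> i)) (box l u) = ennreal (\<Prod>b\<in>Basis. (u - l) \<bullet> b)"
    by (simp add: prod_Basis_vec)
qed simp

text \<open>Integrate over coordinate \<open>m\<close> first: with the other coordinates fixed, the
  shear is a translation of that coordinate.\<close>

lemma nn_integral_shear:
  fixes f :: "real^'d::finite \<Rightarrow> ennreal"
  assumes mn: "m \<noteq> n" and f [measurable]: "f \<in> borel_measurable borel"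
  shows "(\<integral>\<^sup>+x. f (x + (c * x $ n) *\<^sub>R axis m 1) \<partial>lborel) = (\<integral>\<^sup>+x. f x \<partial>lborel)"
proof -
  interpret product_sigma_finite "\<lambda>_::'d. lborel :: real measure" by standard
  define I where "I = UNIV - {m}"
  have U: "UNIV = insert m I" "finite I" "m \<notin> I" by (auto simp: I_def)
  have split: "(\<integral>\<^sup>+x. g x \<partial>lborel) = (\<integral>\<^sup>+x. (\<integral>\<^sup>+y. g (\<chi> i. (x(m := y)) i) \<partial>lborel) \<partial>(\<Pi>\<^sub>M i\<in>I. lborel))"
    if g [measurable]: "g \<in> borel_measurable borel" for g :: "real^'d \<Rightarrow> ennreal"
  proof -
    have [measurable]: "(\<lambda>f. \<chi> i. f i) \<in> borel_measurable (\<Pi>\<^sub>M i\<in>(UNIV::'d set). (lborel :: real measure))"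
      by measurable
    have "(\<integral>\<^sup>+x. g x \<partial>lborel) = (\<integral>\<^sup>+x. g (\<chi> i. x i) \<partial>(\<Pi>\<^sub>M i\<in>UNIV. lborel))"
      by (subst lborel_vec_eq, subst nn_integral_distr) simp_all
    also have "\<dots> = (\<integral>\<^sup>+x. (\<integral>\<^sup>+y. g (\<chi> i. (x(m := y)) i) \<partial>lborel) \<partial>(\<Pi>\<^sub>M i\<in>I. lborel))"
    proof -
      have "(\<lambda>x. g (\<chi> i. x i)) \<in> borel_measurable (\<Pi>\<^sub>M i\<in>insert m I. lborel)"
        unfolding U(1)[symmetric] by measurable
      from product_nn_integral_insert[OF U(2,3) this] show ?thesis unfolding U(1)[symmetric] .
    qed
    finally show ?thesis .
  qed
  have "(\<integral>\<^sup>+x. f (x + (c * x $ n) *\<^sub>R axis m 1) \<partial>lborel)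
      = (\<integral>\<^sup>+x. (\<integral>\<^sup>+y. f ((\<chi> i. (x(m := y)) i) + (c * (\<chi> i. (x(m := y)) i) $ n) *\<^sub>R axis m 1) \<partial>lborel) \<partial>(\<Pi>\<^sub>M i\<in>I. lborel))"
    by (rule split) measurable
  also have "\<dots> = (\<integral>\<^sup>+x. (\<integral>\<^sup>+y. f (\<chi> i. (x(m := y)) i) \<partial>lborel) \<partial>(\<Pi>\<^sub>M i\<in>I. lborel))"
  proof (rule nn_integral_cong)
    fix x :: "'d \<Rightarrow> real"
    have "(\<chi> i. (x(m := y)) i) + (c * (\<chi> i. (x(m := y)) i) $ n) *\<^sub>R axis m 1 = (\<chi> i. (x(m := c * x n + 1 * y)) i)" for y
      using mn by (auto simp: vec_eq_iff axis_def)
    moreover have "(\<lambda>y. f (\<chi> i. (x(m := y)) i)) \<in> borel_measurable borel"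
    proof -
      have "(\<lambda>y. (x(m := y)) i) \<in> borel_measurable borel" for i by (cases "i = m") auto
      then show ?thesis by measurable
    qed
    then have "(\<integral>\<^sup>+y. f (\<chi> i. (x(m := y)) i) \<partial>lborel) = ennreal \<bar>1\<bar> * (\<integral>\<^sup>+y. f (\<chi> i. (x(m := c * x n + 1 * y)) i) \<partial>lborel)"
      by (intro nn_integral_real_affine) auto
    ultimately show "(\<integral>\<^sup>+y. f ((\<chi> i. (x(m := y)) i) + (c * (\<chi> i. (x(m := y)) i) $ n) *\<^sub>R axis m 1) \<partial>lborel)
        = (\<integral>\<^sup>+y. f (\<chi> i. (x(m := y)) i) \<partial>lborel)" by simp
  qed
  also have "\<dots> = (\<integral>\<^sup>+x. f x \<partial>lborel)" by (rule split[symmetric]) measurable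
  finally show ?thesis .
qed

text \<open>Change of variables by induction over elementary matrices. The condition on the
  determinant stands inside the claim because it must be inherited by the factors of a product; it
  makes the zero-row case vacuous.\<close>

lemma nn_integral_matrix_vector_mult:
  fixes A :: "real^'d::finite^'d"
  shows "det A \<noteq> 0 \<longrightarrow> (\<forall>f\<in>borel_measurable borel. ennreal \<bar>det A\<bar> * (\<integral>\<^sup>+x. f (A *v x) \<partial>lborel) = (\<integral>\<^sup>+x. f x \<partial>lborel))"
proof (induction A rule: induct_matrix_elementary)
  case (1 A B)
  show ?case
  proof (intro impI ballI)
    fix f :: "real^'d \<Rightarrow> ennreal" assume d: "det (A ** B) \<noteq> 0" and f [measurable]: "f \<in> borel_measurable borel"
    have dA: "det A \<noteq> 0" and dB: "det B \<noteq> 0" using d by (auto simp: det_mul)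
    have fA: "(\<lambda>x. f (A *v x)) \<in> borel_measurable borel" by measurable
    have A: "ennreal \<bar>det A\<bar> * (\<integral>\<^sup>+x. f (A *v x) \<partial>lborel) = (\<integral>\<^sup>+x. f x \<partial>lborel)"
      and B: "ennreal \<bar>det B\<bar> * (\<integral>\<^sup>+x. f (A *v (B *v x)) \<partial>lborel) = (\<integral>\<^sup>+x. f (A *v x) \<partial>lborel)"
      by (rule 1(1)[rule_format, OF dA f], rule 1(2)[rule_format, OF dB fA])
    show "ennreal \<bar>det (A ** B)\<bar> * (\<integral>\<^sup>+x. f ((A ** B) *v x) \<partial>lborel) = (\<integral>\<^sup>+x. f x \<partial>lborel)"
      unfolding A[symmetric] B[symmetric] by (simp add: det_mul abs_mult ennreal_mult mult.assoc matrix_vector_mul_assoc)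
  qed
next
  case (2 A i)
  then show ?case by (simp add: det_zero_row)
next
  case (3 A)
  show ?case
  proof (intro impI ballI)
    fix f :: "real^'d \<Rightarrow> ennreal" assume d: "det A \<noteq> 0" and f [measurable]: "f \<in> borel_measurable borel"
    have det: "det A = (\<Prod>i\<in>UNIV. A $ i $ i)" using 3 by (rule det_diagonal)
    \<comment> \<open>\<open>lborel_affine_euclidean\<close> indexes its scaling factors by basis
      vectors, so the diagonal is transferred to the vectors \<open>axis i 1\<close>.\<close>
    define c where "c b = (\<Sum>i\<in>UNIV. if b = axis i 1 then A $ i $ i else 0)" for b :: "real^'d"
    have c: "c (axis i 1) = A $ i $ i" for i
      by (simp add: c_def axis_eq_axis if_distrib cong: if_cong)
    have c0: "c b \<noteq> 0" if "b \<in> Basis" for b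
      using that d unfolding det by (auto simp: Basis_vec_real c)
    have Ax: "A *v x = (0::real^'d) + (\<Sum>j\<in>Basis. (c j * (x \<bullet> j)) *\<^sub>R j)" for x
    proof -
      have "(\<Sum>j\<in>Basis. (c j * (x \<bullet> j)) *\<^sub>R j) = (\<Sum>i\<in>UNIV. (A $ i $ i * x $ i) *\<^sub>R axis i 1)"
        unfolding Basis_vec_real by (subst sum.reindex) (auto simp: inj_on_def axis_eq_axis c)
      also have "\<dots> $ k = A $ k $ k * x $ k" for k
        by (simp add: axis_def if_distrib cong: if_cong)
      moreover have "(A *v x) $ k = A $ k $ k * x $ k" for k
      proof -
        have "(A *v x) $ k = (\<Sum>j\<in>UNIV. A $ k $ j * x $ j)" by (simp add: matrix_vector_mult_def)
        also have "\<dots> = (\<Sum>j\<in>UNIV. if j = k then A $ k $ k * x $ k else 0)"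
          by (intro sum.cong) (auto simp: 3)
        finally have "(A *v x) $ k = (\<Sum>j\<in>UNIV. if j = k then A $ k $ k * x $ k else 0)" .
        then show ?thesis by simp
      qed
      ultimately show ?thesis by (simp add: vec_eq_iff)
    qed
    have "(\<integral>\<^sup>+x. f x \<partial>lborel) = (\<integral>\<^sup>+x. f x \<partial>(density (distr lborel borel (\<lambda>x. 0 + (\<Sum>j\<in>Basis. (c j * (x \<bullet> j)) *\<^sub>R j))) (\<lambda>_. (\<Prod>j\<in>Basis. \<bar>c j\<bar>))))"
      using lborel_affine_euclidean[of c "0::real^'d", OF c0] by simp
    also have "\<dots> = (\<integral>\<^sup>+x. ennreal (\<Prod>j\<in>(Basis :: (real^'d) set). \<bar>c j\<bar>) * f (A *v x) \<partial>lborel)"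
      unfolding Ax by (subst nn_integral_density, simp, simp, subst nn_integral_distr) simp_all
    also have "\<dots> = ennreal \<bar>det A\<bar> * (\<integral>\<^sup>+x. f (A *v x) \<partial>lborel)"
      by (subst nn_integral_cmult) (simp_all add: prod_Basis_vec c det abs_prod)
    finally show "ennreal \<bar>det A\<bar> * (\<integral>\<^sup>+x. f (A *v x) \<partial>lborel) = (\<integral>\<^sup>+x. f x \<partial>lborel)" by simp
  qed
next
  case (4 m n)
  let ?A = "(\<chi> i j. mat 1 $ i $ Transposition.transpose m n j) :: real^'d^'d"
  show ?case
  proof (intro impI ballI)
    fix f :: "real^'d \<Rightarrow> ennreal" assume f [measurable]: "f \<in> borel_measurable borel"
    have perm: "Transposition.transpose m n permutes (UNIV :: 'd set)" by (simp add: permutes_swap_id)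
    have "\<bar>det ?A\<bar> = 1"
      using det_permute_columns[OF perm, of "mat 1 :: real^'d^'d"] by (simp add: sign_swap_id)
    moreover have "?A *v x = (\<chi> i. x $ Transposition.transpose m n i)" for x
      unfolding matrix_vector_mult_def mat_def vec_eq_iff
    proof
      fix i
      have "(\<Sum>j\<in>UNIV. (if i = Transposition.transpose m n j then 1 else 0) * x $ j)
          = (\<Sum>j\<in>UNIV. if j = Transposition.transpose m n i then x $ j else 0)"
        by (intro sum.cong) (auto simp: transpose_eq_iff)
      then show "(\<chi> i. \<Sum>j\<in>UNIV. (\<chi> i j. (\<chi> i j. if i = j then 1 else 0) $ i $ Transposition.transpose m n j) $ i $ j * x $ j) $ i
          = (\<chi> i. x $ Transposition.transpose m n i) $ i" by simp
    qed
    moreover have "(\<integral>\<^sup>+x. f (\<chi> i. x $ Transposition.transpose m n i) \<partial>lborel) = (\<integral>\<^sup>+x. f x \<partial>lborel)"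
      using lborel_coordinate_permutation[of "Transposition.transpose m n"] nn_integral_distr[of "\<lambda>x. \<chi> i. x $ Transposition.transpose m n i" lborel borel f]
      by simp
    ultimately show "ennreal \<bar>det ?A\<bar> * (\<integral>\<^sup>+x. f (?A *v x) \<partial>lborel) = (\<integral>\<^sup>+x. f x \<partial>lborel)" by simp
  qed
next
  case (5 m n c)
  let ?A = "(\<chi> i j. if i = m \<and> j = n then c else of_bool (i = j)) :: real^'d^'d"
  show ?case
  proof (intro impI ballI)
    fix f :: "real^'d \<Rightarrow> ennreal" assume f [measurable]: "f \<in> borel_measurable borel"
    have "?A = (\<chi> k. if k = m then row m (mat 1) + c *s row n (mat 1) else row k (mat 1))"
      using 5 by (auto simp: vec_eq_iff row_def mat_def)
    then have "det ?A = 1"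
      using det_row_operation[OF 5, of "mat 1 :: real^'d^'d" c] by simp
    moreover have "?A *v x = x + (c * x $ n) *\<^sub>R axis m 1" for x
      unfolding vec_eq_iff
    proof
      fix i
      have "(?A *v x) $ i = (\<Sum>j\<in>UNIV. (if j = i then x $ j else 0) + (if i = m \<and> j = n then c * x $ j else 0))"
        unfolding matrix_vector_mult_def using 5 by (auto intro!: sum.cong)
      then show "(?A *v x) $ i = (x + (c * x $ n) *\<^sub>R axis m 1) $ i"
        by (cases "i = m") (simp_all add: sum.distrib axis_def)
    qed
    ultimately show "ennreal \<bar>det ?A\<bar> * (\<integral>\<^sup>+x. f (?A *v x) \<partial>lborel) = (\<integral>\<^sup>+x. f x \<partial>lborel)"
      using nn_integral_shear[OF 5 f, of c] by simp
  qed
qed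

lemma lborel_affine_matrix:
  fixes A :: "real^'d::finite^'d"
  assumes A: "det A \<noteq> 0"
  shows "lborel = density (distr lborel borel (\<lambda>x. t + A *v x)) (\<lambda>_. ennreal \<bar>det A\<bar>)"
proof (rule measure_eqI)
  fix S :: "(real^'d) set" assume "S \<in> sets lborel"
  then have S [measurable]: "S \<in> sets borel" by simp
  have "emeasure lborel S = (\<integral>\<^sup>+x. indicator S x \<partial>lborel)" by simp
  also have "\<dots> = (\<integral>\<^sup>+x. indicator S (t + x) \<partial>lborel)"
    by (subst lborel_distr_plus[symmetric, of t], subst nn_integral_distr) simp_all
  also have "\<dots> = ennreal \<bar>det A\<bar> * (\<integral>\<^sup>+x. indicator S (t + A *v x) \<partial>lborel)"
    using A by (subst nn_integral_matrix_vector_mult[rule_format, of A, symmetric]) simp_all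
  also have "\<dots> = emeasure (density (distr lborel borel (\<lambda>x. t + A *v x)) (\<lambda>_. ennreal \<bar>det A\<bar>)) S"
    by (subst emeasure_density, simp, simp, subst nn_integral_distr, simp, simp, subst nn_integral_cmult) simp_all
  finally show "emeasure lborel S = emeasure (density (distr lborel borel (\<lambda>x. t + A *v x)) (\<lambda>_. ennreal \<bar>det A\<bar>)) S" .
qed simp

text \<open>Gram-Schmidt for the form x . A y. Fewer than d vectors \<open>A *v f i\<close> do not
  span the space, and a nonzero vector orthogonal to them in the Euclidean sense is orthogonal to
  the \<open>f i\<close> for the form.\<close>

lemma exists_form_orthonormal:
  fixes A :: "real^'d::finite^'d"
  assumes A: "A \<in> pos_def_mats" and n: "n \<le> CARD('d)"
  shows "\<exists>f. \<forall>i<n. \<forall>j<n. f i \<bullet> (A *v f j) = (if i = j then 1 else 0)"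
  using n
proof (induction n)
  case (Suc n)
  then obtain f where f: "\<And>i j. i < n \<Longrightarrow> j < n \<Longrightarrow> f i \<bullet> (A *v f j) = (if i = j then 1 else 0)" by auto
  have sym: "A \<in> symmetric_mats" using A by (simp add: pos_def_mats_def)
  define S where "S = (\<lambda>i. A *v f i) ` {..<n}"
  have "dim S \<le> card S" by (rule dim_le_card') (simp add: S_def)
  also have "card S \<le> n" unfolding S_def using card_image_le[of "{..<n}"] by simp
  also have "n < DIM(real^'d)" using Suc.prems by simp
  finally obtain v where v: "v \<noteq> 0" "\<And>y. y \<in> span S \<Longrightarrow> orthogonal v y"
    using orthogonal_to_subspace_exists by blast
  define q where "q = v \<bullet> (A *v v)"
  have q: "q > 0" using A v(1) by (simp add: q_def pos_def_mats_def)
  have vf: "v \<bullet> (A *v f i) = 0" if "i < n" for i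
    using v(2)[of "A *v f i"] that by (auto simp: orthogonal_def S_def intro: span_base)
  have fv: "f i \<bullet> (A *v v) = 0" if "i < n" for i
    using vf[OF that] symmetric_inner[OF sym] by metis
  define g where "g = f(n := v /\<^sub>R sqrt q)"
  have "g i \<bullet> (A *v g j) = (if i = j then 1 else 0)" if "i < Suc n" "j < Suc n" for i j
  proof -
    have "(v /\<^sub>R sqrt q) \<bullet> (A *v (v /\<^sub>R sqrt q)) = 1"
      using q by (simp add: matrix_vector_mult_scaleR q_def[symmetric] field_simps)
    then show ?thesis
      using that f fv vf by (auto simp: g_def less_Suc_eq matrix_vector_mult_scaleR)
  qed
  then show ?case by blast
qed simp

lemma exists_form_basis:
  fixes A :: "real^'d::finite^'d"
  assumes A: "A \<in> pos_def_mats"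
  shows "\<exists>W :: real^'d^'d. transpose W ** A ** W = mat 1"
proof -
  obtain f where f: "\<forall>i<CARD('d). \<forall>j<CARD('d). f i \<bullet> (A *v f j) = (if i = j then 1 else 0)"
    using exists_form_orthonormal[OF A order.refl] by blast
  obtain h where h: "bij_betw h (UNIV :: 'd set) {0..<CARD('d)}"
    using ex_bij_betw_finite_nat[of "UNIV :: 'd set"] by auto
  have hl: "h i < CARD('d)" for i using bij_betwE[OF h] by auto
  have hinj: "h i = h j \<longleftrightarrow> i = j" for i j using h by (auto simp: bij_betw_def inj_on_def)
  define W :: "real^'d^'d" where "W = (\<chi> r c. f (h c) $ r)"
  have "(transpose W ** A ** W) $ i $ j = f (h i) \<bullet> (A *v f (h j))" for i j
  proof -
    have "(transpose W ** A ** W) $ i $ j = (\<Sum>k\<in>UNIV. \<Sum>l\<in>UNIV. f (h i) $ l * A $ l $ k * f (h j) $ k)"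
      by (simp add: matrix_matrix_mult_def transpose_def W_def sum_distrib_right)
    also have "\<dots> = (\<Sum>l\<in>UNIV. \<Sum>k\<in>UNIV. f (h i) $ l * A $ l $ k * f (h j) $ k)" by (rule sum.swap)
    also have "\<dots> = f (h i) \<bullet> (A *v f (h j))"
      by (simp add: inner_vec_def matrix_vector_mult_def sum_distrib_left mult.assoc)
    finally show ?thesis .
  qed
  then have "transpose W ** A ** W = mat 1"
    using f hl hinj by (simp add: vec_eq_iff mat_def)
  then show ?thesis by blast
qed

section \<open>Positive definite covariances and the standardization of a Gaussian\<close>

lemma pos_def_invertible:
  assumes "S \<in> pos_def_mats"
  shows "invertible S"
proof -
  have "v = 0" if "S *v v = 0" for v
    using assms that by (cases "v = 0") (auto simp: pos_def_mats_def)
  then show ?thesis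
    unfolding invertible_left_inverse matrix_left_invertible_ker by blast
qed

lemma matrix_inv_mult:
  fixes S :: "real^'d::finite^'d"
  assumes "invertible S"
  shows "S ** matrix_inv S = mat 1" "matrix_inv S ** S = mat 1"
  using someI_ex[OF assms[unfolded invertible_def]] unfolding matrix_inv_def by auto

lemma pos_def_matrix_inv:
  fixes S :: "real^'d::finite^'d"
  assumes S: "S \<in> pos_def_mats"
  shows "matrix_inv S \<in> pos_def_mats"
proof -
  note inv = matrix_inv_mult[OF pos_def_invertible[OF S]]
  have sym: "transpose S = S" using S by (simp add: pos_def_mats_def symmetric_mats_def)
  have "transpose (matrix_inv S) ** S = mat 1"
    using arg_cong[OF inv(1), of transpose] by (simp add: matrix_transpose_mul sym transpose_mat)
  then have "transpose (matrix_inv S) = matrix_inv S"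
    by (metis inv(1) matrix_mul_assoc matrix_mul_lid matrix_mul_rid)
  moreover have "v \<bullet> (matrix_inv S *v v) > 0" if "v \<noteq> 0" for v
  proof -
    define y where "y = matrix_inv S *v v"
    have v: "v = S *v y" by (simp add: y_def matrix_vector_mul_assoc inv)
    then have "y \<noteq> 0" using that by auto
    then have "y \<bullet> (S *v y) > 0" using S by (simp add: pos_def_mats_def)
    also have "y \<bullet> (S *v y) = v \<bullet> (matrix_inv S *v v)"
      unfolding v[symmetric] by (simp add: y_def inner_commute)
    finally show ?thesis .
  qed
  ultimately show ?thesis by (simp add: pos_def_mats_def symmetric_mats_def)
qed

lemma pos_def_det_pos:
  fixes S :: "real^'d::finite^'d"
  assumes S: "S \<in> pos_def_mats"
  shows "det S > 0"
proof -
  obtain W :: "real^'d^'d" where W: "transpose W ** S ** W = mat 1" using exists_form_basis[OF S] by blast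
  then have "det W * det S * det W = 1"
    by (metis det_I det_mul det_transpose)
  then have "(det W)\<^sup>2 * det S = 1" by (simp add: power2_eq_square mult_ac)
  then show ?thesis by (metis zero_less_mult_iff zero_less_one zero_le_power2 not_less)
qed

text \<open>The columns of \<open>W\<close> are orthonormal for the form of the inverse covariance,
  hence W W^T is the covariance. In the coordinates x = mean + W y the density is a product of
  standard normal densities.\<close>

lemma gaussian_standardization:
  fixes \<theta> :: "'d::finite param"
  assumes S: "snd \<theta> \<in> pos_def_mats"
  obtains W :: "real^'d^'d" where "det W \<noteq> 0"
    "\<And>y. \<bar>det W\<bar> * gaussian_density \<theta> (fst \<theta> + W *v y) = (\<Prod>i\<in>UNIV. std_normal_density (y $ i))"
    "\<And>t. (transpose W *v t) \<bullet> (transpose W *v t) = t \<bullet> (snd \<theta> *v t)"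
proof -
  define S where "S = snd \<theta>"
  have S: "S \<in> pos_def_mats" using assms by (simp add: S_def)
  note inv = matrix_inv_mult[OF pos_def_invertible[OF S]]
  obtain W :: "real^'d^'d" where W: "transpose W ** matrix_inv S ** W = mat 1"
    using exists_form_basis[OF pos_def_matrix_inv[OF S]] by blast
  have dW: "(det W)\<^sup>2 * det (matrix_inv S) = 1"
    using arg_cong[OF W, of det] by (simp add: det_mul power2_eq_square mult_ac)
  have "det S * det (matrix_inv S) = 1" using arg_cong[OF inv(1), of det] by (simp add: det_mul)
  then have dS: "det S = (det W)\<^sup>2" using dW by (metis mult_cancel_right mult_eq_0_iff zero_neq_one)
  have W0: "det W \<noteq> 0" using dW by auto
  have quad: "(W *v y) \<bullet> (matrix_inv S *v (W *v y)) = y \<bullet> y" for y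
  proof -
    have "(W *v y) \<bullet> (matrix_inv S *v (W *v y)) = y \<bullet> (transpose W *v (matrix_inv S *v (W *v y)))"
      by (metis dot_lmul_matrix inner_commute transpose_matrix_vector)
    also have "\<dots> = y \<bullet> ((transpose W ** matrix_inv S ** W) *v y)" by (simp add: matrix_vector_mul_assoc matrix_mul_assoc)
    finally show ?thesis by (simp add: W)
  qed
  have "W ** transpose W = S"
  proof -
    have "(transpose W ** matrix_inv S) ** W = mat 1" using W by simp
    then have "W ** (transpose W ** matrix_inv S) = mat 1" by (simp add: matrix_left_right_inverse)
    then have "W ** transpose W ** matrix_inv S ** S = mat 1 ** S" by (simp add: matrix_mul_assoc)
    then show ?thesis by (simp add: matrix_mul_assoc[symmetric] inv(2))
  qed
  then have 3: "(transpose W *v t) \<bullet> (transpose W *v t) = t \<bullet> (snd \<theta> *v t)" for t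
    by (metis S_def dot_lmul_matrix matrix_vector_mul_assoc transpose_matrix_vector)
  have 2: "\<bar>det W\<bar> * gaussian_density \<theta> (fst \<theta> + W *v y) = (\<Prod>i\<in>UNIV. std_normal_density (y $ i))" for y
  proof -
    have "gaussian_density \<theta> (fst \<theta> + W *v y) = exp (- (y \<bullet> y) / 2) / sqrt ((2 * pi) ^ CARD('d) * det S)"
      unfolding gaussian_density_def case_prod_unfold S_def[symmetric] by (simp add: quad)
    also have "sqrt ((2 * pi) ^ CARD('d) * det S) = sqrt (2 * pi) ^ CARD('d) * \<bar>det W\<bar>"
      unfolding dS real_sqrt_mult[of "(2 * pi) ^ CARD('d)"] real_sqrt_power[of "2 * pi"] real_sqrt_abs ..
    finally have "\<bar>det W\<bar> * gaussian_density \<theta> (fst \<theta> + W *v y) = exp (- (y \<bullet> y) / 2) / sqrt (2 * pi) ^ CARD('d)"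
      using W0 by simp
    also have "exp (- (y \<bullet> y) / 2) = (\<Prod>i\<in>UNIV. exp (- (y $ i)\<^sup>2 / 2))"
      by (simp add: exp_sum[symmetric] inner_vec_def power2_eq_square sum_divide_distrib sum_negf)
    also have "\<dots> / sqrt (2 * pi) ^ CARD('d) = (\<Prod>i\<in>UNIV. exp (- (y $ i)\<^sup>2 / 2) / sqrt (2 * pi))"
      by (simp add: prod_dividef)
    finally show ?thesis by (simp add: std_normal_density_def)
  qed
  show ?thesis using W0 2 3 by (rule that)
qed

lemma gaussian_density_pos:
  assumes "snd \<theta> \<in> pos_def_mats"
  shows "0 < gaussian_density \<theta> x"
  using pos_def_det_pos[OF assms] by (simp add: gaussian_density_def case_prod_unfold)

lemma borel_measurable_gaussian_density [measurable]: "gaussian_density \<theta> \<in> borel_measurable borel"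
proof -
  have "continuous_on UNIV (\<lambda>x. (x - fst \<theta>) \<bullet> (matrix_inv (snd \<theta>) *v (x - fst \<theta>)))"
    by (intro continuous_intros)
  then have "continuous_on UNIV (\<lambda>x. exp (- ((x - fst \<theta>) \<bullet> (matrix_inv (snd \<theta>) *v (x - fst \<theta>))) / 2))"
    by (intro continuous_intros) auto
  then have [measurable]: "(\<lambda>x. exp (- ((x - fst \<theta>) \<bullet> (matrix_inv (snd \<theta>) *v (x - fst \<theta>))) / 2)) \<in> borel_measurable borel"
    by (rule borel_measurable_continuous_onI)
  show ?thesis unfolding gaussian_density_def case_prod_unfold by measurable
qed

lemma std_normal_density_cf:
  "integrable lborel (\<lambda>x. complex_of_real (std_normal_density x) * exp (\<i> * of_real (t * x)))"
  "(\<integral>x. complex_of_real (std_normal_density x) * exp (\<i> * of_real (t * x)) \<partial>lborel) = of_real (exp (- t\<^sup>2 / 2))"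
proof -
  have m: "integrable lborel std_normal_density" by simp
  show "integrable lborel (\<lambda>x. complex_of_real (std_normal_density x) * exp (\<i> * of_real (t * x)))"
    by (rule Bochner_Integration.integrable_bound[OF m]) (simp_all add: norm_mult)
  have "char std_normal_distribution t = (\<integral>x. std_normal_density x *\<^sub>R exp (\<i> * of_real (t * x)) \<partial>lborel)"
    unfolding char_def by (subst integral_density) (simp_all add: normal_density_nonneg)
  then show "(\<integral>x. complex_of_real (std_normal_density x) * exp (\<i> * of_real (t * x)) \<partial>lborel) = of_real (exp (- t\<^sup>2 / 2))"
    by (simp add: char_std_normal_distribution scaleR_conv_of_real)
qed

text \<open>After standardization the integrand factorizes over the coordinates with frequency s =
  W^T t, and s . s is the quadratic form of the covariance at t.\<close>

lemma gaussian_cf_integral: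
  fixes \<theta> :: "'d::finite param"
  assumes S: "snd \<theta> \<in> pos_def_mats"
  shows "has_bochner_integral lborel (\<lambda>x. complex_of_real (gaussian_density \<theta> x) * exp (\<i> * of_real (t \<bullet> x))) (gauss_cf \<theta> t)"
proof -
  interpret product_sigma_finite "\<lambda>_::'d. lborel :: real measure" by standard
  obtain W where W0: "det W \<noteq> 0"
    and dens: "\<And>y. \<bar>det W\<bar> * gaussian_density \<theta> (fst \<theta> + W *v y) = (\<Prod>i\<in>UNIV. std_normal_density (y $ i))"
    and quad: "\<And>t. (transpose W *v t) \<bullet> (transpose W *v t) = t \<bullet> (snd \<theta> *v t)"
    using gaussian_standardization[OF S] by blast
  define s where "s = transpose W *v t"
  define g where "g i x = complex_of_real (std_normal_density x) * exp (\<i> * of_real (s $ i * x))" for i x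
  define G where "G y = (\<Prod>i\<in>UNIV. g i (y i))" for y :: "'d \<Rightarrow> real"
  have intG: "integrable (\<Pi>\<^sub>M i\<in>UNIV. lborel) G"
    unfolding G_def g_def by (intro product_integrable_prod std_normal_density_cf) simp
  have "(\<integral>y. G y \<partial>(\<Pi>\<^sub>M i\<in>UNIV. lborel)) = (\<Prod>i\<in>UNIV. \<integral>x. g i x \<partial>lborel)"
    unfolding G_def g_def by (intro product_integral_prod std_normal_density_cf) simp
  also have "\<dots> = (\<Prod>i\<in>UNIV. of_real (exp (- (s $ i)\<^sup>2 / 2)))"
    unfolding g_def std_normal_density_cf ..
  also have "\<dots> = of_real (exp (- (s \<bullet> s) / 2))"
    by (simp add: exp_sum[symmetric] inner_vec_def power2_eq_square sum_divide_distrib sum_negf flip: of_real_prod)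
  finally have valG: "(\<integral>y. G y \<partial>(\<Pi>\<^sub>M i\<in>UNIV. lborel)) = of_real (exp (- (s \<bullet> s) / 2))" .
  define F where "F x = complex_of_real (gaussian_density \<theta> x) * exp (\<i> * of_real (t \<bullet> x))" for x
  have [measurable]: "F \<in> borel_measurable borel" unfolding F_def by measurable
  have FG: "\<bar>det W\<bar> *\<^sub>R F (fst \<theta> + W *v (\<chi> i. y i)) = exp (\<i> * of_real (t \<bullet> fst \<theta>)) * G y" for y
  proof -
    have "t \<bullet> (W *v (\<chi> i. y i)) = s \<bullet> (\<chi> i. y i)"
      by (simp add: s_def dot_lmul_matrix transpose_matrix_vector)
    also have "\<dots> = (\<Sum>i\<in>UNIV. s $ i * y i)" by (simp add: inner_vec_def)
    finally have e: "exp (\<i> * of_real (t \<bullet> (fst \<theta> + W *v (\<chi> i. y i)))) = exp (\<i> * of_real (t \<bullet> fst \<theta>)) * (\<Prod>i\<in>UNIV. exp (\<i> * of_real (s $ i * y i)))"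
      by (simp add: inner_add_right exp_add[symmetric] exp_sum[symmetric] distrib_left sum_distrib_left)
    have "\<bar>det W\<bar> *\<^sub>R F (fst \<theta> + W *v (\<chi> i. y i)) = of_real (\<bar>det W\<bar> * gaussian_density \<theta> (fst \<theta> + W *v (\<chi> i. y i))) * exp (\<i> * of_real (t \<bullet> (fst \<theta> + W *v (\<chi> i. y i))))"
      by (simp add: F_def scaleR_conv_of_real mult.assoc)
    then show ?thesis
      unfolding dens e by (simp add: G_def g_def prod.distrib mult_ac)
  qed
  have vm [measurable]: "(\<lambda>f. \<chi> i. f i) \<in> borel_measurable (\<Pi>\<^sub>M i\<in>(UNIV::'d set). (lborel :: real measure))"
    by measurable
  have "has_bochner_integral (\<Pi>\<^sub>M i\<in>UNIV. lborel) (\<lambda>y. exp (\<i> * of_real (t \<bullet> fst \<theta>)) * G y) (exp (\<i> * of_real (t \<bullet> fst \<theta>)) * of_real (exp (- (s \<bullet> s) / 2)))"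
    using intG valG by (intro has_bochner_integral_mult_right) (auto simp: has_bochner_integral_iff)
  also have "exp (\<i> * of_real (t \<bullet> fst \<theta>)) * of_real (exp (- (s \<bullet> s) / 2)) = gauss_cf \<theta> t"
  proof -
    have "s \<bullet> s = t \<bullet> (snd \<theta> *v t)" by (simp only: s_def quad)
    then show ?thesis by (simp add: gauss_cf_def exp_of_real[symmetric] exp_add[symmetric])
  qed
  finally have hb: "has_bochner_integral (\<Pi>\<^sub>M i\<in>UNIV. lborel) (\<lambda>y. \<bar>det W\<bar> *\<^sub>R F (fst \<theta> + W *v (\<chi> i. y i))) (gauss_cf \<theta> t)"
    by (simp add: FG)
  \<comment> \<open>From here the integral is carried from the product space to vectors, then
    through the affine map, and the factor |det W| becomes a density.\<close>
  have "has_bochner_integral (distr (\<Pi>\<^sub>M i\<in>UNIV. lborel) borel (\<lambda>f. \<chi> i. f i)) (\<lambda>y. \<bar>det W\<bar> *\<^sub>R F (fst \<theta> + W *v y)) (gauss_cf \<theta> t)"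
    using hb vm unfolding has_bochner_integral_iff
    by (subst integrable_distr_eq, simp, measurable, subst integral_distr, simp, measurable)
  then have "has_bochner_integral lborel (\<lambda>y. \<bar>det W\<bar> *\<^sub>R F (fst \<theta> + W *v y)) (gauss_cf \<theta> t)"
    unfolding lborel_vec_eq[symmetric] .
  then have "has_bochner_integral (distr lborel borel (\<lambda>x. fst \<theta> + W *v x)) (\<lambda>x. \<bar>det W\<bar> *\<^sub>R F x) (gauss_cf \<theta> t)"
    unfolding has_bochner_integral_iff
    by (subst integrable_distr_eq, simp, measurable, subst integral_distr, simp, measurable)
  then have "has_bochner_integral (density (distr lborel borel (\<lambda>x. fst \<theta> + W *v x)) (\<lambda>_. ennreal \<bar>det W\<bar>)) F (gauss_cf \<theta> t)"
    by (intro has_bochner_integral_density) auto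
  then show ?thesis
    unfolding lborel_affine_matrix[OF W0, symmetric] F_def .
qed

lemma gauss_cf_0 [simp]: "gauss_cf \<theta> 0 = 1"
  by (simp add: gauss_cf_def)

lemma gaussian_density_integral:
  fixes \<theta> :: "'d::finite param"
  assumes S: "snd \<theta> \<in> pos_def_mats"
  shows "has_bochner_integral lborel (gaussian_density \<theta>) 1"
proof -
  have "has_bochner_integral lborel (\<lambda>x. complex_of_real (gaussian_density \<theta> x)) (complex_of_real 1)"
    using gaussian_cf_integral[OF S, of 0] by simp
  then show ?thesis
    by (simp only: has_bochner_integral_iff complex_of_real_integrable_eq integral_complex_of_real of_real_eq_iff)
qed

section \<open>Mixture densities\<close>

lemma mixture_density_sum:
  fixes G :: "'d::finite param pmf"
  assumes "finite (set_pmf G)"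
  shows "mixture_density G x = (\<Sum>\<theta>\<in>set_pmf G. pmf G \<theta> * gaussian_density \<theta> x)"
  unfolding mixture_density_def using assms by (subst integral_measure_pmf[of "set_pmf G"]) auto

lemma has_bochner_integral_mixture:
  fixes G :: "'d::finite param pmf"
  assumes G: "finite (set_pmf G)" and S: "\<And>\<theta>. \<theta> \<in> set_pmf G \<Longrightarrow> snd \<theta> \<in> pos_def_mats"
  shows "has_bochner_integral lborel (mixture_density G) 1"
    and "has_bochner_integral lborel (\<lambda>x. complex_of_real (mixture_density G x) * exp (\<i> * of_real (t \<bullet> x))) (mixture_cf G t)"
proof -
  have "has_bochner_integral lborel (\<lambda>x. \<Sum>\<theta>\<in>set_pmf G. pmf G \<theta> * gaussian_density \<theta> x) (\<Sum>\<theta>\<in>set_pmf G. pmf G \<theta> * 1)"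
    by (intro has_bochner_integral_sum has_bochner_integral_mult_right gaussian_density_integral S)
  moreover have "mixture_density G = (\<lambda>x. \<Sum>\<theta>\<in>set_pmf G. pmf G \<theta> * gaussian_density \<theta> x)"
    by (rule ext) (rule mixture_density_sum[OF G])
  ultimately show "has_bochner_integral lborel (mixture_density G) 1"
    using sum_pmf_eq_1[OF G order.refl] by simp
  have "has_bochner_integral lborel (\<lambda>x. \<Sum>\<theta>\<in>set_pmf G. of_real (pmf G \<theta>) * (complex_of_real (gaussian_density \<theta> x) * exp (\<i> * of_real (t \<bullet> x))))
      (\<Sum>\<theta>\<in>set_pmf G. of_real (pmf G \<theta>) * gauss_cf \<theta> t)"
    by (intro has_bochner_integral_sum has_bochner_integral_mult_right gaussian_cf_integral S)
  then show "has_bochner_integral lborel (\<lambda>x. complex_of_real (mixture_density G x) * exp (\<i> * of_real (t \<bullet> x))) (mixture_cf G t)"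
    using G by (simp add: mixture_density_sum mixture_cf_def sum_distrib_right mult.assoc)
qed

lemma mixture_density_pos:
  fixes G :: "'d::finite param pmf"
  assumes G: "finite (set_pmf G)" and S: "\<And>\<theta>. \<theta> \<in> set_pmf G \<Longrightarrow> snd \<theta> \<in> pos_def_mats"
  shows "0 < mixture_density G x"
  unfolding mixture_density_sum[OF G]
  using G S set_pmf_not_empty by (intro sum_pos) (auto simp: gaussian_density_pos pmf_positive)

text \<open>Let l be the least value of the forms on the unit sphere and M a bound for the operator
  norms. Then y = S^-1 v satisfies l |y| <= |v| <= M |y|, and v . S^-1 v = y . S y >= l |y|^2 >= (l
  / M^2) |v|^2.\<close>

lemma compact_pos_def_bounds:
  fixes \<Omega> :: "(real^'d::finite^'d) set"
  assumes \<Omega>: "compact \<Omega>" "\<Omega> \<subseteq> pos_def_mats"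
  shows "\<exists>c>0. \<exists>B>0. \<forall>S\<in>\<Omega>. c \<le> det S \<and> (\<forall>v. norm (matrix_inv S *v v) \<le> B * norm v) \<and>
     (\<forall>v. c * (v \<bullet> v) \<le> v \<bullet> (matrix_inv S *v v))"
proof (cases "\<Omega> = {}")
  case True
  then show ?thesis by (rule_tac exI[of _ 1], simp, rule_tac exI[of _ 1], simp)
next
  case False
  have "continuous_on \<Omega> det"
    unfolding det_def by (intro continuous_intros)
  then obtain S0 where S0: "S0 \<in> \<Omega>" "\<And>S. S \<in> \<Omega> \<Longrightarrow> det S0 \<le> det S"
    using continuous_attains_inf[OF \<Omega>(1) False] by blast
  have d0: "det S0 > 0" using S0 \<Omega> pos_def_det_pos by blast
  define X where "X = \<Omega> \<times> sphere (0::real^'d) 1"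
  have cX: "compact X" unfolding X_def using \<Omega>(1) by (intro compact_Times) auto
  have "axis undefined 1 \<in> sphere (0::real^'d) 1" by (simp add: dist_norm)
  then have neX: "X \<noteq> {}" using False unfolding X_def by blast
  have coX: "continuous_on X (\<lambda>x. snd x \<bullet> (fst x *v snd x))" by (intro continuous_intros)
  obtain x0 where x0: "x0 \<in> X" "\<And>x. x \<in> X \<Longrightarrow> snd x0 \<bullet> (fst x0 *v snd x0) \<le> snd x \<bullet> (fst x *v snd x)"
    using continuous_attains_inf[OF cX neX coX] by blast
  define l where "l = snd x0 \<bullet> (fst x0 *v snd x0)"
  have "fst x0 \<in> pos_def_mats" "snd x0 \<noteq> 0" using x0(1) \<Omega>(2) by (auto simp: X_def)
  then have l: "l > 0" unfolding l_def pos_def_mats_def by blast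
  have lb: "l * (v \<bullet> v) \<le> v \<bullet> (S *v v)" if S: "S \<in> \<Omega>" for S v
  proof (cases "v = 0")
    case False
    have "l \<le> (v /\<^sub>R norm v) \<bullet> (S *v (v /\<^sub>R norm v))"
      using x0(2)[of "(S, v /\<^sub>R norm v)"] S False by (simp add: l_def X_def)
    also have "\<dots> = (v \<bullet> (S *v v)) / (v \<bullet> v)"
      by (simp add: matrix_vector_mult_scaleR dot_square_norm power2_eq_square field_simps)
    finally show ?thesis using False by (simp add: field_simps)
  qed simp
  obtain N where N: "\<And>S. S \<in> \<Omega> \<Longrightarrow> norm S \<le> N" using compact_imp_bounded[OF \<Omega>(1)] by (auto simp: bounded_iff)
  have "bilinear ((*v) :: real^'d^'d \<Rightarrow> real^'d \<Rightarrow> real^'d)"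
    unfolding bilinear_def
    by (auto intro!: linearI simp: matrix_vector_mult_add_rdistrib scaleR_matrix_vector_assoc[symmetric]
        matrix_vector_right_distrib matrix_vector_mult_scaleR)
  then obtain K where K: "K > 0" "\<And>(S :: real^'d^'d) v. norm (S *v v) \<le> K * norm S * norm v"
    using bilinear_bounded_pos by blast
  define M where "M = \<bar>N\<bar> * K + 1"
  have M: "M > 0" using K by (simp add: M_def add_nonneg_pos)
  have SM: "norm (S *v v) \<le> M * norm v" if "S \<in> \<Omega>" for S v
  proof -
    have "norm (S *v v) \<le> K * norm S * norm v" by (rule K)
    also have "\<dots> \<le> K * \<bar>N\<bar> * norm v" using N[OF that] K(1) by (intro mult_right_mono mult_left_mono) auto
    also have "\<dots> \<le> M * norm v" by (simp add: M_def algebra_simps)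
    finally show ?thesis .
  qed
  define c where "c = min (det S0) (l / M\<^sup>2)"
  have c: "c > 0" using d0 l M by (simp add: c_def)
  have "c \<le> det S \<and> (\<forall>v. norm (matrix_inv S *v v) \<le> 1 / l * norm v) \<and> (\<forall>v. c * (v \<bullet> v) \<le> v \<bullet> (matrix_inv S *v v))"
    if S: "S \<in> \<Omega>" for S
  proof (intro conjI allI)
    have "S \<in> pos_def_mats" using S \<Omega>(2) by blast
    note inv = matrix_inv_mult[OF pos_def_invertible[OF this]]
    show "c \<le> det S" using S0(2)[OF S] by (simp add: c_def)
    fix v
    define y where "y = matrix_inv S *v v"
    have v: "S *v y = v" by (simp add: y_def matrix_vector_mul_assoc inv)
    have "l * (norm y * norm y) \<le> y \<bullet> v" using lb[OF S, of y] v by (simp add: dot_square_norm power2_eq_square)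
    also have "\<dots> \<le> norm y * norm v" by (rule norm_cauchy_schwarz)
    finally have "norm y * (l * norm y) \<le> norm y * norm v" by (simp add: mult_ac)
    then have "l * norm y \<le> norm v" by (cases "y = 0") auto
    then show "norm (matrix_inv S *v v) \<le> 1 / l * norm v" using l by (simp add: y_def[symmetric] field_simps)
    have "norm v \<le> M * norm y" using SM[OF S, of y] v by simp
    then have "norm v * norm v \<le> (M * norm y) * (M * norm y)" using M by (intro mult_mono) auto
    then have vv: "v \<bullet> v \<le> M\<^sup>2 * (y \<bullet> y)" by (simp add: dot_square_norm power2_eq_square mult_ac)
    have "c * (v \<bullet> v) \<le> (l / M\<^sup>2) * (v \<bullet> v)" by (intro mult_right_mono) (auto simp: c_def)
    also have "\<dots> \<le> (l / M\<^sup>2) * (M\<^sup>2 * (y \<bullet> y))" using vv l M by (intro mult_left_mono) auto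
    also have "\<dots> = l * (y \<bullet> y)" using M by simp
    also have "\<dots> \<le> y \<bullet> v" using lb[OF S, of y] v by simp
    finally show "c * (v \<bullet> v) \<le> v \<bullet> (matrix_inv S *v v)" by (simp add: y_def inner_commute)
  qed
  moreover have "1 / l > 0" using l by simp
  ultimately show ?thesis using c by blast
qed

section \<open>Domination and Lipschitz dependence on the parameter\<close>

lemma exp_neg_diff:
  fixes u v :: real
  assumes "c \<le> u" "c \<le> v"
  shows "\<bar>exp (- u) - exp (- v)\<bar> \<le> exp (- c) * \<bar>u - v\<bar>"
proof -
  have *: "exp (- u) - exp (- v) \<le> exp (- c) * (v - u)" if "c \<le> u" "u \<le> v" for u v :: real
  proof -
    have "exp (- u) - exp (- v) = exp (- u) * (1 - exp (- (v - u)))" by (simp add: algebra_simps flip: exp_add)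
    also have "\<dots> \<le> exp (- u) * (v - u)" 
    proof (rule mult_left_mono)
      show "1 - exp (- (v - u)) \<le> v - u" using exp_ge_add_one_self[of "- (v - u)"] by linarith
    qed simp
    also have "\<dots> \<le> exp (- c) * (v - u)" using that by (intro mult_right_mono) auto
    finally show ?thesis .
  qed
  show ?thesis
  proof (cases "u \<le> v")
    case True
    then have "exp (- v) \<le> exp (- u)" by simp
    then show ?thesis using *[of u v] assms True by simp
  next
    case False
    then have "exp (- u) \<le> exp (- v)" by simp
    then show ?thesis using *[of v u] assms False by simp
  qed
qed

lemma linear_le_exp:
  fixes z c :: real
  assumes "0 < c" "0 \<le> z"
  shows "1 + z \<le> (1 + 1 / c) * exp (c * z)"
proof -
  have "c * z \<le> exp (c * z)" using exp_ge_add_one_self[of "c * z"] by linarith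
  then have "z \<le> 1 / c * exp (c * z)" using assms by (simp add: field_simps)
  moreover have "1 \<le> exp (c * z)" using assms by simp
  ultimately show ?thesis unfolding distrib_right mult_1 by linarith
qed

text \<open>One integrable function that dominates all densities of the family and their difference
  quotients in the parameter; brackets are formed by adding multiples of it.\<close>

definition gaussian_envelope :: "real \<Rightarrow> real^'d::finite \<Rightarrow> real" where
  "gaussian_envelope c x = exp (- c * (x \<bullet> x))"

lemma integrable_gaussian_envelope:
  assumes c: "0 < c"
  shows "integrable lborel (gaussian_envelope c :: real^'d::finite \<Rightarrow> real)"
proof -
  \<comment> \<open>The envelope is a multiple of the centred Gaussian density with this covariance,
    whose inverse is 2 c times the identity.\<close>
  define S :: "real^'d^'d" where "S = (1 / (2 * c)) *\<^sub>R mat 1"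
  have Sv: "S *v v = (1 / (2 * c)) *\<^sub>R v" for v
    by (simp add: S_def scaleR_matrix_vector_assoc[symmetric])
  have "transpose S = S" by (auto simp: S_def transpose_def vec_eq_iff mat_def)
  then have S: "S \<in> pos_def_mats"
    using c by (simp add: pos_def_mats_def symmetric_mats_def Sv)
  note inv = matrix_inv_mult[OF pos_def_invertible[OF S]]
  have "matrix_inv S *v v = (2 * c) *\<^sub>R v" for v
  proof -
    have "matrix_inv S *v (S *v v) = v" by (simp add: matrix_vector_mul_assoc inv)
    then have "matrix_inv S *v ((2 * c) *\<^sub>R (S *v v)) = (2 * c) *\<^sub>R v"
      by (simp only: matrix_vector_mult_scaleR)
    then show ?thesis using c by (simp add: Sv)
  qed
  then have "gaussian_density (0, S) x = gaussian_envelope c x / sqrt ((2 * pi) ^ CARD('d) * det S)" for x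
    by (simp add: gaussian_density_def gaussian_envelope_def)
  then have "gaussian_envelope c = (\<lambda>x. sqrt ((2 * pi) ^ CARD('d) * det S) * gaussian_density (0, S) x)"
    using pos_def_det_pos[OF S] by (intro ext) simp
  moreover have "integrable lborel (gaussian_density (0, S))"
    using gaussian_density_integral[of "(0, S)"] S by (simp add: has_bochner_integral_iff)
  ultimately show ?thesis by simp
qed

lemma det_lipschitz:
  fixes \<Omega> :: "(real^'d::finite^'d) set"
  assumes "bounded \<Omega>"
  shows "\<exists>L>0. \<forall>S\<in>\<Omega>. \<forall>S'\<in>\<Omega>. \<bar>det S - det S'\<bar> \<le> L * norm (S - S')"
proof -
  obtain N where N: "\<And>S. S \<in> \<Omega> \<Longrightarrow> norm S \<le> N" using assms by (auto simp: bounded_iff)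
  define K where "K = max 1 N"
  have entry: "\<bar>S $ i $ j\<bar> \<le> norm S" for S :: "real^'d^'d" and i j
    by (rule order.trans[OF component_le_norm_cart Finite_Cartesian_Product.norm_nth_le])
  have pr: "\<bar>(\<Prod>i\<in>I. S $ i $ p i) - (\<Prod>i\<in>I. S' $ i $ p i)\<bar> \<le> real (card I) * K ^ card I * norm (S - S')"
    if "finite I" and S: "S \<in> \<Omega>" "S' \<in> \<Omega>" for I S S' and p :: "'d \<Rightarrow> 'd"
    using \<open>finite I\<close>
  proof (induction I rule: finite_induct)
    case (insert j I)
    have bd: "\<bar>\<Prod>i\<in>I. S' $ i $ p i\<bar> \<le> K ^ card I"
    proof -
      have "\<bar>\<Prod>i\<in>I. S' $ i $ p i\<bar> \<le> (\<Prod>i\<in>I. K)"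
        unfolding abs_prod
      proof (rule prod_mono)
        show "0 \<le> \<bar>S' $ i $ p i\<bar> \<and> \<bar>S' $ i $ p i\<bar> \<le> K" for i
          using entry[of S' i "p i"] N[OF S(2)] by (simp add: K_def)
      qed
      then show ?thesis by simp
    qed
    have K1: "1 \<le> K" by (simp add: K_def)
    have Sj: "\<bar>S $ j $ p j\<bar> \<le> K" using entry[of S j "p j"] N[OF S(1)] by (simp add: K_def)
    have dj: "\<bar>S $ j $ p j - S' $ j $ p j\<bar> \<le> norm (S - S')" using entry[of "S - S'" j "p j"] by simp
    have "(\<Prod>i\<in>insert j I. S $ i $ p i) - (\<Prod>i\<in>insert j I. S' $ i $ p i)
        = S $ j $ p j * ((\<Prod>i\<in>I. S $ i $ p i) - (\<Prod>i\<in>I. S' $ i $ p i)) + (S $ j $ p j - S' $ j $ p j) * (\<Prod>i\<in>I. S' $ i $ p i)"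
      using insert.hyps by (simp add: algebra_simps)
    also have "\<bar>\<dots>\<bar> \<le> \<bar>S $ j $ p j\<bar> * \<bar>(\<Prod>i\<in>I. S $ i $ p i) - (\<Prod>i\<in>I. S' $ i $ p i)\<bar> + \<bar>S $ j $ p j - S' $ j $ p j\<bar> * \<bar>\<Prod>i\<in>I. S' $ i $ p i\<bar>"
      by (rule order.trans[OF abs_triangle_ineq]) (simp add: abs_mult)
    also have "\<dots> \<le> K * (real (card I) * K ^ card I * norm (S - S')) + norm (S - S') * K ^ card I"
      using insert.IH Sj dj bd K1 by (auto intro!: add_mono mult_mono)
    also have "\<dots> \<le> K * (real (card I) * K ^ card I * norm (S - S')) + norm (S - S') * (K * K ^ card I)"
      using K1 mult_right_mono[of 1 K "K ^ card I"] by (intro add_left_mono mult_left_mono) auto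
    also have "\<dots> = real (card (insert j I)) * K ^ card (insert j I) * norm (S - S')"
      using insert.hyps by (simp add: algebra_simps)
    finally show ?case .
  qed simp
  define P where "P = {p. p permutes (UNIV :: 'd set)}"
  define L where "L = (\<Sum>p\<in>P. real CARD('d) * K ^ CARD('d)) + 1"
  have "\<bar>det S - det S'\<bar> \<le> L * norm (S - S')" if S: "S \<in> \<Omega>" "S' \<in> \<Omega>" for S S'
  proof -
    have "det S - det S' = (\<Sum>p\<in>P. of_int (sign p) * ((\<Prod>i\<in>UNIV. S $ i $ p i) - (\<Prod>i\<in>UNIV. S' $ i $ p i)))"
      by (simp add: det_def P_def right_diff_distrib sum_subtractf)
    also have "\<bar>\<dots>\<bar> \<le> (\<Sum>p\<in>P. real CARD('d) * K ^ CARD('d) * norm (S - S'))"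
    proof (intro order.trans[OF sum_abs] sum_mono)
      fix p :: "'d \<Rightarrow> 'd"
      have "\<bar>of_int (sign p) :: real\<bar> = 1" by (simp add: sign_def)
      then show "\<bar>of_int (sign p) * ((\<Prod>i\<in>UNIV. S $ i $ p i) - (\<Prod>i\<in>UNIV. S' $ i $ p i))\<bar> \<le> real CARD('d) * K ^ CARD('d) * norm (S - S')"
        using pr[OF finite[of UNIV] S, of p] by (simp add: abs_mult)
    qed
    also have "\<dots> \<le> L * norm (S - S')" by (simp add: L_def distrib_right sum_distrib_right)
    finally show ?thesis .
  qed
  moreover have "L > 0" unfolding L_def by (intro add_nonneg_pos sum_nonneg) (auto simp: K_def)
  ultimately show ?thesis by blast
qed

section \<open>Brackets\<close>

lemma inverse_sqrt_diff:
  fixes y y' d :: real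
  assumes d: "0 < d" "d \<le> y" "d \<le> y'"
  shows "\<bar>1 / sqrt y - 1 / sqrt y'\<bar> \<le> \<bar>y - y'\<bar> / (d * sqrt d)"
proof -
  have s: "sqrt d > 0" "sqrt d \<le> sqrt y" "sqrt d \<le> sqrt y'" using d by auto
  have "(1 / sqrt y - 1 / sqrt y') = (y' - y) / (sqrt y * sqrt y' * (sqrt y + sqrt y'))"
  proof -
    have "(sqrt y' - sqrt y) * (sqrt y + sqrt y') = y' - y" using d by (simp add: algebra_simps)
    moreover have "1 / sqrt y - 1 / sqrt y' = (sqrt y' - sqrt y) / (sqrt y * sqrt y')" using s by (simp add: field_simps)
    moreover have "sqrt y + sqrt y' \<noteq> 0" using s by linarith
    ultimately show ?thesis by (metis mult_divide_mult_cancel_right)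
  qed
  then have "\<bar>1 / sqrt y - 1 / sqrt y'\<bar> = \<bar>y - y'\<bar> / (sqrt y * sqrt y' * (sqrt y + sqrt y'))"
    using s by (simp add: abs_minus_commute)
  also have "\<dots> \<le> \<bar>y - y'\<bar> / (d * sqrt d)"
  proof (rule divide_left_mono)
    have "sqrt d * sqrt d \<le> sqrt y * sqrt y'" using s by (intro mult_mono) auto
    then have "d \<le> sqrt y * sqrt y'" using d by simp
    moreover have "sqrt d \<le> sqrt y + sqrt y'" using s by linarith
    ultimately show "d * sqrt d \<le> sqrt y * sqrt y' * (sqrt y + sqrt y')" by (rule mult_mono) (use d s in auto)
    have "0 < sqrt y" "0 < sqrt y'" using s by linarith+
    then show "0 < sqrt y * sqrt y' * (sqrt y + sqrt y') * (d * sqrt d)"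
      using d s(1) by (intro mult_pos_pos add_pos_pos)
  qed simp
  finally show ?thesis .
qed

lemma norm_fst_snd_le: "norm (fst z) \<le> norm z" "norm (snd z) \<le> norm z"
  by (metis norm_fst_le prod.collapse, metis norm_snd_le prod.collapse)

text \<open>The exponents differ by at most a multiple of the parameter distance times 1 + |x|^2.
  Giving up half of the decay rate of the envelope absorbs this quadratic growth.\<close>

lemma gaussian_lipschitz:
  fixes \<Theta> :: "'d::finite param set"
  assumes \<Theta>: "compact \<Theta>" "snd ` \<Theta> \<subseteq> pos_def_mats"
  shows "\<exists>C>0. \<exists>c>0. \<forall>\<theta>\<in>\<Theta>. \<forall>x. gaussian_density \<theta> x \<le> C * gaussian_envelope c x \<and>
    (\<forall>\<theta>'\<in>\<Theta>. \<bar>gaussian_density \<theta> x - gaussian_density \<theta>' x\<bar> \<le> C * norm (\<theta> - \<theta>') * gaussian_envelope c x)"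
proof -
  define \<Omega> where "\<Omega> = snd ` \<Theta>"
  have \<Omega>: "compact \<Omega>" "\<Omega> \<subseteq> pos_def_mats"
    unfolding \<Omega>_def using \<Theta> by (auto intro!: compact_continuous_image continuous_intros)
  from compact_pos_def_bounds[OF \<Omega>] obtain c0 B where c0: "c0 > 0" and B: "B > 0"
    and bnd: "\<forall>S\<in>\<Omega>. c0 \<le> det S \<and> (\<forall>v. norm (matrix_inv S *v v) \<le> B * norm v) \<and>
     (\<forall>v. c0 * (v \<bullet> v) \<le> v \<bullet> (matrix_inv S *v v))" by (elim exE conjE)
  from det_lipschitz[OF compact_imp_bounded[OF \<Omega>(1)]] obtain Ld where Ld: "Ld > 0"
    and dlip: "\<And>S S'. S \<in> \<Omega> \<Longrightarrow> S' \<in> \<Omega> \<Longrightarrow> \<bar>det S - det S'\<bar> \<le> Ld * norm (S - S')" by blast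
  obtain R0 where R0: "\<And>\<theta>. \<theta> \<in> \<Theta> \<Longrightarrow> norm \<theta> \<le> R0" using compact_imp_bounded[OF \<Theta>(1)] by (auto simp: bounded_iff)
  define R where "R = max 0 R0"
  have R: "0 \<le> R" "norm (fst \<theta>) \<le> R" if "\<theta> \<in> \<Theta>" for \<theta>
    using R0[OF that] norm_fst_snd_le(1)[of \<theta>] by (simp_all add: R_def)
  have R: "0 \<le> R" "\<And>\<theta>. \<theta> \<in> \<Theta> \<Longrightarrow> norm (fst \<theta>) \<le> R"
    by (simp add: R_def) (rule R)
  have "bilinear ((*v) :: real^'d^'d \<Rightarrow> real^'d \<Rightarrow> real^'d)"
    unfolding bilinear_def
    by (auto intro!: linearI simp: matrix_vector_mult_add_rdistrib scaleR_matrix_vector_assoc[symmetric]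
        matrix_vector_right_distrib matrix_vector_mult_scaleR)
  then obtain K where K: "K > 0" "\<And>(S :: real^'d^'d) v. norm (S *v v) \<le> K * norm S * norm v"
    using bilinear_bounded_pos by blast
  define q where "q \<theta> x = ((x - fst \<theta>) \<bullet> (matrix_inv (snd \<theta>) *v (x - fst \<theta>))) / 2" for \<theta> :: "'d param" and x
  define y where "y \<theta> = (2 * pi) ^ CARD('d) * det (snd \<theta>)" for \<theta> :: "'d param"
  have dens: "gaussian_density \<theta> x = exp (- q \<theta> x) * (1 / sqrt (y \<theta>))" for \<theta> :: "'d param" and x
    by (simp add: gaussian_density_def case_prod_unfold q_def y_def)
  define d0 where "d0 = (2 * pi) ^ CARD('d) * c0"
  have d0: "d0 > 0" using c0 by (simp add: d0_def)
  have yd: "d0 \<le> y \<theta>" if "\<theta> \<in> \<Theta>" for \<theta>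
    unfolding d0_def y_def using bnd that by (intro mult_left_mono) (auto simp: \<Omega>_def)
  define D0 where "D0 = 1 / sqrt d0"
  have D0: "D0 > 0" using d0 by (simp add: D0_def)
  have D0': "1 / sqrt (y \<theta>) \<le> D0" "0 \<le> 1 / sqrt (y \<theta>)" if "\<theta> \<in> \<Theta>" for \<theta>
    using yd[OF that] d0 unfolding D0_def by (auto intro!: divide_left_mono mult_pos_pos)
  define C2 where "C2 = (2 * pi) ^ CARD('d) * Ld / (d0 * sqrt d0)"
  have C2: "C2 > 0" using Ld d0 by (simp add: C2_def)
  have Dlip: "\<bar>1 / sqrt (y \<theta>) - 1 / sqrt (y \<theta>')\<bar> \<le> C2 * norm (\<theta> - \<theta>')" if t: "\<theta> \<in> \<Theta>" "\<theta>' \<in> \<Theta>" for \<theta> \<theta>'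
  proof -
    have "\<bar>y \<theta> - y \<theta>'\<bar> = (2 * pi) ^ CARD('d) * \<bar>det (snd \<theta>) - det (snd \<theta>')\<bar>"
      by (simp add: y_def abs_mult flip: right_diff_distrib)
    also have "\<dots> \<le> (2 * pi) ^ CARD('d) * (Ld * norm (snd \<theta> - snd \<theta>'))"
      using t by (intro mult_left_mono dlip) (auto simp: \<Omega>_def)
    also have "\<dots> \<le> (2 * pi) ^ CARD('d) * (Ld * norm (\<theta> - \<theta>'))"
      using norm_fst_snd_le(2)[of "\<theta> - \<theta>'"] Ld by (intro mult_left_mono) auto
    finally have yl: "\<bar>y \<theta> - y \<theta>'\<bar> \<le> (2 * pi) ^ CARD('d) * (Ld * norm (\<theta> - \<theta>'))" .
    have "\<bar>1 / sqrt (y \<theta>) - 1 / sqrt (y \<theta>')\<bar> \<le> \<bar>y \<theta> - y \<theta>'\<bar> / (d0 * sqrt d0)"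
      using t d0 yd by (intro inverse_sqrt_diff) auto
    also have "\<dots> \<le> ((2 * pi) ^ CARD('d) * (Ld * norm (\<theta> - \<theta>'))) / (d0 * sqrt d0)"
      using yl d0 by (intro divide_right_mono) auto
    finally show ?thesis by (simp add: C2_def)
  qed
  \<comment> \<open>A common lower bound for all exponents, from
    \<open>c0 * (w \<bullet> w) \<le> 2 * q \<theta> x\<close> and |x|^2 <= 2 |w|^2 + 2 R^2, where w
    = x - mean.\<close>
  define m where "m x = c0 / 4 * (x \<bullet> x) - c0 * R\<^sup>2 / 2" for x :: "real^'d"
  have qm: "m x \<le> q \<theta> x" if t: "\<theta> \<in> \<Theta>" for \<theta> x
  proof -
    define w where "w = x - fst \<theta>"
    have "norm x \<le> norm w + R" using norm_triangle_ineq[of w "fst \<theta>"] R(2)[OF t] by (simp add: w_def)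
    then have "(norm x)\<^sup>2 \<le> (norm w + R)\<^sup>2" by (intro power_mono) auto
    also have "\<dots> \<le> 2 * (norm w)\<^sup>2 + 2 * R\<^sup>2" using sum_squares_bound[of "norm w" R] by (simp add: power2_sum)
    finally have "x \<bullet> x \<le> 2 * (w \<bullet> w) + 2 * R\<^sup>2" by (simp add: dot_square_norm)
    then have "c0 * (x \<bullet> x) \<le> c0 * (2 * (w \<bullet> w) + 2 * R\<^sup>2)" using c0 by (intro mult_left_mono) auto
    moreover have "c0 * (w \<bullet> w) \<le> 2 * q \<theta> x" using bnd t by (auto simp: q_def w_def \<Omega>_def)
    ultimately show ?thesis by (simp add: m_def algebra_simps)
  qed
  define E where "E = exp (c0 * R\<^sup>2 / 2)"
  have Em: "exp (- m x) = E * gaussian_envelope (c0 / 4) x" for x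
    by (simp add: E_def m_def gaussian_envelope_def flip: exp_add)
  have E: "E > 0" by (simp add: E_def)
  \<comment> \<open>2 B comes from shifting the mean in either argument of the form, B K B from
    changing the inverse covariance; the rest bounds (|x| + R)^2 by 1 + |x|^2.\<close>
  define C1 where "C1 = 2 * (2 * B + B * K * B) * (1 + R)\<^sup>2"
  have C1: "C1 > 0" using B K R by (simp add: C1_def add_pos_pos add_pos_nonneg)
  have qlip: "\<bar>q \<theta> x - q \<theta>' x\<bar> \<le> C1 * norm (\<theta> - \<theta>') * (1 + x \<bullet> x)" if t: "\<theta> \<in> \<Theta>" "\<theta>' \<in> \<Theta>" for \<theta> \<theta>' x
  proof -
    define w w' P P' where "w = x - fst \<theta>" and "w' = x - fst \<theta>'" and "P = matrix_inv (snd \<theta>)" and "P' = matrix_inv (snd \<theta>')"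
    define N where "N = norm (\<theta> - \<theta>')"
    define r where "r = (1 + R) * (1 + norm x)"
    have N: "norm (w - w') \<le> N" "norm (snd \<theta>' - snd \<theta>) \<le> N" "0 \<le> N"
      using norm_fst_snd_le[of "\<theta> - \<theta>'"] by (auto simp: w_def w'_def N_def norm_minus_commute)
    have r1: "1 \<le> r" using R mult_mono[of 1 "1 + R" 1 "1 + norm x"] by (simp add: r_def)
    have "norm x + R \<le> r" using R by (simp add: r_def algebra_simps)
    then have w: "norm w \<le> r" "norm w' \<le> r"
      using R(2)[OF t(1)] R(2)[OF t(2)] norm_triangle_ineq4[of x "fst \<theta>"] norm_triangle_ineq4[of x "fst \<theta>'"]
      by (auto simp: w_def w'_def)
    have P: "norm (P *v v) \<le> B * norm v" "norm (P' *v v) \<le> B * norm v" for v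
      using bnd t by (auto simp: P_def P'_def \<Omega>_def)
    have rr: "r \<le> r * r" using r1 by (simp add: mult_left_mono[of 1 r r, simplified])
    have pd: "snd \<theta> \<in> pos_def_mats" "snd \<theta>' \<in> pos_def_mats" using t \<Theta>(2) by auto
    \<comment> \<open>The resolvent identity for inverses: their difference is controlled by the
      difference of the covariances.\<close>
    have PP: "P *v v - P' *v v = P' *v ((snd \<theta>' - snd \<theta>) *v (P *v v))" for v
    proof -
      have "snd \<theta> *v (P *v v) = v" "P' *v (snd \<theta>' *v u) = u" for u v
        using matrix_inv_mult[OF pos_def_invertible[OF pd(1)]] matrix_inv_mult[OF pos_def_invertible[OF pd(2)]]
        by (simp_all add: matrix_vector_mul_assoc P_def P'_def)
      then show ?thesis by (simp add: matrix_vector_mult_diff_rdistrib matrix_vector_mult_diff_distrib)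
    qed
    have "w \<bullet> (P *v w) - w' \<bullet> (P' *v w') = (w - w') \<bullet> (P *v w) + w' \<bullet> (P *v w - P' *v w) + w' \<bullet> (P' *v (w - w'))"
      by (simp add: algebra_simps inner_diff_left inner_diff_right matrix_vector_mult_diff_distrib)
    also have "\<bar>\<dots>\<bar> \<le> \<bar>(w - w') \<bullet> (P *v w)\<bar> + \<bar>w' \<bullet> (P *v w - P' *v w)\<bar> + \<bar>w' \<bullet> (P' *v (w - w'))\<bar>" by linarith
    also have "\<dots> \<le> N * (B * r) + r * (B * (K * N * (B * r))) + r * (B * N)"
    proof (intro add_mono)
      have "\<bar>(w - w') \<bullet> (P *v w)\<bar> \<le> norm (w - w') * norm (P *v w)" by (rule Cauchy_Schwarz_ineq2)
      also have "\<dots> \<le> N * (B * r)"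
        using N w P(1)[of w] B by (intro mult_mono) (auto intro: order.trans[OF P(1)] mult_left_mono)
      finally show "\<bar>(w - w') \<bullet> (P *v w)\<bar> \<le> N * (B * r)" .
      have "norm (P *v w - P' *v w) \<le> B * norm ((snd \<theta>' - snd \<theta>) *v (P *v w))" unfolding PP by (rule P)
      also have "\<dots> \<le> B * (K * norm (snd \<theta>' - snd \<theta>) * norm (P *v w))" using B by (intro mult_left_mono K) auto
      also have "\<dots> \<le> B * (K * N * (B * r))"
        using N w P(1)[of w] B K by (intro mult_left_mono mult_mono) (auto intro: order.trans[OF P(1)] mult_left_mono)
      finally have "norm (P *v w - P' *v w) \<le> B * (K * N * (B * r))" .
      then show "\<bar>w' \<bullet> (P *v w - P' *v w)\<bar> \<le> r * (B * (K * N * (B * r)))"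
        using w r1 by (intro order.trans[OF Cauchy_Schwarz_ineq2] mult_mono) auto
      have "norm (P' *v (w - w')) \<le> B * N" using P(2)[of "w - w'"] N B by (auto intro: order.trans mult_left_mono)
      then show "\<bar>w' \<bullet> (P' *v (w - w'))\<bar> \<le> r * (B * N)"
        using w r1 by (intro order.trans[OF Cauchy_Schwarz_ineq2] mult_mono) auto
    qed
    also have "\<dots> = 2 * (N * B) * r + N * (B * K * B) * (r * r)" by (simp add: algebra_simps)
    also have "\<dots> \<le> 2 * (N * B) * (r * r) + N * (B * K * B) * (r * r)"
      using rr N B by (intro add_right_mono mult_left_mono) auto
    also have "\<dots> = (2 * B + B * K * B) * N * (r * r)" by (simp add: algebra_simps)
    also have "\<dots> \<le> (2 * B + B * K * B) * N * ((1 + R)\<^sup>2 * (2 * (1 + x \<bullet> x)))"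
    proof (rule mult_left_mono)
      have "(1 + norm x)\<^sup>2 \<le> 2 * (1 + x \<bullet> x)"
        using sum_squares_bound[of 1 "norm x"] by (simp add: power2_sum dot_square_norm)
      then have "(1 + R)\<^sup>2 * (1 + norm x)\<^sup>2 \<le> (1 + R)\<^sup>2 * (2 * (1 + x \<bullet> x))" by (intro mult_left_mono) auto
      then show "r * r \<le> (1 + R)\<^sup>2 * (2 * (1 + x \<bullet> x))" by (simp add: r_def power2_eq_square mult_ac)
      show "0 \<le> (2 * B + B * K * B) * N" using B K N by simp
    qed
    also have "\<dots> = C1 * N * (1 + x \<bullet> x)" unfolding C1_def by (simp only: mult_ac)
    finally have b: "\<bar>w \<bullet> (P *v w) - w' \<bullet> (P' *v w')\<bar> \<le> C1 * N * (1 + x \<bullet> x)" .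
    have "\<bar>q \<theta> x - q \<theta>' x\<bar> = \<bar>w \<bullet> (P *v w) - w' \<bullet> (P' *v w')\<bar> / 2"
      by (simp add: q_def w_def w'_def P_def P'_def flip: diff_divide_distrib)
    also have "\<dots> \<le> \<bar>w \<bullet> (P *v w) - w' \<bullet> (P' *v w')\<bar>" by simp
    also note b
    finally show ?thesis unfolding N_def .
  qed
  define c where "c = c0 / 8"
  have c: "c > 0" using c0 by (simp add: c_def)
  define C where "C = E * D0 + E * (C1 * D0 + C2) * (1 + 1 / c)"
  have C: "C > 0" using E D0 C1 C2 c by (simp add: C_def add_pos_pos)
  have env: "(1 + x \<bullet> x) * gaussian_envelope (c0 / 4) x \<le> (1 + 1 / c) * gaussian_envelope c x"
    "gaussian_envelope (c0 / 4) x \<le> gaussian_envelope c x" for x :: "real^'d"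
  proof -
    have e: "exp (c * (x \<bullet> x)) * gaussian_envelope (c0 / 4) x = gaussian_envelope c x"
      by (simp add: gaussian_envelope_def c_def flip: exp_add)
    have "(1 + x \<bullet> x) * gaussian_envelope (c0 / 4) x \<le> (1 + 1 / c) * exp (c * (x \<bullet> x)) * gaussian_envelope (c0 / 4) x"
      using linear_le_exp[OF c, of "x \<bullet> x"] by (intro mult_right_mono) (auto simp: gaussian_envelope_def)
    then show "(1 + x \<bullet> x) * gaussian_envelope (c0 / 4) x \<le> (1 + 1 / c) * gaussian_envelope c x" using e by (simp add: mult.assoc)
    show "gaussian_envelope (c0 / 4) x \<le> gaussian_envelope c x"
      using c0 by (simp add: gaussian_envelope_def c_def mult_right_mono)
  qed
  have env0: "0 < gaussian_envelope a x" for a and x :: "real^'d" by (simp add: gaussian_envelope_def)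
  show ?thesis
  proof (rule exI[of _ C], rule conjI[OF C], rule exI[of _ c], rule conjI[OF c], intro ballI allI conjI)
    fix \<theta> x assume t: "\<theta> \<in> \<Theta>"
    have ee: "exp (- q \<theta> x) \<le> exp (- m x)" if "\<theta> \<in> \<Theta>" for \<theta> using qm[OF that] by simp
    have "gaussian_density \<theta> x \<le> exp (- m x) * D0"
      unfolding dens using ee[OF t] D0'[OF t] by (intro mult_mono) auto
    also have "\<dots> = E * D0 * gaussian_envelope (c0 / 4) x" by (simp add: Em)
    also have "\<dots> \<le> E * D0 * gaussian_envelope c x" using env(2) E D0 by (intro mult_left_mono) auto
    also have "\<dots> \<le> C * gaussian_envelope c x"
      using env0[of c x] E C1 D0 C2 c by (intro mult_right_mono) (auto simp: C_def)
    finally show "gaussian_density \<theta> x \<le> C * gaussian_envelope c x" .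
    fix \<theta>' assume t': "\<theta>' \<in> \<Theta>"
    define N where "N = norm (\<theta> - \<theta>')"
    have N: "0 \<le> N" by (simp add: N_def)
    have z: "1 \<le> 1 + x \<bullet> x" by simp
    have "gaussian_density \<theta> x - gaussian_density \<theta>' x = (exp (- q \<theta> x) - exp (- q \<theta>' x)) * (1 / sqrt (y \<theta>)) + exp (- q \<theta>' x) * (1 / sqrt (y \<theta>) - 1 / sqrt (y \<theta>'))"
      unfolding dens by (simp add: algebra_simps)
    also have "\<bar>\<dots>\<bar> \<le> \<bar>exp (- q \<theta> x) - exp (- q \<theta>' x)\<bar> * (1 / sqrt (y \<theta>)) + exp (- q \<theta>' x) * \<bar>1 / sqrt (y \<theta>) - 1 / sqrt (y \<theta>')\<bar>"
      using D0'(2)[OF t] by (intro order.trans[OF abs_triangle_ineq]) (simp add: abs_mult)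
    also have "\<dots> \<le> (exp (- m x) * (C1 * N * (1 + x \<bullet> x))) * D0 + exp (- m x) * (C2 * N)"
    proof (intro add_mono mult_mono)
      show "\<bar>exp (- q \<theta> x) - exp (- q \<theta>' x)\<bar> \<le> exp (- m x) * (C1 * N * (1 + x \<bullet> x))"
        using exp_neg_diff[OF qm[OF t] qm[OF t'], of x] qlip[OF t t', of x]
        by (auto simp: N_def intro: order.trans mult_left_mono)
    qed (use D0' t t' Dlip ee C1 C2 N z in \<open>auto simp: N_def\<close>)
    also have "\<dots> \<le> (exp (- m x) * (C1 * N * (1 + x \<bullet> x))) * D0 + exp (- m x) * (C2 * N) * (1 + x \<bullet> x)"
      using C2 N mult_left_mono[OF z, of "exp (- m x) * (C2 * N)"] by simp
    also have "\<dots> = E * (C1 * D0 + C2) * N * ((1 + x \<bullet> x) * gaussian_envelope (c0 / 4) x)"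
      unfolding Em by (simp add: algebra_simps)
    also have "\<dots> \<le> E * (C1 * D0 + C2) * N * ((1 + 1 / c) * gaussian_envelope c x)"
      using env(1)[of x] E C1 D0 C2 N by (intro mult_left_mono) auto
    also have "\<dots> = (E * (C1 * D0 + C2) * (1 + 1 / c)) * N * gaussian_envelope c x" by (simp add: mult_ac)
    also have "\<dots> \<le> C * N * gaussian_envelope c x"
      using E D0 N env0[of c x] by (intro mult_right_mono) (auto simp: C_def)
    finally show "\<bar>gaussian_density \<theta> x - gaussian_density \<theta>' x\<bar> \<le> C * norm (\<theta> - \<theta>') * gaussian_envelope c x"
      by (simp add: N_def)
  qed
qed

text \<open>Coordinates are rounded to multiples of \<open>h\<close>, and one member of
  \<open>X\<close> is kept for each occurring code. The net thus consists of members of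
  \<open>X\<close> rather than grid points: its densities are true mixture densities.\<close>

lemma rounding_net:
  fixes v :: "'g \<Rightarrow> 'i \<Rightarrow> real"
  assumes I: "finite I" and v: "\<And>g i. g \<in> X \<Longrightarrow> i \<in> I \<Longrightarrow> \<bar>v g i\<bar> \<le> R" and h: "0 < h" "h \<le> 1" and R: "0 \<le> R"
  shows "\<exists>N. finite N \<and> N \<subseteq> X \<and> real (card N) \<le> ((2 * R + 5) / h) ^ card I \<and>
    (\<forall>g\<in>X. \<exists>g'\<in>N. \<forall>i\<in>I. \<bar>v g i - v g' i\<bar> < h)"
proof -
  define K where "K = \<lceil>R / h\<rceil> + 1"
  have "0 \<le> R / h" using R h by simp
  then have K0: "0 \<le> K" unfolding K_def by linarith
  define code where "code g = restrict (\<lambda>i. \<lfloor>v g i / h\<rfloor>) I" for g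
  define codes where "codes = I \<rightarrow>\<^sub>E {- K..K}"
  have code: "code g \<in> codes" if "g \<in> X" for g
  proof -
    have "\<lfloor>v g i / h\<rfloor> \<in> {- K..K}" if "i \<in> I" for i
    proof -
      have "\<bar>v g i / h\<bar> \<le> R / h"
        using v[OF \<open>g \<in> X\<close> that] h by (simp add: abs_divide divide_right_mono)
      then have "- (R / h) \<le> v g i / h" "v g i / h \<le> R / h" by linarith+
      then have "\<lfloor>- (R / h)\<rfloor> \<le> \<lfloor>v g i / h\<rfloor>" "\<lfloor>v g i / h\<rfloor> \<le> \<lfloor>R / h\<rfloor>" by (auto intro: floor_mono)
      moreover have "\<lfloor>R / h\<rfloor> \<le> \<lceil>R / h\<rceil>" by linarith
      ultimately show ?thesis by (simp add: K_def ceiling_def)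
    qed
    then show ?thesis by (auto simp: code_def codes_def)
  qed
  have fin: "finite codes" unfolding codes_def using I by (intro finite_PiE) auto
  have cc: "real (card codes) \<le> ((2 * R + 5) / h) ^ card I"
  proof -
    have "card codes = nat (2 * K + 1) ^ card I" using I by (simp add: codes_def card_PiE)
    then have "real (card codes) = (2 * real_of_int K + 1) ^ card I" using K0 by simp
    also have "\<dots> \<le> ((2 * R + 5) / h) ^ card I"
    proof (rule power_mono)
      have "real_of_int K \<le> R / h + 2" unfolding K_def by linarith
      then have "2 * real_of_int K + 1 \<le> 2 * (R / h) + 5 * 1" by linarith
      also have "\<dots> \<le> 2 * (R / h) + 5 * (1 / h)" using h by (intro add_left_mono mult_left_mono) auto
      also have "\<dots> = (2 * R + 5) / h" by (simp add: add_divide_distrib)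
      finally show "2 * real_of_int K + 1 \<le> (2 * R + 5) / h" .
    qed (use K0 in simp)
    finally show ?thesis .
  qed
  \<comment> \<open>Only codes that occur are given representatives that are used, so the choice is
    always from a nonempty set.\<close>
  define rep where "rep c = (SOME g. g \<in> X \<and> code g = c)" for c
  have rep: "rep (code g) \<in> X \<and> code (rep (code g)) = code g" if "g \<in> X" for g
    unfolding rep_def by (rule someI[of _ g]) (use that in simp)
  define N where "N = rep ` code ` X"
  have sub: "code ` X \<subseteq> codes" using code by blast
  have finX: "finite (code ` X)" using sub fin by (rule finite_subset)
  have "card N \<le> card (code ` X)" unfolding N_def using finX by (rule card_image_le)
  also have "\<dots> \<le> card codes" using fin sub by (rule card_mono)
  finally have "real (card N) \<le> ((2 * R + 5) / h) ^ card I" using cc by linarith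
  moreover have "finite N" "N \<subseteq> X" using finX rep by (auto simp: N_def)
  moreover have "\<exists>g'\<in>N. \<forall>i\<in>I. \<bar>v g i - v g' i\<bar> < h" if g: "g \<in> X" for g
  proof (intro bexI ballI)
    show "rep (code g) \<in> N" using g by (auto simp: N_def)
    fix i assume i: "i \<in> I"
    define g' where "g' = rep (code g)"
    have "code g' i = code g i" using rep[OF g] by (simp add: g'_def)
    then have "\<lfloor>v g' i / h\<rfloor> = \<lfloor>v g i / h\<rfloor>" using i by (simp add: code_def)
    then have "\<bar>v g i / h - v g' i / h\<bar> < 1" by linarith
    then have "\<bar>(v g i - v g' i) / h\<bar> < 1" by (simp add: diff_divide_distrib)
    then show "\<bar>v g i - v (rep (code g)) i\<bar> < h" using h by (simp add: abs_divide g'_def divide_less_eq)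
  qed
  ultimately show ?thesis by blast
qed

lemma norm_le_coordinates:
  fixes z :: "'a::euclidean_space"
  assumes "\<And>b. b \<in> Basis \<Longrightarrow> \<bar>z \<bullet> b\<bar> \<le> h"
  shows "norm z \<le> real DIM('a) * h"
  using norm_le_l1[of z] sum_bounded_above[of Basis "\<lambda>b. \<bar>z \<bullet> b\<bar>" h, OF assms] by linarith

text \<open>A mixing measure is coded by its order, weights and atom coordinates in an arbitrary
  enumeration. No continuity of the enumeration is needed: close codes give close mixtures term by
  term. The size of the net is polynomial in 1/h.\<close>

lemma mixture_net:
  fixes \<Theta> :: "'d::finite param set"
  assumes bd: "bounded \<Theta>" and C: "C > 0"
    and up: "\<And>\<theta> x. \<theta> \<in> \<Theta> \<Longrightarrow> \<bar>gaussian_density \<theta> x\<bar> \<le> C * env x"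
    and lip: "\<And>\<theta> \<theta>' x. \<theta> \<in> \<Theta> \<Longrightarrow> \<theta>' \<in> \<Theta> \<Longrightarrow> \<bar>gaussian_density \<theta> x - gaussian_density \<theta>' x\<bar> \<le> C * norm (\<theta> - \<theta>') * env x"
    and env: "\<And>x. 0 \<le> env x"
  shows "\<exists>A>0. \<exists>D L. L > 0 \<and> (\<forall>h. 0 < h \<longrightarrow> h \<le> 1 \<longrightarrow> (\<exists>N. finite N \<and> N \<subseteq> mixing_le k \<Theta> \<and> real (card N) \<le> A * (1 / h) ^ D \<and>
     (\<forall>G\<in>mixing_le k \<Theta>. \<exists>G'\<in>N. \<forall>x. \<bar>mixture_density G x - mixture_density G' x\<bar> \<le> L * h * env x)))"
proof -
  obtain R0 where R0: "\<And>\<theta>. \<theta> \<in> \<Theta> \<Longrightarrow> norm \<theta> \<le> R0" using bd by (auto simp: bounded_iff)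
  define R where "R = max (real k) (max 1 R0)"
  have R: "0 \<le> R" "real k \<le> R" "1 \<le> R" "R0 \<le> R" by (auto simp: R_def)
  define en where "en G = (SOME f. bij_betw f {..<card (set_pmf G)} (set_pmf G))" for G :: "'d param pmf"
  have en: "bij_betw (en G) {..<card (set_pmf G)} (set_pmf G)" if "G \<in> mixing_le k \<Theta>" for G
  proof -
    have "\<exists>f. bij_betw f {..<card (set_pmf G)} (set_pmf G)"
      using that ex_bij_betw_nat_finite[of "set_pmf G"] by (auto simp: mixing_le_def atLeast0LessThan)
    then show ?thesis unfolding en_def by (rule someI_ex)
  qed
  \<comment> \<open>\<open>None\<close> stands for the number of atoms,
    \<open>Some (j, None)\<close> for weight j and \<open>Some (j, Some b)\<close> for a coordinate
    of atom j; entries beyond the order are 0.\<close>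
  define idx where "idx = insert None (Some ` ({..<k} \<times> insert None (Some ` (Basis :: 'd param set))))"
  define v where "v G i = (case i of None \<Rightarrow> real (card (set_pmf G))
     | Some (j, b) \<Rightarrow> if j < card (set_pmf G) then (case b of None \<Rightarrow> pmf G (en G j) | Some b \<Rightarrow> en G j \<bullet> b) else 0)"
    for G :: "'d param pmf" and i
  have idx: "finite idx" by (simp add: idx_def)
  have enT: "en G j \<in> set_pmf G" "en G j \<in> \<Theta>" if "G \<in> mixing_le k \<Theta>" "j < card (set_pmf G)" for G j
    using bij_betwE[OF en[OF that(1)]] that by (auto simp: mixing_le_def)
  have vb: "\<bar>v G i\<bar> \<le> R" if G: "G \<in> mixing_le k \<Theta>" and i: "i \<in> idx" for G i
  proof -
    have "\<bar>en G j \<bullet> b\<bar> \<le> R" if "j < card (set_pmf G)" "b \<in> Basis" for j b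
      using Basis_le_norm[OF that(2), of "en G j"] R0[OF enT(2)[OF G that(1)]] R by linarith
    moreover have "real (card (set_pmf G)) \<le> R" using G R(2) by (simp add: mixing_le_def)
    moreover have "pmf G (en G j) \<le> R" for j using pmf_le_1[of G "en G j"] R(3) by linarith
    ultimately show ?thesis
      using i R(1) by (auto simp: idx_def v_def)
  qed
  define D where "D = card idx"
  define Dm where "Dm = real DIM('d param)"
  define L where "L = real k * (C + C * Dm) + 1"
  have L: "L > 0" using C by (simp add: L_def Dm_def add_nonneg_pos)
  define A where "A = (2 * R + 5) ^ D"
  have A: "A > 0" using R by (simp add: A_def)
  have net: "\<exists>N. finite N \<and> N \<subseteq> mixing_le k \<Theta> \<and> real (card N) \<le> A * (1 / h) ^ D \<and>
     (\<forall>G\<in>mixing_le k \<Theta>. \<exists>G'\<in>N. \<forall>x. \<bar>mixture_density G x - mixture_density G' x\<bar> \<le> L * h * env x)"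
    if h: "0 < h" "h \<le> 1" for h
  proof -
    have "\<exists>N. finite N \<and> N \<subseteq> mixing_le k \<Theta> \<and> real (card N) \<le> ((2 * R + 5) / h) ^ card idx \<and>
      (\<forall>g\<in>mixing_le k \<Theta>. \<exists>g'\<in>N. \<forall>i\<in>idx. \<bar>v g i - v g' i\<bar> < h)"
      using idx vb h R(1) by (rule rounding_net)
    then obtain N where N: "finite N" "N \<subseteq> mixing_le k \<Theta>"
      "real (card N) \<le> ((2 * R + 5) / h) ^ card idx"
      "\<forall>g\<in>mixing_le k \<Theta>. \<exists>g'\<in>N. \<forall>i\<in>idx. \<bar>v g i - v g' i\<bar> < h" by (elim exE conjE)
    have "\<exists>G'\<in>N. \<forall>x. \<bar>mixture_density G x - mixture_density G' x\<bar> \<le> L * h * env x"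
      if G: "G \<in> mixing_le k \<Theta>" for G
    proof -
      from N(4) G obtain G' where G': "G' \<in> N" and close: "\<And>i. i \<in> idx \<Longrightarrow> \<bar>v G i - v G' i\<bar> < h" by blast
      have G'm: "G' \<in> mixing_le k \<Theta>" using G' N(2) by blast
      define m where "m = card (set_pmf G)"
      \<comment> \<open>Since \<open>h \<le> 1\<close>, two integers closer than \<open>h\<close>
        are equal: both mixtures have the same number of atoms.\<close>
      have "\<bar>real (card (set_pmf G)) - real (card (set_pmf G'))\<bar> < 1" using close[of None] h by (simp add: idx_def v_def)
      then have m': "card (set_pmf G') = m" by (simp add: m_def)
      have mk: "m \<le> k" using G by (simp add: m_def mixing_le_def)
      have fin: "finite (set_pmf G)" "finite (set_pmf G')" using G G'm by (auto simp: mixing_le_def)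
      have p: "\<bar>pmf G (en G j) - pmf G' (en G' j)\<bar> \<le> h" if "j < m" for j
        using close[of "Some (j, None)"] that mk m' by (simp add: idx_def v_def m_def)
      have t: "norm (en G j - en G' j) \<le> Dm * h" if "j < m" for j
        unfolding Dm_def
      proof (rule norm_le_coordinates)
        fix b :: "'d param" assume "b \<in> Basis"
        then show "\<bar>(en G j - en G' j) \<bullet> b\<bar> \<le> h"
          using close[of "Some (j, Some b)"] that mk m' by (simp add: idx_def v_def m_def inner_diff_left)
      qed
      have "\<bar>mixture_density G x - mixture_density G' x\<bar> \<le> L * h * env x" for x
      proof -
        have e1: "mixture_density G x = (\<Sum>j<m. pmf G (en G j) * gaussian_density (en G j) x)"
          unfolding mixture_density_sum[OF fin(1)] m_def by (rule sum.reindex_bij_betw[OF en[OF G], symmetric])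
        have e2: "mixture_density G' x = (\<Sum>j<m. pmf G' (en G' j) * gaussian_density (en G' j) x)"
          unfolding mixture_density_sum[OF fin(2)] m'[symmetric] by (rule sum.reindex_bij_betw[OF en[OF G'm], symmetric])
        have "\<bar>mixture_density G x - mixture_density G' x\<bar>
            \<le> (\<Sum>j<m. \<bar>pmf G (en G j) * gaussian_density (en G j) x - pmf G' (en G' j) * gaussian_density (en G' j) x\<bar>)"
          unfolding e1 e2 sum_subtractf[symmetric] by (rule sum_abs)
        also have "\<dots> \<le> (\<Sum>j<m. (C + C * Dm) * h * env x)"
        proof (rule sum_mono)
          fix j assume "j \<in> {..<m}"
          then have j: "j < m" by simp
          have T: "en G j \<in> \<Theta>" "en G' j \<in> \<Theta>" using enT(2)[OF G] enT(2)[OF G'm] j m' by (auto simp: m_def)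
          have "pmf G (en G j) * gaussian_density (en G j) x - pmf G' (en G' j) * gaussian_density (en G' j) x
            = (pmf G (en G j) - pmf G' (en G' j)) * gaussian_density (en G j) x + pmf G' (en G' j) * (gaussian_density (en G j) x - gaussian_density (en G' j) x)"
            by (simp add: algebra_simps)
          also have "\<bar>\<dots>\<bar> \<le> \<bar>pmf G (en G j) - pmf G' (en G' j)\<bar> * \<bar>gaussian_density (en G j) x\<bar> + pmf G' (en G' j) * \<bar>gaussian_density (en G j) x - gaussian_density (en G' j) x\<bar>"
            by (rule order.trans[OF abs_triangle_ineq]) (simp add: abs_mult)
          also have "\<dots> \<le> h * (C * env x) + 1 * (C * norm (en G j - en G' j) * env x)"
            using p[OF j] up[OF T(1)] lip[OF T] pmf_le_1 h C env by (intro add_mono mult_mono) auto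
          also have "\<dots> \<le> h * (C * env x) + 1 * (C * (Dm * h) * env x)"
            using t[OF j] C env by (intro add_left_mono mult_left_mono mult_right_mono) auto
          also have "\<dots> = (C + C * Dm) * h * env x" by (simp add: algebra_simps)
          finally show "\<bar>pmf G (en G j) * gaussian_density (en G j) x - pmf G' (en G' j) * gaussian_density (en G' j) x\<bar> \<le> (C + C * Dm) * h * env x" .
        qed
        also have "\<dots> = real m * (C + C * Dm) * (h * env x)" by simp
        also have "\<dots> \<le> L * (h * env x)"
        proof (rule mult_right_mono)
          have "real m * (C + C * Dm) \<le> real k * (C + C * Dm)" using mk C by (intro mult_right_mono) (auto simp: Dm_def)
          then show "real m * (C + C * Dm) \<le> L" by (simp add: L_def)
        qed (use h env in simp)
        finally show ?thesis by (simp add: mult.assoc)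
      qed
      then show ?thesis using G' by blast
    qed
    moreover have "real (card N) \<le> A * (1 / h) ^ D" using N(3) by (simp add: A_def D_def power_divide)
    ultimately show ?thesis using N(1,2) by (intro exI[of _ N] conjI ballI)
  qed
  show ?thesis
    by (rule exI[of _ A], rule conjI[OF A], rule exI[of _ D], rule exI[of _ L], rule conjI[OF L], intro allI impI, rule net)
qed

section \<open>Affinity and large deviations of products\<close>

lemma product_markov:
  fixes g :: "'a \<Rightarrow> real" and P :: "'a measure"
  assumes P: "prob_space P" and g [measurable]: "g \<in> borel_measurable P" and g0: "\<And>x. x \<in> space P \<Longrightarrow> 0 \<le> g x"
    and a: "(\<integral>\<^sup>+x. ennreal (g x) \<partial>P) \<le> ennreal a" and a0: "0 \<le> a" and t: "0 < t"
  shows "{x \<in> space (\<Pi>\<^sub>M i\<in>{1..n}. P). t \<le> (\<Prod>i = 1..n. g (x i))} \<in> sets (\<Pi>\<^sub>M i\<in>{1..n}. P)"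
    and "measure (\<Pi>\<^sub>M i\<in>{1..n}. P) {x \<in> space (\<Pi>\<^sub>M i\<in>{1..n}. P). t \<le> (\<Prod>i = 1..n. g (x i))} \<le> a ^ n / t"
proof -
  interpret P: prob_space P by fact
  interpret PP: product_prob_space "\<lambda>_::nat. P" "{1..n}" by standard
  define M where "M = (\<Pi>\<^sub>M i\<in>{1..n}. P)"
  interpret M: prob_space M unfolding M_def by (rule PP.P.prob_space_axioms)
  have pm [measurable]: "(\<lambda>x. \<Prod>i = 1..n. g (x i)) \<in> borel_measurable M" unfolding M_def by measurable
  have pe: "(\<lambda>x. ennreal (\<Prod>i = 1..n. g (x i))) \<in> borel_measurable M" using pm by (rule measurable_compose) simp
  define S where "S = {x \<in> space M. t \<le> (\<Prod>i = 1..n. g (x i))}"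
  show S: "{x \<in> space (\<Pi>\<^sub>M i\<in>{1..n}. P). t \<le> (\<Prod>i = 1..n. g (x i))} \<in> sets (\<Pi>\<^sub>M i\<in>{1..n}. P)"
    unfolding M_def[symmetric] by measurable
  have sp: "x i \<in> space P" if "x \<in> space M" "i \<in> {1..n}" for x i
    using that by (auto simp: M_def space_PiM)
  have "(\<integral>\<^sup>+x. ennreal (\<Prod>i = 1..n. g (x i)) \<partial>M) = (\<integral>\<^sup>+x. (\<Prod>i = 1..n. ennreal (g (x i))) \<partial>M)"
    by (intro nn_integral_cong prod_ennreal[symmetric] g0 sp)
  also have "\<dots> = (\<Prod>i = 1..n. \<integral>\<^sup>+x. ennreal (g x) \<partial>P)"
    unfolding M_def by (rule PP.product_nn_integral_prod) auto
  also have "\<dots> \<le> ennreal (a ^ n)"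
    using a a0 by (simp add: power_mono flip: ennreal_power)
  finally have int: "(\<integral>\<^sup>+x. ennreal (\<Prod>i = 1..n. g (x i)) \<partial>M) \<le> ennreal (a ^ n)" .
  have "emeasure M S = emeasure M {x \<in> space M. 1 \<le> ennreal (1 / t) * ennreal (\<Prod>i = 1..n. g (x i))}"
  proof (intro arg_cong[where f = "emeasure M"] set_eqI)
    fix x
    have "t \<le> (\<Prod>i = 1..n. g (x i)) \<longleftrightarrow> 1 \<le> ennreal (1 / t) * ennreal (\<Prod>i = 1..n. g (x i))" if x: "x \<in> space M"
    proof -
      have "0 \<le> (\<Prod>i = 1..n. g (x i))" by (intro prod_nonneg g0 sp x)
      then have "ennreal (1 / t) * ennreal (\<Prod>i = 1..n. g (x i)) = ennreal (1 / t * (\<Prod>i = 1..n. g (x i)))"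
        using t by (intro ennreal_mult[symmetric]) auto
      then show ?thesis using t by (simp add: field_simps)
    qed
    then show "x \<in> S \<longleftrightarrow> x \<in> {x \<in> space M. 1 \<le> ennreal (1 / t) * ennreal (\<Prod>i = 1..n. g (x i))}"
      by (auto simp: S_def)
  qed
  also have "\<dots> \<le> ennreal (1 / t) * (\<integral>\<^sup>+x. ennreal (\<Prod>i = 1..n. g (x i)) * indicator (space M) x \<partial>M)"
    by (rule nn_integral_Markov_inequality) (intro borel_measurable_times_ennreal pe borel_measurable_indicator sets.top, rule sets.top)
  also have "\<dots> \<le> ennreal (1 / t) * ennreal (a ^ n)"
    using int by (intro mult_left_mono) (auto simp: nn_integral_cong[of M "\<lambda>x. ennreal (\<Prod>i = 1..n. g (x i)) * indicator (space M) x" "\<lambda>x. ennreal (\<Prod>i = 1..n. g (x i))"])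
  also have "\<dots> = ennreal (a ^ n / t)" using a0 t by (simp flip: ennreal_mult)
  finally have "emeasure M S \<le> ennreal (a ^ n / t)" .
  then show "measure (\<Pi>\<^sub>M i\<in>{1..n}. P) {x \<in> space (\<Pi>\<^sub>M i\<in>{1..n}. P). t \<le> (\<Prod>i = 1..n. g (x i))} \<le> a ^ n / t"
    unfolding M_def[symmetric] S_def[symmetric] using a0 t
    by (simp add: M.emeasure_eq_measure)
qed

text \<open>Cauchy--Schwarz for \<open>\<bar>p - q\<bar> = \<bar>\<surd>p - \<surd>q\<bar> (\<surd>p + \<surd>q)\<close>.\<close>

lemma affinity_le:
  fixes p q :: "'a \<Rightarrow> real"
  assumes p: "has_bochner_integral M p 1" and q: "has_bochner_integral M q 1"
    and nonneg: "\<And>x. 0 \<le> p x" "\<And>x. 0 \<le> q x"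
  shows "integrable M (\<lambda>x. sqrt (p x * q x))"
    and "(\<integral>x. sqrt (p x * q x) \<partial>M) \<le> 1 - (\<integral>x. \<bar>p x - q x\<bar> \<partial>M)\<^sup>2 / 8"
proof -
  note ip = p[THEN integrable.intros] and iq = q[THEN integrable.intros]
  have vp: "(\<integral>x. p x \<partial>M) = 1" and vq: "(\<integral>x. q x \<partial>M) = 1" using p q by (auto simp: has_bochner_integral_iff)
  have [measurable]: "p \<in> borel_measurable M" "q \<in> borel_measurable M" using ip iq by auto
  have am: "sqrt (p x * q x) \<le> (p x + q x) / 2" for x
    using arith_geo_mean_sqrt[OF nonneg(1) nonneg(2)] .
  show isq: "integrable M (\<lambda>x. sqrt (p x * q x))"
    by (rule Bochner_Integration.integrable_bound[of M "\<lambda>x. (p x + q x) / 2"])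
       (use ip iq am nonneg in \<open>auto intro!: order.trans[OF am]\<close>)
  define u where "u x = \<bar>sqrt (p x) - sqrt (q x)\<bar>" for x
  define w where "w x = sqrt (p x) + sqrt (q x)" for x
  have uw: "\<bar>p x - q x\<bar> = u x * w x" for x
  proof -
    have "p x - q x = (sqrt (p x) - sqrt (q x)) * (sqrt (p x) + sqrt (q x))"
      using nonneg[of x] by (simp add: algebra_simps)
    then show ?thesis using nonneg[of x] by (simp add: u_def w_def abs_mult)
  qed
  have u2: "(u x)\<^sup>2 = p x + q x - 2 * sqrt (p x * q x)" and w2: "(w x)\<^sup>2 = p x + q x + 2 * sqrt (p x * q x)" for x
    using nonneg[of x] by (simp_all add: u_def w_def power2_diff power2_sum real_sqrt_mult)
  define a where "a = (\<integral>x. sqrt (p x * q x) \<partial>M)"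
  have iu: "integrable M (\<lambda>x. (u x)\<^sup>2)" "(\<integral>x. (u x)\<^sup>2 \<partial>M) = 2 - 2 * a"
    and iw: "integrable M (\<lambda>x. (w x)\<^sup>2)" "(\<integral>x. (w x)\<^sup>2 \<partial>M) = 2 + 2 * a"
    unfolding u2 w2 a_def using ip iq isq vp vq by simp_all
  have a1: "a \<le> 1"
  proof -
    have "0 \<le> (\<integral>x. (u x)\<^sup>2 \<partial>M)" by (rule integral_nonneg_AE) simp
    then show ?thesis using iu by simp
  qed
  have iuw: "integrable M (\<lambda>x. u x * w x)"
    unfolding uw[symmetric] using ip iq by (intro integrable_abs Bochner_Integration.integrable_diff)
  define V where "V = (\<integral>x. u x * w x \<partial>M)"
  \<comment> \<open>Cauchy-Schwarz in the form of a nonnegative quadratic in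
    \<open>s\<close>.\<close>
  have quad: "0 \<le> (2 - 2 * a) - 2 * s * V + s\<^sup>2 * (2 + 2 * a)" for s
  proof -
    have "0 \<le> (\<integral>x. (u x - s * w x)\<^sup>2 \<partial>M)" by (rule integral_nonneg_AE) simp
    also have "(\<lambda>x. (u x - s * w x)\<^sup>2) = (\<lambda>x. (u x)\<^sup>2 - 2 * s * (u x * w x) + s\<^sup>2 * (w x)\<^sup>2)"
      by (auto simp: power2_eq_square algebra_simps)
    also have "(\<integral>x. (u x)\<^sup>2 - 2 * s * (u x * w x) + s\<^sup>2 * (w x)\<^sup>2 \<partial>M) = (2 - 2 * a) - 2 * s * V + s\<^sup>2 * (2 + 2 * a)"
      using iu iw iuw by (simp add: V_def)
    finally show ?thesis .
  qed
  \<comment> \<open>s = V/4 minimizes the quadratic once 2 + 2 a is replaced by its bound 4.\<close>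
  have "0 \<le> (2 - 2 * a) - 2 * (V / 4) * V + (V / 4)\<^sup>2 * (2 + 2 * a)" by (rule quad)
  also have "\<dots> \<le> (2 - 2 * a) - 2 * (V / 4) * V + (V / 4)\<^sup>2 * 4" using a1 by (intro add_left_mono mult_left_mono) auto
  finally have "a \<le> 1 - V\<^sup>2 / 8" by (simp add: power2_eq_square)
  then show "(\<integral>x. sqrt (p x * q x) \<partial>M) \<le> 1 - (\<integral>x. \<bar>p x - q x\<bar> \<partial>M)\<^sup>2 / 8"
    unfolding a_def V_def uw .
qed

lemma mixture_cf_diff_le:
  fixes G G0 :: "'d::finite param pmf"
  assumes "finite (set_pmf G)" "\<And>\<theta>. \<theta> \<in> set_pmf G \<Longrightarrow> snd \<theta> \<in> pos_def_mats"
    "finite (set_pmf G0)" "\<And>\<theta>. \<theta> \<in> set_pmf G0 \<Longrightarrow> snd \<theta> \<in> pos_def_mats"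
  shows "norm (mixture_cf G t - mixture_cf G0 t) \<le> (\<integral>x. \<bar>mixture_density G x - mixture_density G0 x\<bar> \<partial>lborel)"
proof -
  let ?e = "\<lambda>x. exp (\<i> * complex_of_real (t \<bullet> x))"
  have 1: "has_bochner_integral lborel (\<lambda>x. complex_of_real (mixture_density G x) * ?e x - complex_of_real (mixture_density G0 x) * ?e x)
     (mixture_cf G t - mixture_cf G0 t)"
    using assms by (intro has_bochner_integral_diff has_bochner_integral_mixture)
  then have "mixture_cf G t - mixture_cf G0 t = (\<integral>x. complex_of_real (mixture_density G x - mixture_density G0 x) * ?e x \<partial>lborel)"
    by (simp add: has_bochner_integral_iff left_diff_distrib)
  also have "norm \<dots> \<le> (\<integral>x. norm (complex_of_real (mixture_density G x - mixture_density G0 x) * ?e x) \<partial>lborel)"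
    by (rule integral_norm_bound)
  also have "\<dots> = (\<integral>x. \<bar>mixture_density G x - mixture_density G0 x\<bar> \<partial>lborel)"
    by (simp add: norm_mult flip: of_real_diff)
  finally show ?thesis .
qed

section \<open>The penalty and the union bound\<close>

lemma one_plus_power_le_exp:
  fixes y :: real
  assumes "0 \<le> 1 + y"
  shows "(1 + y) ^ n \<le> exp (real n * y)"
  using power_mono[OF exp_ge_add_one_self assms, of n] by (simp add: exp_of_nat_mult)

lemma measure_finite_UN_le:
  assumes "finite I" "\<And>i. i \<in> I \<Longrightarrow> A i \<in> sets M" "\<And>i. i \<in> I \<Longrightarrow> measure M (A i) \<le> b" "finite_measure M"
  shows "measure M (\<Union>i\<in>I. A i) \<le> real (card I) * b"
proof -
  interpret finite_measure M by fact
  have "measure M (\<Union>i\<in>I. A i) \<le> (\<Sum>i\<in>I. measure M (A i))"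
    using assms by (intro finite_measure_subadditive_finite) auto
  also have "\<dots> \<le> real (card I) * b" using assms by (intro sum_bounded_above) auto
  finally show ?thesis .
qed

lemma prod_ratio_ge_iff:
  fixes p q :: "'a \<Rightarrow> real"
  assumes "\<And>i. i \<in> I \<Longrightarrow> 0 < p i \<and> 0 < q i"
  shows "(\<Prod>i\<in>I. p i / q i) = exp (\<Sum>i\<in>I. ln (p i) - ln (q i))"
proof (cases "finite I")
  case True
  have "(\<Prod>i\<in>I. p i / q i) = (\<Prod>i\<in>I. exp (ln (p i) - ln (q i)))"
    using assms by (intro prod.cong) (auto simp: exp_diff)
  then show ?thesis using True by (simp add: exp_sum)
qed simp

lemma penalty_nonpos: "penalty G \<le> 0"
  unfolding penalty_def by (intro sum_nonpos) (auto simp: pmf_le_1 pmf_positive)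

text \<open>All summands of the penalty are nonpositive, so each is at least the total: a bound on
  the penalty bounds every weight.\<close>

lemma pmf_ge_exp_penalty:
  assumes "finite (set_pmf G)" "\<theta> \<in> set_pmf G"
  shows "exp (penalty G) \<le> pmf G \<theta>"
proof -
  have "penalty G = ln (pmf G \<theta>) + (\<Sum>\<theta>\<in>set_pmf G - {\<theta>}. ln (pmf G \<theta>))"
    unfolding penalty_def using assms by (subst sum.remove) auto
  also have "(\<Sum>\<theta>\<in>set_pmf G - {\<theta>}. ln (pmf G \<theta>)) \<le> 0"
    by (intro sum_nonpos) (auto simp: pmf_le_1 pmf_positive)
  finally have "exp (penalty G) \<le> exp (ln (pmf G \<theta>))" by simp
  then show ?thesis using assms(2) by (simp add: pmf_positive)
qed

section \<open>The sampling measure and exceptional events of upper brackets\<close>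

lemma prob_space_mixture:
  fixes G :: "'d::finite param pmf"
  assumes G: "finite (set_pmf G)" "\<And>\<theta>. \<theta> \<in> set_pmf G \<Longrightarrow> snd \<theta> \<in> pos_def_mats"
  shows "prob_space (density lborel (\<lambda>x. ennreal (mixture_density G x)))"
proof
  have hp: "has_bochner_integral lborel (mixture_density G) 1" using G by (rule has_bochner_integral_mixture)
  have p0: "0 \<le> mixture_density G x" for x using mixture_density_pos[of G x] G by (simp add: less_imp_le)
  have [measurable]: "mixture_density G \<in> borel_measurable borel" using hp by (auto simp: has_bochner_integral_iff)
  have "emeasure (density lborel (\<lambda>x. ennreal (mixture_density G x))) (space (density lborel (\<lambda>x. ennreal (mixture_density G x))))
      = (\<integral>\<^sup>+x. ennreal (mixture_density G x) \<partial>lborel)"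
    by (subst emeasure_density) auto
  also have "\<dots> = ennreal 1"
    using hp p0 by (subst nn_integral_eq_integral) (auto simp: has_bochner_integral_iff)
  finally show "emeasure (density lborel (\<lambda>x. ennreal (mixture_density G x))) (space (density lborel (\<lambda>x. ennreal (mixture_density G x)))) = 1"
    by simp
qed

lemma prob_space_sample_measure:
  fixes G :: "'d::finite param pmf"
  assumes "finite (set_pmf G)" "\<And>\<theta>. \<theta> \<in> set_pmf G \<Longrightarrow> snd \<theta> \<in> pos_def_mats"
  shows "prob_space (sample_measure G n)"
  unfolding sample_measure_def by (intro prob_space_PiM prob_space_mixture assms)

text \<open>\<open>U\<close> dominates every mixture near \<open>G'\<close> but has mass 1 plus a
  small error. The first event uses the mean of U / p, the second that of its square root: the
  affinity plus an error, for which \<open>G0\<close> has to be dominated by the envelope. The last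
  claim permits the bound of the power by an exponential.\<close>

lemma upper_bracket_events:
  fixes G0 G' :: "'d::finite param pmf" and env :: "real^'d \<Rightarrow> real" and n :: nat
  assumes supp: "finite (set_pmf G0)" "snd ` set_pmf G0 \<subseteq> pos_def_mats"
      "finite (set_pmf G')" "snd ` set_pmf G' \<subseteq> pos_def_mats"
    and env: "\<And>x. 0 \<le> env x" and ienv: "integrable lborel env" and C: "0 \<le> C" "\<And>x. mixture_density G0 x \<le> C * env x"
    and \<eta>: "0 \<le> \<eta>" and t: "0 < t"
  defines "U \<equiv> \<lambda>x. mixture_density G' x + \<eta> * env x"
  defines "M \<equiv> sample_measure G0 n"
  shows "{x \<in> space M. t \<le> (\<Prod>i = 1..n. U (x i) / mixture_density G0 (x i))} \<in> sets M" (is "?A \<in> _")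
    and "measure M {x \<in> space M. t \<le> (\<Prod>i = 1..n. U (x i) / mixture_density G0 (x i))} \<le> (1 + \<eta> * integral\<^sup>L lborel env) ^ n / t"
    and "{x \<in> space M. t \<le> (\<Prod>i = 1..n. sqrt (U (x i) / mixture_density G0 (x i)))} \<in> sets M"
    and "measure M {x \<in> space M. t \<le> (\<Prod>i = 1..n. sqrt (U (x i) / mixture_density G0 (x i)))}
       \<le> (1 - (\<integral>x. \<bar>mixture_density G' x - mixture_density G0 x\<bar> \<partial>lborel)\<^sup>2 / 8 + sqrt (\<eta> * C) * integral\<^sup>L lborel env) ^ n / t"
    and "0 \<le> 1 - (\<integral>x. \<bar>mixture_density G' x - mixture_density G0 x\<bar> \<partial>lborel)\<^sup>2 / 8 + sqrt (\<eta> * C) * integral\<^sup>L lborel env"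
proof -
  have G0: "finite (set_pmf G0)" "\<And>\<theta>. \<theta> \<in> set_pmf G0 \<Longrightarrow> snd \<theta> \<in> pos_def_mats"
    and G': "finite (set_pmf G')" "\<And>\<theta>. \<theta> \<in> set_pmf G' \<Longrightarrow> snd \<theta> \<in> pos_def_mats"
    using supp by auto
  let ?p = "mixture_density G0" and ?q = "mixture_density G'"
  note hp = has_bochner_integral_mixture(1)[OF G0] and hq = has_bochner_integral_mixture(1)[OF G']
  have p0: "0 < ?p x" and q0: "0 < ?q x" for x
    using mixture_density_pos[of G0 x] mixture_density_pos[of G' x] G0 G' by auto
  have [measurable]: "?p \<in> borel_measurable borel" "?q \<in> borel_measurable borel" "env \<in> borel_measurable borel"
    using hp hq ienv by (auto simp: has_bochner_integral_iff)
  have [measurable]: "U \<in> borel_measurable borel" unfolding U_def by measurable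
  have U0: "0 < U x" for x using q0[of x] env[of x] \<eta> by (simp add: U_def add_pos_nonneg)
  define P where "P = density lborel (\<lambda>x. ennreal (?p x))"
  have sP: "sets P = sets borel" "space P = UNIV" by (simp_all add: P_def)
  have P: "prob_space P" unfolding P_def by (rule prob_space_mixture[OF G0])
  have M: "M = (\<Pi>\<^sub>M i\<in>{1..n}. P)" by (simp add: M_def sample_measure_def P_def)
  have int: "(\<integral>\<^sup>+x. ennreal (f x) \<partial>P) = (\<integral>\<^sup>+x. ennreal (f x * ?p x) \<partial>lborel)" if [measurable]: "f \<in> borel_measurable borel" and "\<And>x. 0 \<le> f x" for f
    unfolding P_def using that p0 by (subst nn_integral_density) (auto simp: ennreal_mult less_imp_le mult.commute intro!: nn_integral_cong)
  have I0: "0 \<le> integral\<^sup>L lborel env" using env by (simp add: integral_nonneg_AE)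
  have int1: "(\<integral>\<^sup>+x. ennreal (U x / ?p x) \<partial>P) \<le> ennreal (1 + \<eta> * integral\<^sup>L lborel env)"
  proof -
    have "(\<integral>\<^sup>+x. ennreal (U x / ?p x) \<partial>P) = (\<integral>\<^sup>+x. ennreal (U x) \<partial>lborel)"
      using U0 p0 by (subst int) (auto simp: less_imp_le less_imp_neq[symmetric] intro!: nn_integral_cong)
    also have "\<dots> = ennreal (\<integral>x. U x \<partial>lborel)"
      using hq ienv U0 by (intro nn_integral_eq_integral) (auto simp: U_def[abs_def] has_bochner_integral_iff less_imp_le)
    also have "(\<integral>x. U x \<partial>lborel) = 1 + \<eta> * integral\<^sup>L lborel env"
      unfolding U_def using hq ienv by (simp add: has_bochner_integral_iff)
    finally show ?thesis by simp
  qed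
  have m1: "(\<lambda>x. U x / ?p x) \<in> borel_measurable P" "(\<lambda>x. sqrt (U x / ?p x)) \<in> borel_measurable P"
    by (simp_all add: P_def)
  have n1: "0 \<le> U x / ?p x" for x using U0[of x] p0[of x] by simp
  have a0: "0 \<le> 1 + \<eta> * integral\<^sup>L lborel env" using \<eta> I0 by simp
  show "{x \<in> space M. t \<le> (\<Prod>i = 1..n. U (x i) / mixture_density G0 (x i))} \<in> sets M"
    unfolding M by (rule product_markov(1)[OF P m1(1) n1 int1 a0 t])
  show "measure M {x \<in> space M. t \<le> (\<Prod>i = 1..n. U (x i) / mixture_density G0 (x i))} \<le> (1 + \<eta> * integral\<^sup>L lborel env) ^ n / t"
    unfolding M by (rule product_markov(2)[OF P m1(1) n1 int1 a0 t])
  define b where "b = 1 - (\<integral>x. \<bar>?q x - ?p x\<bar> \<partial>lborel)\<^sup>2 / 8 + sqrt (\<eta> * C) * integral\<^sup>L lborel env"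
  note aff = affinity_le[OF hq hp less_imp_le[OF q0] less_imp_le[OF p0]]
  have b0: "0 \<le> b"
  proof -
    have "0 \<le> (\<integral>x. sqrt (?q x * ?p x) \<partial>lborel)" using p0 q0 by (intro integral_nonneg_AE) (auto simp: less_imp_le)
    moreover have "0 \<le> sqrt (\<eta> * C) * integral\<^sup>L lborel env" using I0 \<eta> C by simp
    ultimately show ?thesis using aff(2) unfolding b_def by linarith
  qed
  have int2: "(\<integral>\<^sup>+x. ennreal (sqrt (U x / ?p x)) \<partial>P) \<le> ennreal b"
  proof -
    have "(\<integral>\<^sup>+x. ennreal (sqrt (U x / ?p x)) \<partial>P) = (\<integral>\<^sup>+x. ennreal (sqrt (U x / ?p x) * ?p x) \<partial>lborel)"
      using n1 by (intro int) auto
    also have "\<dots> \<le> (\<integral>\<^sup>+x. ennreal (sqrt (?q x * ?p x) + sqrt (\<eta> * C) * env x) \<partial>lborel)"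
    proof (intro nn_integral_mono ennreal_leI)
      fix x
      have "sqrt (U x / ?p x) * ?p x = sqrt (U x * ?p x)"
      proof -
        have "sqrt (U x / ?p x) * ?p x = sqrt (U x / ?p x) * sqrt (?p x * ?p x)" using p0[of x] by simp
        also have "\<dots> = sqrt (U x * ?p x)" using p0[of x] by (subst real_sqrt_mult[symmetric]) simp
        finally show ?thesis .
      qed
      also have "U x * ?p x \<le> ?q x * ?p x + \<eta> * C * (env x * env x)"
      proof -
        have "\<eta> * env x * ?p x \<le> \<eta> * env x * (C * env x)" using \<eta> env C(2) by (intro mult_left_mono) auto
        then show ?thesis by (simp add: U_def algebra_simps)
      qed
      then have "sqrt (U x * ?p x) \<le> sqrt (?q x * ?p x + \<eta> * C * (env x * env x))" by simp
      also have "\<dots> \<le> sqrt (?q x * ?p x) + sqrt (\<eta> * C * (env x * env x))"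
        using p0[of x] q0[of x] \<eta> C env[of x] by (intro sqrt_add_le_add_sqrt) auto
      also have "sqrt (\<eta> * C * (env x * env x)) = sqrt (\<eta> * C) * env x" using env[of x] by (simp add: real_sqrt_mult)
      finally show "sqrt (U x / ?p x) * ?p x \<le> sqrt (?q x * ?p x) + sqrt (\<eta> * C) * env x" .
    qed
    also have "\<dots> = ennreal (\<integral>x. sqrt (?q x * ?p x) + sqrt (\<eta> * C) * env x \<partial>lborel)"
      using aff(1) ienv p0 q0 \<eta> C env by (intro nn_integral_eq_integral) (auto simp: less_imp_le)
    also have "(\<integral>x. sqrt (?q x * ?p x) + sqrt (\<eta> * C) * env x \<partial>lborel) \<le> b"
      using aff ienv by (simp add: b_def)
    finally show ?thesis by (simp add: ennreal_leI)
  qed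
  have n2: "0 \<le> sqrt (U x / ?p x)" for x using n1 by simp
  show "{x \<in> space M. t \<le> (\<Prod>i = 1..n. sqrt (U (x i) / mixture_density G0 (x i)))} \<in> sets M"
    unfolding M by (rule product_markov(1)[OF P m1(2) n2 int2 b0 t])
  show "measure M {x \<in> space M. t \<le> (\<Prod>i = 1..n. sqrt (U (x i) / mixture_density G0 (x i)))}
       \<le> (1 - (\<integral>x. \<bar>mixture_density G' x - mixture_density G0 x\<bar> \<partial>lborel)\<^sup>2 / 8 + sqrt (\<eta> * C) * integral\<^sup>L lborel env) ^ n / t"
    unfolding M b_def[symmetric] by (rule product_markov(2)[OF P m1(2) n2 int2 b0 t])
  show "0 \<le> 1 - (\<integral>x. \<bar>mixture_density G' x - mixture_density G0 x\<bar> \<partial>lborel)\<^sup>2 / 8 + sqrt (\<eta> * C) * integral\<^sup>L lborel env"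
    using b0 by (simp add: b_def)
qed

section \<open>The rate of convergence\<close>

lemma sqrt_prod: "sqrt (prod f I) = (\<Prod>i\<in>I. sqrt (f i))"
  by (induction I rule: infinite_finite_induct) (simp_all add: real_sqrt_mult)

text \<open>Both sqrt (log n / n) and 1/n are absorbed into log n / sqrt n because log n is at least
  log 2.\<close>

lemma rate_bounds:
  assumes n: "2 \<le> n" and K: "0 \<le> K"
  shows "sqrt (8 * K * ln (real n) / real n) \<le> sqrt (8 * K) / sqrt (ln 2) * (ln (real n) / sqrt (real n))"
    and "1 / real n \<le> 1 / ln 2 * (ln (real n) / sqrt (real n))"
proof -
  have ln: "ln 2 \<le> ln (real n)" using n by simp
  have l2: "0 < ln (2::real)" by simp
  have l0: "0 \<le> ln (real n)" using n by simp
  have s: "0 < sqrt (real n)" using n by simp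
  have "sqrt (ln (real n)) * sqrt (ln 2) \<le> sqrt (ln (real n)) * sqrt (ln (real n))"
    using ln l0 by (intro mult_left_mono) auto
  also have "\<dots> = ln (real n)" using l0 by simp
  finally have "sqrt (ln (real n)) \<le> ln (real n) / sqrt (ln 2)" by (simp add: field_simps)
  then have "sqrt (8 * K) / sqrt (real n) * sqrt (ln (real n)) \<le> sqrt (8 * K) / sqrt (real n) * (ln (real n) / sqrt (ln 2))"
    using K s by (intro mult_left_mono) auto
  then show "sqrt (8 * K * ln (real n) / real n) \<le> sqrt (8 * K) / sqrt (ln 2) * (ln (real n) / sqrt (real n))"
    by (simp add: real_sqrt_mult real_sqrt_divide mult_ac)
  have "sqrt (real n) * 1 \<le> sqrt (real n) * sqrt (real n)" using n by (intro mult_left_mono) auto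
  then have "1 / real n \<le> 1 / sqrt (real n)" using s n by (simp add: frac_le)
  also have "\<dots> \<le> 1 / ln 2 * (ln (real n) / sqrt (real n))" using ln l2 s by (simp add: field_simps)
  finally show "1 / real n \<le> 1 / ln 2 * (ln (real n) / sqrt (real n))" .
qed

text \<open>The event is uniform over all \<open>G\<close> that score at least as well as
  \<open>G0\<close>, and is a finite union of bracket events. Hence no measurability of the
  estimator enters. On it the log-likelihood ratio S satisfies S < d log n, which bounds the penalty
  below, while the comparison with \<open>G0\<close> gives S >= \<open>\<rho>\<close> log n, which
  excludes large L1 distances.\<close>

lemma penalized_mle_good_event:
  fixes \<Theta> :: "'d::finite param set"
  assumes \<Theta>: "compact \<Theta>" "snd ` \<Theta> \<subseteq> pos_def_mats" and G0: "G0 \<in> mixing_le k \<Theta>"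
  shows "\<exists>A>0. \<exists>w>0. \<forall>n\<ge>2. \<exists>Bad\<in>sets (sample_measure G0 n). measure (sample_measure G0 n) Bad \<le> A / real n \<and>
    (\<forall>x\<in>space (sample_measure G0 n) - Bad. \<forall>G\<in>mixing_le k \<Theta>.
       penalized_loglik (ln (real n)) n x G0 \<le> penalized_loglik (ln (real n)) n x G \<longrightarrow>
       (\<forall>\<theta>\<in>set_pmf G. w \<le> pmf G \<theta>) \<and> (\<forall>t. norm (mixture_cf G t - mixture_cf G0 t) \<le> A * (ln (real n) / sqrt (real n))))"
proof -
  have mix: "finite (set_pmf G)" "\<theta> \<in> set_pmf G \<Longrightarrow> snd \<theta> \<in> pos_def_mats" if "G \<in> mixing_le k \<Theta>" for G \<theta>
    using that \<Theta>(2) by (auto simp: mixing_le_def)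
  from gaussian_lipschitz[OF \<Theta>] obtain C c where C: "C > 0" and c: "c > 0" and
    lip0: "\<forall>\<theta>\<in>\<Theta>. \<forall>x. gaussian_density \<theta> x \<le> C * gaussian_envelope c x \<and>
    (\<forall>\<theta>'\<in>\<Theta>. \<bar>gaussian_density \<theta> x - gaussian_density \<theta>' x\<bar> \<le> C * norm (\<theta> - \<theta>') * gaussian_envelope c x)"
    by (elim exE conjE)
  define env where "env = (gaussian_envelope c :: real^'d \<Rightarrow> real)"
  have env: "0 \<le> env x" for x by (simp add: env_def gaussian_envelope_def)
  have ienv: "integrable lborel env" unfolding env_def by (rule integrable_gaussian_envelope[OF c])
  have up: "\<bar>gaussian_density \<theta> x\<bar> \<le> C * env x" if "\<theta> \<in> \<Theta>" for \<theta> x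
    using lip0 that \<Theta>(2) gaussian_density_pos[of \<theta> x] by (auto simp: env_def image_subset_iff)
  have up': "gaussian_density \<theta> x \<le> C * env x" if "\<theta> \<in> \<Theta>" for \<theta> x using up[OF that, of x] by linarith
  have lip: "\<bar>gaussian_density \<theta> x - gaussian_density \<theta>' x\<bar> \<le> C * norm (\<theta> - \<theta>') * env x" if "\<theta> \<in> \<Theta>" "\<theta>' \<in> \<Theta>" for \<theta> \<theta>' x
    using lip0 that by (auto simp: env_def)
  have "\<exists>A>0. \<exists>D L. L > 0 \<and> (\<forall>h. 0 < h \<longrightarrow> h \<le> 1 \<longrightarrow> (\<exists>N. finite N \<and> N \<subseteq> mixing_le k \<Theta> \<and> real (card N) \<le> A * (1 / h) ^ D \<and>
     (\<forall>G\<in>mixing_le k \<Theta>. \<exists>G'\<in>N. \<forall>x. \<bar>mixture_density G x - mixture_density G' x\<bar> \<le> L * h * env x)))"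
    using compact_imp_bounded[OF \<Theta>(1)] C up lip env by (rule mixture_net)
  then obtain A0 D L where A0: "A0 > 0" and L: "L > 0" and
    net: "\<forall>h. 0 < h \<longrightarrow> h \<le> 1 \<longrightarrow> (\<exists>N. finite N \<and> N \<subseteq> mixing_le k \<Theta> \<and> real (card N) \<le> A0 * (1 / h) ^ D \<and>
     (\<forall>G\<in>mixing_le k \<Theta>. \<exists>G'\<in>N. \<forall>x. \<bar>mixture_density G x - mixture_density G' x\<bar> \<le> L * h * env x))"
    by (elim exE conjE)
  have p0C: "mixture_density G0 x \<le> C * env x" for x
  proof -
    have "mixture_density G0 x \<le> (\<Sum>\<theta>\<in>set_pmf G0. pmf G0 \<theta> * (C * env x))"
      unfolding mixture_density_sum[OF mix(1)[OF G0]] using G0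
      by (intro sum_mono mult_left_mono up') (auto simp: mixing_le_def)
    also have "\<dots> = (\<Sum>\<theta>\<in>set_pmf G0. pmf G0 \<theta>) * (C * env x)" by (simp only: sum_distrib_right)
    also have "(\<Sum>\<theta>\<in>set_pmf G0. pmf G0 \<theta>) = 1" using mix(1)[OF G0] by (intro sum_pmf_eq_1) auto
    finally show ?thesis by simp
  qed
  define J where "J = integral\<^sup>L lborel env"
  have J0: "0 \<le> J" unfolding J_def using env by (simp add: integral_nonneg_AE)
  \<comment> \<open>Dominates the three constants in the bracket errors, so that the mesh 1 / (n^2
    B) makes each error at most 1/n per observation.\<close>
  define B where "B = 1 + L * J + L * C * J\<^sup>2"
  have B: "1 \<le> B" "L * J \<le> B" "L * C * J\<^sup>2 \<le> B" using L C J0 by (auto simp: B_def)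
  define A1 where "A1 = A0 * B ^ D"
  have A1: "0 < A1" using A0 B by (simp add: A1_def)
  \<comment> \<open>The net has order n^(2 D) elements; a failure probability of order n^(-d) for
    each leaves 1/n after the union bound.\<close>
  define d where "d = 2 * D + 1"
  define \<rho> where "\<rho> = penalty G0"
  have \<rho>: "\<rho> \<le> 0" unfolding \<rho>_def by (rule penalty_nonpos)
  \<comment> \<open>-\<rho>/2 compensates the threshold n^(\<rho>/2) of the square-root product, so
    that this event too has probability at most e / n^d.\<close>
  define K where "K = real d - \<rho> / 2"
  have K: "0 \<le> K" using \<rho> by (simp add: K_def)
  define A2 where "A2 = sqrt (8 * K) / sqrt (ln 2) + 1 / ln 2"
  have A2: "0 < A2" using K by (simp add: A2_def add_nonneg_pos)
  define A where "A = A2 + 2 * exp 1 * A1"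
  have A: "0 < A" "A2 \<le> A" "2 * exp 1 * A1 \<le> A" using A1 A2 by (auto simp: A_def add_pos_pos)
  \<comment> \<open>The common factor log n cancels between likelihood bound and penalty, so this
    bound on the weights is free of \<open>n\<close>.\<close>
  define w where "w = exp (\<rho> - real d)"
  have w: "0 < w" by (simp add: w_def)
  show ?thesis
  proof (rule exI[of _ A], rule conjI[OF A(1)], rule exI[of _ w], rule conjI[OF w], intro allI impI)
    fix n :: nat assume n: "2 \<le> n"
    define M where "M = sample_measure G0 n"
    interpret M: prob_space M unfolding M_def using mix[OF G0] by (rule prob_space_sample_measure)
    have rn: "0 < real n" "1 \<le> real n" using n by auto
    have lnn: "0 < ln (real n)" using n by simp
    \<comment> \<open>The square of \<open>n\<close> is needed because the affinity error is of
      order sqrt \<eta>, and \<eta> is proportional to \<open>h\<close>.\<close>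
    define h where "h = 1 / ((real n)\<^sup>2 * B)"
    have nB: "1 \<le> (real n)\<^sup>2 * B" using rn(2) B(1) mult_mono[of 1 "(real n)\<^sup>2" 1 B] by (simp add: one_le_power)
    have h: "0 < h" "h \<le> 1" using nB by (auto simp: h_def)
    from net h have "\<exists>N. finite N \<and> N \<subseteq> mixing_le k \<Theta> \<and> real (card N) \<le> A0 * (1 / h) ^ D \<and>
     (\<forall>G\<in>mixing_le k \<Theta>. \<exists>G'\<in>N. \<forall>x. \<bar>mixture_density G x - mixture_density G' x\<bar> \<le> L * h * env x)" by simp
    then obtain N where N: "finite N" "N \<subseteq> mixing_le k \<Theta>" and cN: "real (card N) \<le> A0 * (1 / h) ^ D"
      and cover: "\<forall>G\<in>mixing_le k \<Theta>. \<exists>G'\<in>N. \<forall>x. \<bar>mixture_density G x - mixture_density G' x\<bar> \<le> L * h * env x" by (elim exE conjE)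
    define \<eta> where "\<eta> = L * h"
    have \<eta>0: "0 \<le> \<eta>" using L h by (simp add: \<eta>_def)
    have "L * J * h \<le> B * h" using B h by (intro mult_right_mono) auto
    also have Bh: "B * h = 1 / (real n)\<^sup>2" using B by (simp add: h_def)
    finally have "\<eta> * J \<le> 1 / (real n)\<^sup>2" by (simp add: \<eta>_def mult_ac)
    also have "\<dots> \<le> 1 / real n" using rn by (simp add: power2_eq_square field_simps)
    finally have \<eta>J: "\<eta> * J \<le> 1 / real n" .
    have "L * C * J\<^sup>2 * h \<le> B * h" using B h by (intro mult_right_mono) auto
    then have "\<eta> * C * J\<^sup>2 \<le> (1 / real n)\<^sup>2" using Bh by (simp add: \<eta>_def power_divide mult_ac)
    then have "sqrt (\<eta> * C * J\<^sup>2) \<le> 1 / real n" using rn by (intro real_le_lsqrt) auto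
    then have \<eta>CJ: "sqrt (\<eta> * C) * J \<le> 1 / real n" using J0 by (simp add: real_sqrt_mult)
    define U where "U G' x = mixture_density G' x + \<eta> * env x" for G' :: "'d param pmf" and x
    define V where "V G' = (\<integral>x. \<bar>mixture_density G' x - mixture_density G0 x\<bar> \<partial>lborel)" for G'
    define \<tau> where "\<tau> = sqrt (8 * K * ln (real n) / real n)"
    have \<tau>: "0 \<le> \<tau>" "\<tau>\<^sup>2 = 8 * K * ln (real n) / real n" using K lnn rn by (auto simp: \<tau>_def)
    define t1 t2 where "t1 = real n ^ d" and "t2 = exp (ln (real n) * \<rho> / 2)"
    have t1: "0 < t1" "t1 = exp (real d * ln (real n))" using rn by (auto simp: t1_def exp_of_nat_mult)
    have t2: "0 < t2" by (simp add: t2_def)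
    define Bad1 where "Bad1 G' = {x \<in> space M. t1 \<le> (\<Prod>i = 1..n. U G' (x i) / mixture_density G0 (x i))}" for G'
    \<comment> \<open>Only brackets at L1 distance at least \<tau> count: near \<open>G0\<close> the
      affinity is too close to 1 for the event to be rare.\<close>
    define Bad2 where "Bad2 G' = (if \<tau> \<le> V G' then {x \<in> space M. t2 \<le> (\<Prod>i = 1..n. sqrt (U G' (x i) / mixture_density G0 (x i)))} else {})" for G'
    have bads: "Bad1 G' \<in> sets M" "Bad2 G' \<in> sets M" "measure M (Bad1 G' \<union> Bad2 G') \<le> 2 * exp 1 / t1" if "G' \<in> N" for G'
    proof -
      have G': "G' \<in> mixing_le k \<Theta>" using that N(2) by blast
      have supp: "finite (set_pmf G)" "snd ` set_pmf G \<subseteq> pos_def_mats" if "G \<in> mixing_le k \<Theta>" for G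
        using mix[OF that] by auto
      note ev = upper_bracket_events[OF supp[OF G0] supp[OF G'] env ienv less_imp_le[OF C] p0C \<eta>0,
          folded U_def J_def V_def]
      show s1: "Bad1 G' \<in> sets M" unfolding Bad1_def by (unfold M_def, rule ev(1)[OF t1(1)])
      show s2: "Bad2 G' \<in> sets M" unfolding Bad2_def using ev(3)[OF t2] by (auto simp: M_def)
      have "measure M (Bad1 G') \<le> (1 + \<eta> * J) ^ n / t1" unfolding Bad1_def by (unfold M_def, rule ev(2)[OF t1(1)])
      also have "\<dots> \<le> exp 1 / t1"
      proof (rule divide_right_mono)
        have "(1 + \<eta> * J) ^ n \<le> exp (real n * (\<eta> * J))" using \<eta>0 J0 by (intro one_plus_power_le_exp) simp
        also have "\<dots> \<le> exp 1" using \<eta>J rn by (simp add: field_simps)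
        finally show "(1 + \<eta> * J) ^ n \<le> exp 1" .
      qed (use t1 in simp)
      finally have 1: "measure M (Bad1 G') \<le> exp 1 / t1" .
      have 2: "measure M (Bad2 G') \<le> exp 1 / t1"
      proof (cases "\<tau> \<le> V G'")
        case True
        have "measure M (Bad2 G') \<le> (1 - (V G')\<^sup>2 / 8 + sqrt (\<eta> * C) * J) ^ n / t2"
          unfolding Bad2_def using True ev(4)[OF t2] by (simp add: M_def)
        also have "\<dots> \<le> exp (1 - K * ln (real n)) / t2"
        proof (rule divide_right_mono)
          have "(1 + (- (V G')\<^sup>2 / 8 + sqrt (\<eta> * C) * J)) ^ n \<le> exp (real n * (- (V G')\<^sup>2 / 8 + sqrt (\<eta> * C) * J))"
            using ev(5)[OF t2] by (intro one_plus_power_le_exp) simp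
          also have "\<dots> \<le> exp (1 - K * ln (real n))"
          proof -
            have "\<tau>\<^sup>2 \<le> (V G')\<^sup>2" using True \<tau>(1) by (intro power_mono)
            then have "- (V G')\<^sup>2 / 8 + sqrt (\<eta> * C) * J \<le> - (K * ln (real n) / real n) + 1 / real n"
              using \<eta>CJ \<tau>(2) by simp
            then have "real n * (- (V G')\<^sup>2 / 8 + sqrt (\<eta> * C) * J) \<le> real n * (- (K * ln (real n) / real n) + 1 / real n)"
              using rn by (intro mult_left_mono) auto
            also have "\<dots> = 1 - K * ln (real n)" using rn by (simp add: field_simps)
            finally show ?thesis by simp
          qed
          finally show "(1 - (V G')\<^sup>2 / 8 + sqrt (\<eta> * C) * J) ^ n \<le> exp (1 - K * ln (real n))" by (simp add: algebra_simps)
        qed (use t2 in simp)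
        also have "\<dots> = exp 1 / t1"
          unfolding t1(2) t2_def by (simp add: K_def field_simps flip: exp_add exp_diff)
        finally show ?thesis .
      qed (use t1 in \<open>simp add: Bad2_def\<close>)
      have "measure M (Bad1 G' \<union> Bad2 G') \<le> measure M (Bad1 G') + measure M (Bad2 G')"
        using s1 s2 by (rule measure_Un_le)
      with 1 2 show "measure M (Bad1 G' \<union> Bad2 G') \<le> 2 * exp 1 / t1" by simp
    qed
    define Bad where "Bad = (\<Union>G'\<in>N. Bad1 G' \<union> Bad2 G')"
    have BadM: "Bad \<in> sets M" unfolding Bad_def using N(1) bads by (intro sets.finite_UN sets.Un) auto
    have "measure M Bad \<le> real (card N) * (2 * exp 1 / t1)"
      unfolding Bad_def using N(1) bads M.finite_measure_axioms by (intro measure_finite_UN_le sets.Un) auto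
    also have "\<dots> \<le> (A1 * real n ^ (2 * D)) * (2 * exp 1 / t1)"
    proof (rule mult_right_mono)
      have "A0 * (1 / h) ^ D = A1 * real n ^ (2 * D)"
        by (simp add: h_def A1_def power_mult_distrib power_mult)
      then show "real (card N) \<le> A1 * real n ^ (2 * D)" using cN by simp
    qed (use t1 in simp)
    also have "\<dots> = 2 * exp 1 * A1 / real n"
      using rn by (simp add: t1_def d_def field_simps)
    also have "\<dots> \<le> A / real n" using A rn by (intro divide_right_mono) auto
    finally have mBad: "measure M Bad \<le> A / real n" .
    have good: "(\<forall>\<theta>\<in>set_pmf G. w \<le> pmf G \<theta>) \<and> (\<forall>t. norm (mixture_cf G t - mixture_cf G0 t) \<le> A * (ln (real n) / sqrt (real n)))"
      if x: "x \<in> space M - Bad" and G: "G \<in> mixing_le k \<Theta>"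
        and pl: "penalized_loglik (ln (real n)) n x G0 \<le> penalized_loglik (ln (real n)) n x G" for x G
    proof -
      from cover G obtain G' where G': "G' \<in> N" and close: "\<And>y. \<bar>mixture_density G y - mixture_density G' y\<bar> \<le> L * h * env y" by blast
      have G'm: "G' \<in> mixing_le k \<Theta>" using G' N(2) by blast
      have pos: "0 < mixture_density G y" "0 < mixture_density G0 y" for y
        using mixture_density_pos[OF mix[OF G]] mixture_density_pos[OF mix[OF G0]] by blast+
      have GU: "mixture_density G y \<le> U G' y" for y using close[of y] unfolding U_def \<eta>_def by linarith
      define S where "S = (\<Sum>i = 1..n. ln (mixture_density G (x i)) - ln (mixture_density G0 (x i)))"
      have prodS: "(\<Prod>i = 1..n. mixture_density G (x i) / mixture_density G0 (x i)) = exp S"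
        unfolding S_def by (rule prod_ratio_ge_iff) (simp add: pos)
      have plS: "ln (real n) * \<rho> \<le> S + ln (real n) * penalty G"
        using pl by (simp add: penalized_loglik_def S_def \<rho>_def sum_subtractf)
      have x1: "x \<in> space M" "x \<notin> Bad1 G'" "x \<notin> Bad2 G'" using x G' by (auto simp: Bad_def)
      have ratio: "mixture_density G (x i) / mixture_density G0 (x i) \<le> U G' (x i) / mixture_density G0 (x i)" for i
        using GU pos by (intro divide_right_mono) (auto simp: less_imp_le)
      have "exp S \<le> (\<Prod>i = 1..n. U G' (x i) / mixture_density G0 (x i))"
        unfolding prodS[symmetric] using ratio pos by (intro prod_mono) (auto simp: less_imp_le)
      also have "\<dots> < exp (real d * ln (real n))" using x1 unfolding Bad1_def t1(2) by auto
      finally have "S < real d * ln (real n)" by simp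
      \<comment> \<open>The upper bound on S, put into the comparison with \<open>G0\<close>,
        becomes a lower bound on the penalty.\<close>
      then have "ln (real n) * (\<rho> - real d) \<le> ln (real n) * penalty G" using plS by (simp add: algebra_simps)
      then have "\<rho> - real d \<le> penalty G" using lnn by simp
      then have wG: "w \<le> exp (penalty G)" by (simp add: w_def)
      have weights: "\<forall>\<theta>\<in>set_pmf G. w \<le> pmf G \<theta>"
        using pmf_ge_exp_penalty[OF mix(1)[OF G]] wG order.trans by blast
      have "ln (real n) * penalty G \<le> 0" using penalty_nonpos[of G] lnn by (simp add: mult_nonneg_nonpos)
      \<comment> \<open>Conversely, the penalty of \<open>G\<close> is nonpositive, so it cannot
        compensate a small likelihood ratio.\<close>
      then have "ln (real n) * \<rho> \<le> S" using plS by linarith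
      then have "t2 \<le> exp (S / 2)" by (simp add: t2_def)
      also have "exp (S / 2) = sqrt (exp S)"
        by (rule real_sqrt_unique[symmetric]) (simp_all add: power2_eq_square flip: exp_add)
      also have "\<dots> = (\<Prod>i = 1..n. sqrt (mixture_density G (x i) / mixture_density G0 (x i)))"
        unfolding prodS[symmetric] by (rule sqrt_prod)
      also have "\<dots> \<le> (\<Prod>i = 1..n. sqrt (U G' (x i) / mixture_density G0 (x i)))"
        using ratio pos by (intro prod_mono) (auto simp: less_imp_le)
      finally have "t2 \<le> (\<Prod>i = 1..n. sqrt (U G' (x i) / mixture_density G0 (x i)))" .
      then have V\<tau>: "V G' < \<tau>" using x1 unfolding Bad2_def by (cases "\<tau> \<le> V G'") auto
      have cf: "norm (mixture_cf G t - mixture_cf G0 t) \<le> A * (ln (real n) / sqrt (real n))" for t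
      proof -
        have iG: "integrable lborel (mixture_density G)" "integrable lborel (mixture_density G')" "integrable lborel (mixture_density G0)"
          using has_bochner_integral_mixture(1)[OF mix[OF G]] has_bochner_integral_mixture(1)[OF mix[OF G'm]] has_bochner_integral_mixture(1)[OF mix[OF G0]]
          by (simp_all add: has_bochner_integral_iff)
        have "norm (mixture_cf G t - mixture_cf G0 t) \<le> (\<integral>y. \<bar>mixture_density G y - mixture_density G0 y\<bar> \<partial>lborel)"
          using mix[OF G] mix[OF G0] by (rule mixture_cf_diff_le)
        also have "\<dots> \<le> (\<integral>y. \<bar>mixture_density G' y - mixture_density G0 y\<bar> + \<eta> * env y \<partial>lborel)"
        proof (rule integral_mono)
          fix y
          show "\<bar>mixture_density G y - mixture_density G0 y\<bar> \<le> \<bar>mixture_density G' y - mixture_density G0 y\<bar> + \<eta> * env y"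
            using close[of y] unfolding \<eta>_def by linarith
        qed (use iG ienv in auto)
        also have "\<dots> = V G' + \<eta> * J" using iG ienv by (simp add: V_def J_def)
        also have "\<dots> \<le> \<tau> + 1 / real n" using V\<tau> \<eta>J by linarith
        also have "\<dots> \<le> A2 * (ln (real n) / sqrt (real n))"
          using rate_bounds[OF n K] unfolding \<tau>_def A2_def distrib_right by linarith
        also have "\<dots> \<le> A * (ln (real n) / sqrt (real n))" using A lnn by (intro mult_right_mono) auto
        finally show ?thesis .
      qed
      show ?thesis using weights cf by blast
    qed
    show "\<exists>Bad\<in>sets (sample_measure G0 n). measure (sample_measure G0 n) Bad \<le> A / real n \<and>
      (\<forall>x\<in>space (sample_measure G0 n) - Bad. \<forall>G\<in>mixing_le k \<Theta>.
       penalized_loglik (ln (real n)) n x G0 \<le> penalized_loglik (ln (real n)) n x G \<longrightarrow>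
       (\<forall>\<theta>\<in>set_pmf G. w \<le> pmf G \<theta>) \<and> (\<forall>t. norm (mixture_cf G t - mixture_cf G0 t) \<le> A * (ln (real n) / sqrt (real n))))"
      unfolding M_def[symmetric] using BadM mBad good by (intro bexI[of _ Bad] conjI ballI impI) blast+
  qed
qed

text \<open>The constant is chosen before \<open>n\<close> and before the estimator, which may be
  any selection of maximizers with measurable loss. Integrability is asserted as well because the
  expectation of a non-integrable function is 0 by convention.\<close>

theorem theorem3:
  fixes a :: real
    and \<Omega> :: "(real^'d::finite^'d) set"
    and k k0 :: nat
    and G0 :: "'d param pmf"
  assumes "a > 0"
    and "compact \<Omega>" and "\<Omega> \<subseteq> pos_def_mats"
    and "\<exists>l u. 0 < l \<and> (\<forall>S\<in>\<Omega>. eigenvalues S \<subseteq> {l..u})"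
    and "param_interior (param_space a \<Omega>) \<noteq> {}"
    and "1 \<le> k0" and "k0 \<le> k"
    and "G0 \<in> mixing_eq k0 (param_space a \<Omega>)"
  shows "\<exists>C>0. \<forall>n\<ge>2. \<forall>Ghat :: (nat \<Rightarrow> real^'d) \<Rightarrow> 'd param pmf.
    (\<forall>x\<in>space (sample_measure G0 n).
       is_penalized_mle (param_space a \<Omega>) k (ln (real n)) n x (Ghat x)) \<longrightarrow>
    (\<lambda>x. mixing_loss (Ghat x) G0) \<in> borel_measurable (sample_measure G0 n) \<longrightarrow>
    integrable (sample_measure G0 n) (\<lambda>x. mixing_loss (Ghat x) G0) \<and>
    prob_space.expectation (sample_measure G0 n) (\<lambda>x. mixing_loss (Ghat x) G0)
      \<le> C * (ln (real n) / sqrt (real n))"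
proof -
  define \<Theta> where "\<Theta> = param_space a \<Omega>"
  have "{\<mu> :: real^'d. \<forall>i. \<mu> $ i \<in> {- a..a}} = cbox (\<chi> i. - a) (\<chi> i. a)"
    by (auto simp: mem_box Basis_vec_real)
  then have \<Theta>: "compact \<Theta>" "snd ` \<Theta> \<subseteq> pos_def_mats"
    using assms(2,3) by (auto simp: \<Theta>_def param_space_def intro!: compact_Times)
  have G0: "G0 \<in> mixing_le k \<Theta>"
    using assms(7,8) by (auto simp: mixing_eq_def mixing_le_def \<Theta>_def)
  have mixG0: "finite (set_pmf G0)" "\<And>\<theta>. \<theta> \<in> set_pmf G0 \<Longrightarrow> snd \<theta> \<in> pos_def_mats"
    using G0 \<Theta>(2) by (auto simp: mixing_le_def)
  from penalized_mle_good_event[OF \<Theta> G0] obtain A w where A: "A > 0" and w: "w > 0" and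
    good: "\<forall>n\<ge>2. \<exists>Bad\<in>sets (sample_measure G0 n). measure (sample_measure G0 n) Bad \<le> A / real n \<and>
    (\<forall>x\<in>space (sample_measure G0 n) - Bad. \<forall>G\<in>mixing_le k \<Theta>.
       penalized_loglik (ln (real n)) n x G0 \<le> penalized_loglik (ln (real n)) n x G \<longrightarrow>
       (\<forall>\<theta>\<in>set_pmf G. w \<le> pmf G \<theta>) \<and> (\<forall>t. norm (mixture_cf G t - mixture_cf G0 t) \<le> A * (ln (real n) / sqrt (real n))))"
    by (elim exE conjE)
  from mixing_loss_cf_bound[OF \<Theta> G0 w] obtain C1 where C1: "C1 > 0" and
    inverse: "\<forall>G\<in>mixing_le k \<Theta>. \<forall>M. (\<forall>\<theta>\<in>set_pmf G. w \<le> pmf G \<theta>) \<longrightarrow>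
    (\<forall>t. norm (mixture_cf G t - mixture_cf G0 t) \<le> M) \<longrightarrow> mixing_loss G G0 \<le> C1 * M" by (elim exE conjE)
  from mixing_loss_bounded[OF compact_imp_bounded[OF \<Theta>(1)] G0] obtain L where L: "L > 0"
    "\<And>G. G \<in> mixing_le k \<Theta> \<Longrightarrow> mixing_loss G G0 \<le> L" by blast
  \<comment> \<open>The inverse bound on the good event, plus the crude bound \<open>L\<close> times
    the probability A/n of the bad event, with 1/n compared to the rate.\<close>
  define C where "C = C1 * A + L * A / ln 2"
  have C: "C > 0" using C1 A L by (simp add: C_def add_pos_pos)
  show ?thesis
  proof (rule exI[of _ C], rule conjI[OF C], intro allI impI)
    fix n :: nat and Ghat :: "(nat \<Rightarrow> real^'d) \<Rightarrow> 'd param pmf"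
    assume n: "2 \<le> n"
      and mle: "\<forall>x\<in>space (sample_measure G0 n). is_penalized_mle (param_space a \<Omega>) k (ln (real n)) n x (Ghat x)"
      and meas: "(\<lambda>x. mixing_loss (Ghat x) G0) \<in> borel_measurable (sample_measure G0 n)"
    define M where "M = sample_measure G0 n"
    interpret M: prob_space M unfolding M_def using mixG0 by (rule prob_space_sample_measure)
    define r where "r = ln (real n) / sqrt (real n)"
    have r: "0 \<le> r" using n by (simp add: r_def)
    from good n obtain Bad where Bad: "Bad \<in> sets M" "measure M Bad \<le> A / real n"
      and gd: "\<forall>x\<in>space M - Bad. \<forall>G\<in>mixing_le k \<Theta>.
       penalized_loglik (ln (real n)) n x G0 \<le> penalized_loglik (ln (real n)) n x G \<longrightarrow>
       (\<forall>\<theta>\<in>set_pmf G. w \<le> pmf G \<theta>) \<and> (\<forall>t. norm (mixture_cf G t - mixture_cf G0 t) \<le> A * r)"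
      unfolding M_def r_def by blast
    \<comment> \<open>The maximizer enters only through its comparison with \<open>G0\<close>,
      itself a competitor since \<open>k0 \<le> k\<close>.\<close>
    have Gh: "Ghat x \<in> mixing_le k \<Theta>" "penalized_loglik (ln (real n)) n x G0 \<le> penalized_loglik (ln (real n)) n x (Ghat x)"
      if "x \<in> space M" for x
      using mle that G0 by (auto simp: M_def is_penalized_mle_def is_arg_max_def \<Theta>_def not_less)
    have bound: "mixing_loss (Ghat x) G0 \<le> C1 * (A * r) + L * indicator Bad x" if x: "x \<in> space M" for x
    proof (cases "x \<in> Bad")
      case True
      have "0 \<le> C1 * (A * r)" using C1 A r by simp
      then show ?thesis using L(2)[OF Gh(1)[OF x]] True by simp
    next
      case False
      then have "(\<forall>\<theta>\<in>set_pmf (Ghat x). w \<le> pmf (Ghat x) \<theta>) \<and> (\<forall>t. norm (mixture_cf (Ghat x) t - mixture_cf G0 t) \<le> A * r)"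
        using gd x Gh[OF x] by blast
      then have "mixing_loss (Ghat x) G0 \<le> C1 * (A * r)" using inverse Gh(1)[OF x] by blast
      then show ?thesis using False by simp
    qed
    have int: "integrable M (\<lambda>x. mixing_loss (Ghat x) G0)"
      using meas L(2) Gh(1) mixing_loss_nonneg[of _ G0]
      by (intro M.integrable_const_bound[where B = L] AE_I2) (auto simp: M_def[symmetric])
    have "M.expectation (\<lambda>x. mixing_loss (Ghat x) G0) \<le> M.expectation (\<lambda>x. C1 * (A * r) + L * indicator Bad x)"
      using int bound Bad(1) by (intro integral_mono) (auto simp: M.emeasure_eq_measure)
    also have "\<dots> = C1 * (A * r) + L * measure M Bad"
      using Bad(1) by (simp add: M.prob_space M.emeasure_eq_measure)
    also have "\<dots> \<le> C1 * (A * r) + L * (A / real n)"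
      using Bad(2) L by (intro add_left_mono mult_left_mono) auto
    also have "\<dots> \<le> C1 * (A * r) + L * (A * (1 / ln 2 * r))"
    proof -
      have "A / real n = A * (1 / real n)" by simp
      also have "\<dots> \<le> A * (1 / ln 2 * r)" using rate_bounds(2)[OF n order.refl] A unfolding r_def by (intro mult_left_mono) auto
      finally show ?thesis using L by (intro add_left_mono mult_left_mono) auto
    qed
    also have "\<dots> = C * r" by (simp add: C_def algebra_simps)
    finally show "integrable (sample_measure G0 n) (\<lambda>x. mixing_loss (Ghat x) G0) \<and>
      prob_space.expectation (sample_measure G0 n) (\<lambda>x. mixing_loss (Ghat x) G0) \<le> C * (ln (real n) / sqrt (real n))"
      using int unfolding M_def r_def by blast
  qed
qed

end
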